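(* Let $0<n<+\infty$, $0\le j<+\infty$ and $\vartheta:=\frac jn+\frac d{2n}$, and assume $\vartheta<1$. The Gagliardo-Nirenberg inequality $$H^n\subset\mathcal L^{2,\infty,j},\qquad\|D^jf\|_{\mathcal L^\infty}\le G\,\|f\|^{1-\vartheta}_{\mathcal L^2}\|D^nf\|^{\vartheta}_{\mathcal L^2}\quad\text{for some } G\in[0,+\infty)\text{ and all } f\in H^n$$ holds, and its sharp constant $G(j,n)$ is given by $$G(j,n)=\frac{S(j,n)}{\sqrt{(1-\vartheta)^{1-\vartheta}\vartheta^\vartheta}}=\frac1{2^{d/2}\pi^{d/4-1/2}\sqrt{\Gamma(d/2)\,(1-\vartheta)^{1-\vartheta}\vartheta^\vartheta\,n\,\sin(\pi\vartheta)}},$$ where $S(j,n)$ is the sharp constant of the inequality $\|D^jf\|_{\mathcal L^\infty}\le S\sqrt{\|f\|^2_{\mathcal L^2}+\|D^nf\|^2_{\mathcal L^2}}$ for all $f\in H^n$. The function $$f:=\mathcal F^{-1}\Big(\frac{|k|^j}{1+|k|^{2n}}\Big)$$ is a maximizer for the Gagliardo-Nirenberg inequality above.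
   Context: Fix $d\in\{1,2,3,\dots\}$; functions are complex-valued on $\mathbb R^d$. $\mathcal S$ is the Schwartz space; the Fourier transform is $\mathcal F\varphi(k)=(2\pi)^{-d/2}\int_{\mathbb R^d}e^{-ik\cdot x}\varphi(x)\,dx$. $\Phi:=\{\phi\in\mathcal S:\int x_{i_1}\cdots x_{i_m}\phi(x)dx=0 \text{ for all } m\ge 0, i_1,\dots,i_m\}$ and $\Psi:=\{\psi\in\mathcal S: \partial_{i_1\cdots i_m}\psi(0)=0\text{ for all } m\ge0,i_1,\dots,i_m\}$ are closed subspaces of $\mathcal S$ with $\mathcal F\Phi=\Psi$; $\Phi',\Psi'$ are their topological duals. $\mathcal F:\Phi'\to\Psi'$ is the bijection $\langle\mathcal Ff,\psi\rangle:=\langle f,\mathcal F^{-1}\psi_R\rangle$, $\psi_R(k)=\psi(-k)$. For $s\in\mathbb R$ and $g\in\Psi'$, $|k|^sg\in\Psi'$ is $\langle|k|^sg,\psi\rangle:=\langle g,|k|^s\psi\rangle$, and $D^s:\Phi'\to\Phi'$ is the bijection $D^sf:=\mathcal F^{-1}(|k|^s\mathcal Ff)$ (so $D=\sqrt{-\Delta}$). $\mathcal L^p:=L^p(\mathbb R^d,\mathbb C)$ for $p\in[1,+\infty)$, while $\mathcal L^\infty:=C_0(\mathbb R^d,\mathbb C)$ (continuous functions vanishing at infinity, sup norm). A function $f\in\mathcal L^p$ is identified with the element $\phi\mapsto\int f\phi$ of $\Phi'$ (this map is injective). $H^n:=\{f\in\mathcal L^2:D^nf\in\mathcal L^2\}$,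 $\mathcal L^{2,\infty,j}:=\{f\in\mathcal L^2:D^jf\in\mathcal L^\infty\}$. The sharp constant is the smallest constant for which an inequality holds; a maximizer is a nonzero $f\in H^n$ for which the inequality with the sharp constant is an equality. *)

theory Defs
  imports "HOL-Analysis.Analysis"
begin

type_synonym 'd fn = "real ^ 'd \<Rightarrow> complex"
type_synonym 'd functional = "'d fn \<Rightarrow> complex"

definition partial :: "'d::finite \<Rightarrow> 'd fn \<Rightarrow> 'd fn" where
  "partial i f = (\<lambda>x. frechet_derivative f (at x) (axis i 1))"

definition partials :: "'d::finite list \<Rightarrow> 'd fn \<Rightarrow> 'd fn" where
  "partials is f = foldr partial is f"

definition smooth :: "'d::finite fn \<Rightarrow> bool" where
  "smooth f \<longleftrightarrow> (\<forall>is x. partials is f differentiable (at x))"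

definition schwartz :: "'d::finite fn set" where
  "schwartz = {f. smooth f \<and>
     (\<forall>N is. bdd_above (range (\<lambda>x. (1 + norm x) ^ N * norm (partials is f x))))}"

definition schwartz_seminorm :: "nat \<Rightarrow> 'd::finite list \<Rightarrow> 'd fn \<Rightarrow> real" where
  "schwartz_seminorm N is f = (SUP x. (1 + norm x) ^ N * norm (partials is f x))"

definition schwartz_topology :: "'d::finite fn topology" where
  "schwartz_topology = topology_generated_by
     {{g \<in> schwartz. schwartz_seminorm N is (\<lambda>x. g x - f x) < e} | N is f e.
        f \<in> schwartz \<and> 0 < e}"

definition Phi :: "'d::finite fn set" where
  "Phi = {\<phi> \<in> schwartz. \<forall>is. (LINT x|lborel. of_real (\<Prod>i\<leftarrow>is. x $ i) * \<phi> x) = 0}"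

definition Psi :: "'d::finite fn set" where
  "Psi = {\<psi> \<in> schwartz. \<forall>is. partials is \<psi> 0 = 0}"

definition fourier :: "'d::finite fn \<Rightarrow> 'd fn" where
  "fourier \<phi> = (\<lambda>k. of_real ((2 * pi) powr (- real CARD('d) / 2)) *
     (LINT x|lborel. exp (- (\<i> * of_real (k \<bullet> x))) * \<phi> x))"

text \<open>The topological dual of a linear subspace \<open>V\<close> of the Schwartz space. Functionals are
  extensional (\<open>undefined\<close> outside \<open>V\<close>), so that HOL equality is equality on \<open>V\<close>.\<close>

definition dual :: "'d::finite fn set \<Rightarrow> 'd functional set" where
  "dual V = {T \<in> extensional V.
     (\<forall>\<phi>\<in>V. \<forall>\<eta>\<in>V. T (\<lambda>x. \<phi> x + \<eta> x) = T \<phi> + T \<eta>) \<and>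
     (\<forall>c. \<forall>\<phi>\<in>V. T (\<lambda>x. c * \<phi> x) = c * T \<phi>) \<and>
     continuous_map (subtopology schwartz_topology V) euclidean T}"

definition as_functional :: "'d::finite fn set \<Rightarrow> 'd fn \<Rightarrow> 'd functional" where
  "as_functional V f = (\<lambda>\<phi>\<in>V. LINT x|lborel. f x * \<phi> x)"

definition fourier_dual :: "'d::finite functional \<Rightarrow> 'd functional" where
  "fourier_dual f = (\<lambda>\<psi>\<in>Psi. f (inv_into schwartz fourier (\<lambda>k. \<psi> (- k))))"

definition inv_fourier_dual :: "'d::finite functional \<Rightarrow> 'd functional" where
  "inv_fourier_dual = inv_into (dual Phi) fourier_dual"

text \<open>Here \<open>0 powr s = 0\<close> for every \<open>s\<close>, also for \<open>s \<le> 0\<close>; this is harmless since every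
  \<open>\<psi>\<close> in \<open>Psi\<close> vanishes at the origin to infinite order.\<close>

definition mult_norm_powr :: "real \<Rightarrow> 'd::finite functional \<Rightarrow> 'd functional" where
  "mult_norm_powr s g = (\<lambda>\<psi>\<in>Psi. g (\<lambda>k. of_real (norm k powr s) * \<psi> k))"

definition frac_deriv :: "real \<Rightarrow> 'd::finite functional \<Rightarrow> 'd functional" where
  "frac_deriv s f = inv_fourier_dual (mult_norm_powr s (fourier_dual f))"

definition L2_fun :: "'d::finite fn set" where
  "L2_fun = {f \<in> borel_measurable lborel. integrable lborel (\<lambda>x. (norm (f x))\<^sup>2)}"

definition C0_fun :: "'d::finite fn set" where
  "C0_fun = {f. continuous_on UNIV f \<and> (f \<longlongrightarrow> 0) at_infinity}"

text \<open>As the identification of functions with functionals on \<open>Phi\<close> is injective (up to null sets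
  in the case of \<open>L2\<close>), the norms below do not depend on the representative that
  \<open>inv_into\<close> selects.\<close>

definition L2 :: "'d::finite functional set" where
  "L2 = as_functional Phi ` L2_fun"

definition L2_norm :: "'d::finite functional \<Rightarrow> real" where
  "L2_norm T = sqrt (LINT x|lborel. (norm (inv_into L2_fun (as_functional Phi) T x))\<^sup>2)"

definition Linf :: "'d::finite functional set" where
  "Linf = as_functional Phi ` C0_fun"

definition Linf_norm :: "'d::finite functional \<Rightarrow> real" where
  "Linf_norm T = (SUP x. norm (inv_into C0_fun (as_functional Phi) T x))"

definition H :: "real \<Rightarrow> 'd::finite functional set" where
  "H n = {f \<in> L2. frac_deriv n f \<in> L2}"

definition L2inf :: "real \<Rightarrow> 'd::finite functional set" where
  "L2inf j = {f \<in> L2. frac_deriv j f \<in> Linf}"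

definition is_sharp_constant :: "(real \<Rightarrow> bool) \<Rightarrow> real \<Rightarrow> bool" where
  "is_sharp_constant P C \<longleftrightarrow> 0 \<le> C \<and> P C \<and> (\<forall>C'\<ge>0. P C' \<longrightarrow> C \<le> C')"

definition GN_inequality :: "real \<Rightarrow> real \<Rightarrow> real \<Rightarrow> real \<Rightarrow> 'd::finite functional \<Rightarrow> bool" where
  "GN_inequality j n \<theta> G f \<longleftrightarrow>
     Linf_norm (frac_deriv j f) \<le> G * L2_norm f powr (1 - \<theta>) * L2_norm (frac_deriv n f) powr \<theta>"

definition S_inequality :: "real \<Rightarrow> real \<Rightarrow> real \<Rightarrow> 'd::finite functional \<Rightarrow> bool" where
  "S_inequality j n S f \<longleftrightarrow>
     Linf_norm (frac_deriv j f) \<le> S * sqrt ((L2_norm f)\<^sup>2 + (L2_norm (frac_deriv n f))\<^sup>2)"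

definition GN_maximizer :: "real \<Rightarrow> real \<Rightarrow> real \<Rightarrow> real \<Rightarrow> 'd::finite functional \<Rightarrow> bool" where
  "GN_maximizer j n \<theta> G f \<longleftrightarrow> f \<in> H n \<and> f \<noteq> as_functional Phi (\<lambda>_. 0) \<and>
     Linf_norm (frac_deriv j f) = G * L2_norm f powr (1 - \<theta>) * L2_norm (frac_deriv n f) powr \<theta>"

end

theory Submission
  imports Defs "HOL-Probability.Characteristic_Functions" "HOL-Probability.Sinc_Integral"
begin

text \<open>
  The inequality is a weighted Cauchy-Schwarz inequality on the Fourier side. An element of
  \<open>H n\<close> is described by a density \<open>g\<close>, its Fourier transform: both \<open>g\<close> and \<open>|k|^n g\<close> are square
  integrable, their norms are the two norms on the right-hand side (Plancherel), and the
  derivative of order \<open>j\<close> is the inverse Fourier transform of \<open>|k|^j g\<close>. Write \<open>A\<close> and \<open>B\<close> for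
  the squared norms of \<open>g\<close> and \<open>|k|^n g\<close>. For every \<open>l > 0\<close>
    \<open>(\<integral> |k|^j |g|)^2 \<le> I(l) (A + l B)\<close>, where \<open>I(l) = \<integral> |k|^(2j) / (1 + l |k|^(2n))\<close>,
  and \<open>I(l) = l^(-\<theta>) I(1)\<close> is finite because \<open>0 < \<theta> < 1\<close> (\<open>weighted_L1_bound\<close>,
  \<open>radial_integral\<close>). Hence \<open>|k|^j g\<close> is integrable, its inverse transform is continuous, vanishes
  at infinity (\<open>riemann_lebesgue\<close>) and is bounded by \<open>(2 \<pi>)^(-d/2)\<close> times the \<open>L1\<close> norm of
  \<open>|k|^j g\<close>. The choice \<open>l = 1\<close> gives the constant \<open>S\<close>; the best choice of \<open>l\<close> gives \<open>G\<close>
  (\<open>weighted_L1_bound_optimal\<close>).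

  With these constants both inequalities are equalities for \<open>g = |k|^j / (1 + |k|^(2n))\<close>. Since \<open>|k|^j g \<ge> 0\<close>, the
  supremum is attained at the origin and equals \<open>(2 \<pi>)^(-d/2) I(1)\<close>, and \<open>A + B = I(1)\<close>. The
  bound for general \<open>l\<close> says that \<open>l^(-\<theta>) (A + l B)\<close> is at least \<open>I(1)\<close>, with equality at
  \<open>l = 1\<close>; the derivative vanishes there, so that \<open>B = \<theta> I(1)\<close> and \<open>A = (1 - \<theta>) I(1)\<close>
  (\<open>maximizer_density\<close>). The value of \<open>I(1)\<close> comes from the law of \<open>|k|^(2n)\<close> under Lebesgue
  measure and from the reflection formula of the Gamma function.

  The spaces of the theorem consist of functionals on \<open>Phi\<close>. For \<open>g\<close> of at most polynomial growth
  in the mean (\<open>tempered\<close>), \<open>spectral g\<close> is the functional whose Fourier transform is \<open>g\<close>. These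
  functionals lie in the dual of \<open>Phi\<close>, and \<open>frac_deriv s\<close> multiplies \<open>g\<close> by \<open>|k|^s\<close>
  (\<open>spectral_in_dual\<close>, \<open>frac_deriv_spectral\<close>). Two uniqueness statements make the norms
  computable: a tempered density that annihilates \<open>Psi\<close> is zero almost everywhere
  (\<open>Psi_annihilator\<close>), and a function in \<open>C0_fun\<close> that annihilates \<open>Phi\<close> is zero
  (\<open>C0_Phi_annihilator\<close>). Both are tested on Gaussians times a cutoff that is flat at the origin.

  The Fourier analysis rests on one identity, \<open>fourier_regularised_inversion\<close>: damping the inversion
  integral by a Gaussian replaces \<open>f\<close> by its Gaussian average. Inversion for Schwartz functions,
  uniqueness for integrable functions and the bound of the \<open>L2\<close> norm of a transform by that of the
  function are limits of it. For \<open>L2\<close> only this contraction is proved directly; the transform and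
  its inverse are both contractions, and therefore isometries.
\<close>

section \<open>The Fourier kernel and integrals over Euclidean space\<close>

definition wave :: "real ^ 'd::finite \<Rightarrow> real ^ 'd \<Rightarrow> complex" where
  "wave k x = exp (- (\<i> * of_real (k \<bullet> x)))"

definition fconst :: "'d::finite itself \<Rightarrow> real" where
  "fconst _ = (2 * pi) powr (- real CARD('d) / 2)"

text \<open>Without a normalising factor, so that \<open>gauss\<close> is its own Fourier transform.\<close>

definition gauss :: "real ^ 'd::finite \<Rightarrow> real" where
  "gauss x = exp (- (x \<bullet> x) / 2)"

lemma fourier_eq:
  fixes f :: "'d::finite fn"
  shows "fourier f k = of_real (fconst TYPE('d)) * (LINT x|lborel. wave k x * f x)"
  by (simp add: fourier_def fconst_def wave_def)

lemma fconst_pos: "0 < fconst TYPE('d::finite)"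
  by (simp add: fconst_def)

lemma norm_wave [simp]: "norm (wave k x) = 1"
  by (simp add: wave_def norm_exp_eq_Re)

lemma wave_commute: "wave k x = wave x k"
  by (simp add: wave_def inner_commute)

lemma wave_add: "wave (k + l) x = wave k x * wave l x"
  by (simp add: wave_def inner_add_left algebra_simps flip: exp_add)

lemma wave_add_right: "wave k (x + y) = wave k x * wave k y"
  by (simp add: wave_def inner_add_right algebra_simps flip: exp_add)

lemma wave_minus_minus [simp]: "wave (- k) (- x) = wave k x"
  by (simp add: wave_def)

lemma wave_minus_right: "wave k (- x) = wave (- k) x"
  by (simp add: wave_def)

lemma wave_0 [simp]: "wave 0 x = 1" "wave x 0 = 1"
  by (simp_all add: wave_def)

lemma cnj_wave: "cnj (wave k x) = wave (- k) x"
  by (simp add: wave_def exp_cnj)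

lemma measurable_wave [measurable]:
  assumes [measurable]: "f \<in> borel_measurable M" "g \<in> borel_measurable M"
  shows "(\<lambda>x. wave (f x) (g x)) \<in> borel_measurable M"
  unfolding wave_def by measurable

lemma measurable_gauss [measurable]: "gauss \<in> borel_measurable borel"
  unfolding gauss_def by measurable

lemma gauss_pos: "0 < gauss x" and gauss_le_1: "gauss x \<le> 1" and gauss_0 [simp]: "gauss 0 = 1"
  by (simp_all add: gauss_def)

lemma abs_gauss [simp]: "\<bar>gauss x\<bar> = gauss x" and gauss_nonneg [simp]: "0 \<le> gauss x"
  using gauss_pos[of x] by simp_all

lemma integrable_mult_bounded:
  fixes f g :: "'a \<Rightarrow> complex"
  assumes "integrable M f" and [measurable]: "g \<in> borel_measurable M" and "\<And>x. norm (g x) \<le> B"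
  shows "integrable M (\<lambda>x. g x * f x)"
proof -
  have "integrable M (\<lambda>x. B * norm (f x))" using assms(1) by simp
  then show ?thesis
    by (rule Bochner_Integration.integrable_bound)
       (use assms in \<open>auto simp: norm_mult intro!: mult_right_mono AE_I2 order_trans[OF _ abs_ge_self]\<close>)
qed

lemma integrable_wave:
  assumes "integrable lborel f"
  shows "integrable lborel (\<lambda>x. wave k x * f x)"
  by (rule integrable_mult_bounded[OF assms, where B = 1]) auto

lemma lborel_prod_basis:
  fixes f :: "'a::euclidean_space \<Rightarrow> real \<Rightarrow> 'b::{real_normed_field,banach,second_countable_topology}"
  assumes "\<And>b. b \<in> Basis \<Longrightarrow> integrable lborel (f b)"
  shows "integrable lborel (\<lambda>x. \<Prod>b\<in>Basis. f b (x \<bullet> b))"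
    and "(LINT x|lborel. (\<Prod>b\<in>Basis. f b (x \<bullet> b))) = (\<Prod>b\<in>Basis. (LINT t|lborel. f b t))"
proof -
  interpret product_sigma_finite "\<lambda>_::'a. lborel :: real measure" ..
  let ?P = "\<Pi>\<^sub>M b\<in>(Basis::'a set). (lborel :: real measure)"
  let ?T = "\<lambda>g. \<Sum>b\<in>(Basis::'a set). g b *\<^sub>R b"
  have [measurable]: "f b \<in> borel_measurable borel" if "b \<in> Basis" for b
    using borel_measurable_integrable[OF assms[OF that]] by simp
  have T: "?T \<in> ?P \<rightarrow>\<^sub>M borel" by measurable
  have m: "(\<lambda>x. \<Prod>b\<in>Basis. f b (x \<bullet> b)) \<in> borel_measurable borel" by measurable
  have eq: "(\<Prod>b\<in>Basis. f b (?T g \<bullet> b)) = (\<Prod>b\<in>Basis. f b (g b))" for g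
    by (intro prod.cong refl) (simp add: inner_sum_left inner_Basis if_distrib cong: if_cong)
  show "integrable lborel (\<lambda>x. \<Prod>b\<in>Basis. f b (x \<bullet> b))"
    by (subst lborel_eq, subst integrable_distr_eq[OF T m], subst eq)
       (rule product_integrable_prod[OF finite_Basis assms])
  show "(LINT x|lborel. (\<Prod>b\<in>Basis. f b (x \<bullet> b))) = (\<Prod>b\<in>Basis. (LINT t|lborel. f b t))"
    by (subst lborel_eq, subst integral_distr[OF T m], subst eq)
       (rule product_integral_prod[OF finite_Basis assms])
qed

lemma integrable_inverse_1_plus_sq: "integrable lborel (\<lambda>x::real. inverse (1 + x\<^sup>2))"
  using integrable_inverse_1_plus_square by (simp add: set_integrable_def einterval_def)

text \<open>The square of \<open>1 + norm x\<close> dominates \<open>1 + x_b^2\<close> for each coordinate, so the weight is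
  dominated by a product of integrable functions of one variable.\<close>

lemma integrable_weight:
  "integrable lborel (\<lambda>x::real ^ 'd::finite. inverse ((1 + norm x) ^ (2 * CARD('d))))"
proof (rule Bochner_Integration.integrable_bound)
  show "integrable lborel (\<lambda>x::real^'d. \<Prod>b\<in>Basis. inverse (1 + (x \<bullet> b)\<^sup>2))"
    by (rule lborel_prod_basis(1)) (rule integrable_inverse_1_plus_sq)
  have "inverse ((1 + norm x) ^ (2 * CARD('d))) \<le> (\<Prod>b\<in>Basis. inverse (1 + (x \<bullet> b)\<^sup>2))" for x :: "real^'d"
  proof -
    have "inverse ((1 + norm x) ^ (2 * CARD('d))) = (\<Prod>b\<in>(Basis::(real^'d) set). inverse ((1 + norm x)\<^sup>2))"
      by (simp add: power_mult power_inverse)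
    also have "\<dots> \<le> (\<Prod>b\<in>Basis. inverse (1 + (x \<bullet> b)\<^sup>2))"
    proof (intro prod_mono conjI le_imp_inverse_le)
      fix b :: "real^'d" assume "b \<in> Basis"
      have "(x \<bullet> b)\<^sup>2 \<le> (norm x)\<^sup>2"
        using Basis_le_norm[OF \<open>b \<in> Basis\<close>, of x] abs_le_square_iff[of "x \<bullet> b" "norm x"] by simp
      then show "1 + (x \<bullet> b)\<^sup>2 \<le> (1 + norm x)\<^sup>2" by (simp add: power2_sum add_increasing2)
      show "0 < 1 + (x \<bullet> b)\<^sup>2" by (simp add: add_pos_nonneg)
    qed simp
    finally show ?thesis .
  qed
  moreover have "0 \<le> (\<Prod>b\<in>Basis. inverse (1 + (x \<bullet> b)\<^sup>2))" for x :: "real^'d"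
    by (intro prod_nonneg) simp
  ultimately have "norm (inverse ((1 + norm x) ^ (2 * CARD('d)))) \<le> norm (\<Prod>b\<in>Basis. inverse (1 + (x \<bullet> b)\<^sup>2))" for x :: "real^'d"
    using abs_of_nonneg[of "\<Prod>b\<in>Basis. inverse (1 + (x \<bullet> b)\<^sup>2)"] by (simp add: abs_of_nonneg)
  then show "AE x in lborel. norm (inverse ((1 + norm x) ^ (2 * CARD('d))))
      \<le> norm (\<Prod>b\<in>(Basis::(real^'d) set). inverse (1 + (x \<bullet> b)\<^sup>2))"
    by simp
qed simp

lemma nn_integral_lborel_affine:
  fixes t :: "'a::euclidean_space"
  assumes [measurable]: "f \<in> borel_measurable borel" and c: "c \<noteq> 0"
  shows "(\<integral>\<^sup>+x. f x \<partial>lborel) = ennreal (\<bar>c\<bar> ^ DIM('a)) * (\<integral>\<^sup>+x. f (t + c *\<^sub>R x) \<partial>lborel)"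
  by (subst lborel_affine[OF c, of t])
     (simp add: nn_integral_density nn_integral_distr nn_integral_cmult)

lemma integrable_lborel_affine:
  fixes t :: "'a::euclidean_space" and f :: "'a \<Rightarrow> 'b::{banach, second_countable_topology}"
  assumes "integrable lborel f" and c: "c \<noteq> 0"
  shows "integrable lborel (\<lambda>x. f (t + c *\<^sub>R x))"
proof -
  have [measurable]: "f \<in> borel_measurable borel" using assms by auto
  have "(\<integral>\<^sup>+x. norm (f x) \<partial>lborel) < \<infinity>"
    using assms by (simp add: integrable_iff_bounded)
  then have "ennreal (\<bar>c\<bar> ^ DIM('a)) * (\<integral>\<^sup>+x. norm (f (t + c *\<^sub>R x)) \<partial>lborel) < \<infinity>"
    by (subst (asm) nn_integral_lborel_affine[OF _ c, of _ t]) auto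
  then have "(\<integral>\<^sup>+x. norm (f (t + c *\<^sub>R x)) \<partial>lborel) < \<infinity>"
    using c by (auto simp: ennreal_mult_less_top)
  then show ?thesis by (simp add: integrable_iff_bounded)
qed

lemma integral_lborel_affine:
  fixes t :: "'a::euclidean_space" and f :: "'a \<Rightarrow> 'b::{banach, second_countable_topology}"
  assumes [measurable]: "f \<in> borel_measurable borel" and c: "c \<noteq> 0"
  shows "(LINT x|lborel. f x) = \<bar>c\<bar> ^ DIM('a) *\<^sub>R (LINT x|lborel. f (t + c *\<^sub>R x))"
  by (subst lborel_affine[OF c, of t]) (simp add: integral_density integral_distr)

lemma integral_lborel_shift:
  fixes t :: "'a::euclidean_space" and f :: "'a \<Rightarrow> 'b::{banach, second_countable_topology}"
  assumes "f \<in> borel_measurable borel"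
  shows "(LINT x|lborel. f (t + x)) = (LINT x|lborel. f x)"
  using integral_lborel_affine[OF assms, of 1 t] by simp

lemma integral_lborel_reflect:
  fixes f :: "'a::euclidean_space \<Rightarrow> 'b::{banach, second_countable_topology}"
  assumes "f \<in> borel_measurable borel"
  shows "(LINT x|lborel. f (- x)) = (LINT x|lborel. f x)"
  using integral_lborel_affine[OF assms, of "-1" 0] by simp

lemma gauss_prod: "gauss x = (\<Prod>b\<in>Basis. exp (- (x \<bullet> b)\<^sup>2 / 2))"
  by (simp add: gauss_def euclidean_inner[of x x] power2_eq_square exp_sum[symmetric] sum_divide_distrib sum_negf)

lemma gauss_1d:
  "integrable lborel (\<lambda>t::real. exp (- (\<i> * of_real (s * t))) * of_real (exp (- t\<^sup>2 / 2)))"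
  "(LINT t|lborel. exp (- (\<i> * of_real (s * t))) * of_real (exp (- t\<^sup>2 / 2)))
     = of_real (sqrt (2 * pi) * exp (- s\<^sup>2 / 2))"
proof -
  have int: "integrable lborel (\<lambda>t::real. of_real (std_normal_density t) :: complex)"
    using integrable_normal_density[of 1 0] by (simp add: integrable_of_real)
  have e: "exp (- t\<^sup>2 / 2) = sqrt (2 * pi) * std_normal_density t" for t :: real
    by (simp add: std_normal_density_def)
  have "integrable lborel (\<lambda>t::real. exp (- (\<i> * of_real (s * t))) * of_real (std_normal_density t))"
    by (rule integrable_mult_bounded[OF int, where B = 1]) (auto simp: norm_exp_eq_Re)
  then show "integrable lborel (\<lambda>t::real. exp (- (\<i> * of_real (s * t))) * of_real (exp (- t\<^sup>2 / 2)))"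
    unfolding e of_real_mult by (simp add: mult.left_commute)
  have "char std_normal_distribution (- s) = of_real (exp (- s\<^sup>2 / 2))"
    by (simp add: char_std_normal_distribution)
  then have "(LINT t|lborel. exp (- (\<i> * of_real (s * t))) * of_real (std_normal_density t)) = of_real (exp (- s\<^sup>2 / 2))"
    unfolding char_def
    by (subst (asm) integral_density) (auto simp: scaleR_conv_of_real mult.commute)
  then show "(LINT t|lborel. exp (- (\<i> * of_real (s * t))) * of_real (exp (- t\<^sup>2 / 2)))
     = of_real (sqrt (2 * pi) * exp (- s\<^sup>2 / 2))"
    unfolding e of_real_mult by (simp add: mult.left_commute)
qed

text \<open>Over an orthonormal basis the integral is a product of one-dimensional ones, each of them the
  characteristic function of a normal distribution.\<close>

lemma wave_gauss:
  fixes k :: "real ^ 'd::finite"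
  shows "integrable lborel (\<lambda>x. wave k x * of_real (gauss x))"
    and "of_real (fconst TYPE('d)) * (LINT x|lborel. wave k x * of_real (gauss x)) = of_real (gauss k)"
proof -
  have eq: "wave k x * of_real (gauss x)
     = (\<Prod>b\<in>Basis. exp (- (\<i> * of_real ((k \<bullet> b) * (x \<bullet> b)))) * of_real (exp (- (x \<bullet> b)\<^sup>2 / 2)))" for x
    unfolding wave_def gauss_prod
    by (simp add: prod.distrib euclidean_inner[of k x] sum_distrib_left flip: exp_sum sum_negf of_real_prod)
  show "integrable lborel (\<lambda>x. wave k x * of_real (gauss x))"
    unfolding eq by (rule lborel_prod_basis(1)) (rule gauss_1d(1))
  have "(LINT x|lborel. wave k x * of_real (gauss x))
     = (\<Prod>b\<in>Basis. of_real (sqrt (2 * pi) * exp (- (k \<bullet> b)\<^sup>2 / 2)))"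
    unfolding eq by (subst lborel_prod_basis(2)[OF gauss_1d(1)]) (simp only: gauss_1d(2))
  also have "\<dots> = of_real (sqrt (2 * pi) ^ CARD('d) * gauss k)"
    unfolding gauss_prod by (simp add: prod.distrib)
  also have "sqrt (2 * pi) ^ CARD('d) = (2 * pi) powr (real CARD('d) / 2)"
    by (simp add: powr_half_sqrt[symmetric] powr_powr flip: powr_realpow)
  finally show "of_real (fconst TYPE('d)) * (LINT x|lborel. wave k x * of_real (gauss x)) = of_real (gauss k)"
    unfolding fconst_def by (simp add: powr_minus)
qed

lemma integrable_gauss: "integrable lborel (\<lambda>x::real^'d::finite. gauss x)"
proof -
  have "integrable lborel (\<lambda>x::real^'d. of_real (gauss x) :: complex)"
    using wave_gauss(1)[of "0::real^'d"] by simp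
  then have "integrable lborel (\<lambda>x::real^'d. Re (of_real (gauss x)))" by (rule integrable_Re)
  then show ?thesis by simp
qed

lemma integral_gauss: "fconst TYPE('d) * (LINT x|lborel. gauss (x::real^'d::finite)) = 1"
proof -
  have "complex_of_real (fconst TYPE('d) * (LINT x|lborel. gauss (x::real^'d))) = 1"
    using wave_gauss(2)[of "0::real^'d"] by simp
  then show ?thesis using of_real_eq_1_iff by blast
qed

section \<open>The Fourier transform of integrable functions\<close>

lemma norm_fourier_le:
  fixes f :: "'d::finite fn"
  shows "norm (fourier f k) \<le> fconst TYPE('d) * (LINT x|lborel. norm (f x))"
proof -
  have "norm (LINT x|lborel. wave k x * f x) \<le> (LINT x|lborel. norm (wave k x * f x))"
    by (rule integral_norm_bound)
  then show ?thesis
    using fconst_pos[where 'd='d] by (simp add: fourier_eq norm_mult mult_left_mono)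
qed

lemma continuous_fourier:
  fixes f :: "'d::finite fn"
  assumes "integrable lborel f"
  shows "continuous_on UNIV (fourier f)"
proof -
  have [measurable]: "f \<in> borel_measurable borel" using assms by auto
  have "(\<lambda>n. LINT x|lborel. wave (u n) x * f x) \<longlonglongrightarrow> (LINT x|lborel. wave k x * f x)"
    if "u \<longlonglongrightarrow> k" for u k
  proof (rule integral_dominated_convergence[where w = "\<lambda>x. norm (f x)"])
    show "AE x in lborel. (\<lambda>n. wave (u n) x * f x) \<longlonglongrightarrow> wave k x * f x"
      unfolding wave_def using that by (intro AE_I2 tendsto_intros)
  qed (use assms in \<open>auto simp: norm_mult\<close>)
  then have "continuous_on UNIV (\<lambda>k. LINT x|lborel. wave k x * f x)"
    by (simp add: continuous_on_sequentially o_def)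
  then show ?thesis unfolding fourier_eq by (intro continuous_intros)
qed

lemma measurable_fourier [measurable]:
  assumes [measurable]: "f \<in> borel_measurable borel"
  shows "fourier f \<in> borel_measurable borel"
  unfolding fourier_eq by measurable

text \<open>The domination that allows to exchange integrals against a bounded kernel.\<close>

lemma integrable_pair_kernel:
  fixes f g :: "'d::finite fn"
  assumes f: "integrable lborel f" and g: "integrable lborel g"
    and [measurable]: "(\<lambda>p. K (fst p) (snd p)) \<in> borel_measurable (lborel \<Otimes>\<^sub>M lborel)"
    and K: "\<And>x y. norm (K x y) \<le> B"
  shows "integrable (lborel \<Otimes>\<^sub>M lborel) (\<lambda>(x, y). K x y * (f x * g y) :: complex)"
proof -
  have [measurable]: "f \<in> borel_measurable borel" "g \<in> borel_measurable borel" using f g by auto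
  have int: "integrable (lborel \<Otimes>\<^sub>M lborel) (\<lambda>(x, y). f x * g y)"
    by (rule lborel_pair.Fubini_integrable) (use f g in \<open>auto simp: norm_mult\<close>)
  show ?thesis
    unfolding case_prod_unfold
    by (rule integrable_mult_bounded[where B = B])
       (use int K in \<open>auto simp: case_prod_unfold\<close>)
qed

lemma fourier_multiplication:
  fixes f g :: "'d::finite fn"
  assumes f: "integrable lborel f" and g: "integrable lborel g"
  shows "(LINT x|lborel. fourier f x * g x) = (LINT x|lborel. f x * fourier g x)"
proof -
  let ?c = "complex_of_real (fconst TYPE('d))"
  have "integrable (lborel \<Otimes>\<^sub>M lborel) (\<lambda>(x, y). wave x y * (f x * g y))"
    by (rule integrable_pair_kernel[OF f g, where B = 1]) auto
  then have "(LINT y|lborel. LINT x|lborel. wave x y * (f x * g y)) =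
      (LINT x|lborel. LINT y|lborel. wave x y * (f x * g y))"
    by (rule lborel_pair.Fubini_integral)
  moreover have "(LINT x|lborel. wave x y * (f x * g y)) = (LINT x|lborel. wave y x * f x) * g y" for y
    by (simp add: wave_commute mult.assoc[symmetric])
  moreover have "(LINT y|lborel. wave x y * (f x * g y)) = f x * (LINT y|lborel. wave x y * g y)" for x
    by (simp add: mult.left_commute)
  ultimately have *: "(LINT y|lborel. (LINT x|lborel. wave y x * f x) * g y)
      = (LINT x|lborel. f x * (LINT y|lborel. wave x y * g y))"
    by simp
  have "(LINT x|lborel. fourier f x * g x) = ?c * (LINT y|lborel. (LINT x|lborel. wave y x * f x) * g y)"
    by (simp add: fourier_eq mult.assoc)
  also have "\<dots> = (LINT x|lborel. f x * fourier g x)"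
    by (simp add: * fourier_eq mult.left_commute[of _ ?c])
  finally show ?thesis .
qed

lemma integrable_gauss_scaled:
  "t \<noteq> 0 \<Longrightarrow> integrable lborel (\<lambda>k::real^'d::finite. gauss (t *\<^sub>R k))"
  using integrable_lborel_affine[OF integrable_gauss, of t 0] by simp

lemma integrable_wave_gauss_scaled:
  "t \<noteq> 0 \<Longrightarrow> integrable lborel (\<lambda>k::real^'d::finite. wave a k * of_real (gauss (t *\<^sub>R k)))"
  by (intro integrable_wave integrable_of_real integrable_gauss_scaled)

lemma fourier_wave_gauss_scaled:
  fixes x :: "real^'d::finite"
  assumes t: "0 < t"
  shows "fourier (\<lambda>k. wave (- x) k * of_real (gauss (t *\<^sub>R k))) y
    = of_real (inverse (t ^ CARD('d)) * gauss ((y - x) /\<^sub>R t))"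
proof -
  have "fourier (\<lambda>k. wave (- x) k * of_real (gauss (t *\<^sub>R k))) y
      = of_real (fconst TYPE('d)) * (LINT k|lborel. wave (y - x) k * of_real (gauss (t *\<^sub>R k)))"
    by (simp add: fourier_eq mult.assoc[symmetric] flip: wave_add)
  also have "(LINT k|lborel. wave (y - x) k * of_real (gauss (t *\<^sub>R k)))
     = inverse (t ^ CARD('d)) *\<^sub>R (LINT k|lborel. wave (y - x) (k /\<^sub>R t) * of_real (gauss k))"
    using t by (subst integral_lborel_affine[where c = "inverse t" and t = 0]) (auto simp: power_inverse)
  also have "(\<lambda>k. wave (y - x) (k /\<^sub>R t)) = wave ((y - x) /\<^sub>R t)"
    by (simp add: wave_def fun_eq_iff)
  finally show ?thesis
    by (simp add: scaleR_conv_of_real[where 'a=complex] mult.left_commute[of "of_real (fconst _)"] wave_gauss(2))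
qed

lemma integral_against_scaled_gauss:
  fixes f :: "'d::finite fn"
  assumes [measurable]: "f \<in> borel_measurable borel" and t: "0 < t"
  shows "(LINT y|lborel. f y * of_real (inverse (t ^ CARD('d)) * gauss ((y - x) /\<^sub>R t)))
       = (LINT z|lborel. f (x + t *\<^sub>R z) * of_real (gauss z))"
proof -
  have "(LINT y|lborel. f y * of_real (inverse (t ^ CARD('d)) * gauss ((y - x) /\<^sub>R t)))
    = \<bar>t\<bar> ^ DIM(real^'d) *\<^sub>R (LINT z|lborel. f (x + t *\<^sub>R z)
      * of_real (inverse (t ^ CARD('d)) * gauss ((x + t *\<^sub>R z - x) /\<^sub>R t)))"
    by (rule integral_lborel_affine) (use t in auto)
  also have "\<dots> = (LINT z|lborel. f (x + t *\<^sub>R z) * of_real (gauss z))"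
  proof -
    have eq: "f (x + t *\<^sub>R z) * of_real (inverse (t ^ CARD('d)) * gauss ((x + t *\<^sub>R z - x) /\<^sub>R t))
        = of_real (inverse (t ^ CARD('d))) * (f (x + t *\<^sub>R z) * of_real (gauss z))" for z
      using t by simp
    show ?thesis unfolding eq using t by (simp add: scaleR_conv_of_real[where 'a=complex])
  qed
  finally show ?thesis .
qed

text \<open>The multiplication formula, with a modulated Gaussian as second function: damping the inversion
  integral at \<open>x\<close> amounts to averaging \<open>f\<close> around \<open>x\<close> at scale \<open>t\<close>. Inversion, uniqueness and the
  \<open>L2\<close> bound below are limits of this identity as \<open>t\<close> tends to 0.\<close>

lemma fourier_regularised_inversion:
  fixes f :: "'d::finite fn"
  assumes f: "integrable lborel f" and t: "0 < t"
  shows "(LINT k|lborel. fourier f k * (wave (- x) k * of_real (gauss (t *\<^sub>R k))))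
       = (LINT z|lborel. f (x + t *\<^sub>R z) * of_real (gauss z))"
proof -
  have g: "integrable lborel (\<lambda>k. wave (- x) k * of_real (gauss (t *\<^sub>R k)) :: complex)"
    using t by (intro integrable_wave_gauss_scaled) auto
  have [measurable]: "f \<in> borel_measurable borel" using f by auto
  show ?thesis
    by (simp add: fourier_multiplication[OF f g] fourier_wave_gauss_scaled[OF t]
        integral_against_scaled_gauss[OF _ t, of f x, simplified])
qed

lemma gauss_scaled_tendsto:
  "(\<lambda>n. complex_of_real (gauss (inverse (real (Suc n)) *\<^sub>R k))) \<longlonglongrightarrow> 1"
proof -
  have "(\<lambda>n. inverse (real (Suc n)) *\<^sub>R k) \<longlonglongrightarrow> 0"
    using tendsto_scaleR[OF LIMSEQ_inverse_real_of_nat tendsto_const[of k]] by simp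
  moreover have "isCont (\<lambda>k. complex_of_real (gauss k)) 0"
    unfolding gauss_def by (intro continuous_intros) auto
  ultimately show ?thesis
    using isCont_tendsto_compose[of 0 "\<lambda>k. complex_of_real (gauss k)"] by fastforce
qed

lemma gauss_average_tendsto:
  fixes f :: "'d::finite fn"
  assumes cont: "continuous_on UNIV f" and bd: "\<And>x. norm (f x) \<le> B"
  shows "(\<lambda>n. of_real (fconst TYPE('d)) * (LINT z|lborel. f (x + inverse (real (Suc n)) *\<^sub>R z) * of_real (gauss z)))
      \<longlonglongrightarrow> f x"
proof -
  have [measurable]: "f \<in> borel_measurable borel" using cont by (rule borel_measurable_continuous_onI)
  let ?t = "\<lambda>n. inverse (real (Suc n))"
  have "(\<lambda>n. LINT z|lborel. f (x + ?t n *\<^sub>R z) * of_real (gauss z))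
      \<longlonglongrightarrow> (LINT z|lborel. f x * of_real (gauss (z::real^'d)))"
  proof (rule integral_dominated_convergence[where w = "\<lambda>z. B * gauss z"])
    show "AE z in lborel. (\<lambda>n. f (x + ?t n *\<^sub>R z) * of_real (gauss z)) \<longlonglongrightarrow> f x * of_real (gauss z)"
    proof (intro AE_I2 tendsto_mult tendsto_const)
      fix z
      have "(\<lambda>n. x + ?t n *\<^sub>R z) \<longlonglongrightarrow> x + 0 *\<^sub>R z"
        by (intro tendsto_intros LIMSEQ_inverse_real_of_nat)
      moreover have "isCont f x" using cont by (simp add: continuous_on_eq_continuous_at)
      ultimately show "(\<lambda>n. f (x + ?t n *\<^sub>R z)) \<longlonglongrightarrow> f x"
        using isCont_tendsto_compose by fastforce
    qed
    show "AE z in lborel. norm (f (x + ?t n *\<^sub>R z) * of_real (gauss z)) \<le> B * gauss z" for n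
      using bd by (intro AE_I2) (simp add: norm_mult mult_right_mono)
  qed (auto intro: integrable_gauss)
  from tendsto_mult[OF tendsto_const[of "of_real (fconst TYPE('d))"] this]
  have "(\<lambda>n. of_real (fconst TYPE('d)) * (LINT z|lborel. f (x + ?t n *\<^sub>R z) * of_real (gauss z)))
      \<longlonglongrightarrow> of_real (fconst TYPE('d) * (LINT z|lborel. gauss (z::real^'d))) * f x"
    by (simp add: mult_ac)
  then show ?thesis by (simp add: integral_gauss)
qed

lemma fourier_inversion:
  fixes f :: "'d::finite fn"
  assumes f: "integrable lborel f" and Ff: "integrable lborel (fourier f)"
    and cont: "continuous_on UNIV f" and bd: "\<And>x. norm (f x) \<le> B"
  shows "fourier (fourier f) x = f (- x)"
proof -
  have [measurable]: "f \<in> borel_measurable borel" using f by auto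
  let ?t = "\<lambda>n. inverse (real (Suc n))"
  have "(\<lambda>n. LINT k|lborel. fourier f k * (wave x k * of_real (gauss (?t n *\<^sub>R k))))
      \<longlonglongrightarrow> (LINT k|lborel. fourier f k * (wave x k * 1))"
  proof (rule integral_dominated_convergence[where w = "\<lambda>k. norm (fourier f k)"])
    show "AE k in lborel. (\<lambda>n. fourier f k * (wave x k * of_real (gauss (?t n *\<^sub>R k))))
       \<longlonglongrightarrow> fourier f k * (wave x k * 1)"
      by (intro AE_I2 tendsto_intros gauss_scaled_tendsto)
    show "AE k in lborel. norm (fourier f k * (wave x k * of_real (gauss (?t n *\<^sub>R k)))) \<le> norm (fourier f k)" for n
      by (intro AE_I2) (simp add: norm_mult mult_left_le gauss_le_1)
  qed (use Ff in auto)
  from tendsto_mult[OF tendsto_const[of "of_real (fconst TYPE('d))"] this]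
  have "(\<lambda>n. of_real (fconst TYPE('d)) * (LINT z|lborel. f (- x + ?t n *\<^sub>R z) * of_real (gauss z)))
      \<longlonglongrightarrow> of_real (fconst TYPE('d)) * (LINT k|lborel. fourier f k * (wave x k * 1))"
    by (subst (asm) fourier_regularised_inversion[OF f, of _ "- x", unfolded minus_minus]) simp_all
  from LIMSEQ_unique[OF this gauss_average_tendsto[OF cont bd]]
  show ?thesis by (simp add: fourier_eq[of "fourier f"] mult_ac)
qed

text \<open>Cauchy-Schwarz, from the nonnegativity of the quadratic polynomial
  \<open>s \<mapsto> \<integral> (s |f| - |g|)^2\<close>.\<close>

lemma L2_product:
  fixes f g :: "'a \<Rightarrow> complex"
  assumes [measurable]: "f \<in> borel_measurable M" "g \<in> borel_measurable M"
    and f: "integrable M (\<lambda>x. (norm (f x))\<^sup>2)" and g: "integrable M (\<lambda>x. (norm (g x))\<^sup>2)"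
  shows "integrable M (\<lambda>x. f x * g x)"
    and "(LINT x|M. norm (f x * g x))\<^sup>2 \<le> (LINT x|M. (norm (f x))\<^sup>2) * (LINT x|M. (norm (g x))\<^sup>2)"
    and "(norm (LINT x|M. f x * g x))\<^sup>2 \<le> (LINT x|M. (norm (f x))\<^sup>2) * (LINT x|M. (norm (g x))\<^sup>2)"
proof -
  have am: "norm (f x * g x) \<le> (norm (f x))\<^sup>2 + (norm (g x))\<^sup>2" for x
  proof -
    have "0 \<le> (norm (f x) - norm (g x))\<^sup>2" by simp
    moreover have "0 \<le> norm (f x) * norm (g x)" by simp
    ultimately show ?thesis unfolding power2_diff norm_mult by linarith
  qed
  show int: "integrable M (\<lambda>x. f x * g x)"
    by (rule Bochner_Integration.integrable_bound[OF Bochner_Integration.integrable_add[OF f g]])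
       (use am in \<open>auto intro: order_trans[OF _ abs_ge_self]\<close>)
  let ?X = "LINT x|M. norm (f x * g x)"
  let ?A = "LINT x|M. (norm (f x))\<^sup>2"
  let ?B = "LINT x|M. (norm (g x))\<^sup>2"
  have quad: "2 * s * ?X \<le> s\<^sup>2 * ?A + ?B" for s :: real
  proof -
    have "(LINT x|M. 2 * s * norm (f x * g x)) \<le> (LINT x|M. s\<^sup>2 * (norm (f x))\<^sup>2 + (norm (g x))\<^sup>2)"
    proof (rule integral_mono)
      fix x
      have "0 \<le> (s * norm (f x) - norm (g x))\<^sup>2" by simp
      then show "2 * s * norm (f x * g x) \<le> s\<^sup>2 * (norm (f x))\<^sup>2 + (norm (g x))\<^sup>2"
        unfolding power2_diff norm_mult power_mult_distrib by (simp add: mult_ac)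
    qed (use int f g in auto)
    then show ?thesis using int f g by simp
  qed
  have X: "0 \<le> ?X" and A: "0 \<le> ?A" and B: "0 \<le> ?B" by auto
  show *: "?X\<^sup>2 \<le> ?A * ?B"
  proof (cases "?A = 0")
    case True
    have "?X = 0"
    proof (rule ccontr)
      assume "?X \<noteq> 0"
      then have "2 * ((?B + 1) / (2 * ?X)) * ?X = ?B + 1" by (simp del: norm_mult)
      then show False using quad[of "(?B + 1) / (2 * ?X)"] True by simp
    qed
    then show ?thesis using True by simp
  next
    case False
    then have "?A > 0" using A by linarith
    then show ?thesis using quad[of "?X / ?A"] by (simp add: field_simps power2_eq_square)
  qed
  have "norm (LINT x|M. f x * g x) \<le> ?X" by (rule integral_norm_bound)
  then show "(norm (LINT x|M. f x * g x))\<^sup>2 \<le> ?A * ?B"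
    using * by (meson norm_ge_zero order_trans power_mono)
qed

text \<open>The indicator of an open set is the increasing limit of the continuous functions
  \<open>min 1 (n * infdist x (- U))\<close>, so the integral of \<open>G\<close> over every open set vanishes; open sets form a
  generator of the Borel sets that is stable under intersection.\<close>

lemma AE_zero_if_continuous_integrals_zero:
  fixes G :: "'a::euclidean_space \<Rightarrow> complex"
  assumes G: "integrable lborel G"
    and z: "\<And>\<phi>. continuous_on UNIV \<phi> \<Longrightarrow> (\<And>x. 0 \<le> \<phi> x \<and> \<phi> x \<le> 1) \<Longrightarrow>
      (LINT x|lborel. complex_of_real (\<phi> x) * G x) = 0"
  shows "AE x in lborel. G x = 0"
proof -
  have [measurable]: "G \<in> borel_measurable borel" using G by auto
  have op: "(LINT x:U|lborel. G x) = 0" if U: "open U" for U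
  proof (cases "U = UNIV")
    case True
    then show ?thesis using z[of "\<lambda>_. 1"] by (simp add: set_lebesgue_integral_def)
  next
    case False
    define \<phi> where "\<phi> n x = min 1 (real n * infdist x (- U))" for n x
    have [measurable]: "(\<lambda>x. infdist x (- U)) \<in> borel_measurable borel"
      by (intro borel_measurable_continuous_onI continuous_on_infdist continuous_on_id)
    have "(\<lambda>n. LINT x|lborel. complex_of_real (\<phi> n x) * G x) \<longlonglongrightarrow> (LINT x|lborel. indicator U x *\<^sub>R G x)"
    proof (rule integral_dominated_convergence[where w = "\<lambda>x. norm (G x)"])
      show "AE x in lborel. (\<lambda>n. complex_of_real (\<phi> n x) * G x) \<longlonglongrightarrow> indicator U x *\<^sub>R G x"
      proof (intro AE_I2)
        fix x
        have "(\<lambda>n. complex_of_real (\<phi> n x)) \<longlonglongrightarrow> of_real (indicator U x)"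
        proof (cases "x \<in> U")
          case True
          then have d: "infdist x (- U) > 0"
            using in_closed_iff_infdist_zero[of "- U" x] U False infdist_nonneg[of x "- U"]
            by (auto simp: less_le)
          obtain N where N: "real N * infdist x (- U) > 1"
            using reals_Archimedean3[OF d] by blast
          have "\<phi> n x = 1" if "n \<ge> N" for n
          proof -
            have "real N * infdist x (- U) \<le> real n * infdist x (- U)"
              using that d by (intro mult_right_mono) auto
            then show ?thesis using N by (simp add: \<phi>_def)
          qed
          then have "\<forall>\<^sub>F n in sequentially. complex_of_real (\<phi> n x) = 1"
            unfolding eventually_sequentially by (intro exI[of _ N]) auto
          then show ?thesis using True by (simp add: tendsto_eventually)
        next
          case False
          then show ?thesis by (simp add: \<phi>_def)
        qed
        from tendsto_mult[OF this tendsto_const[of "G x"]]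
        show "(\<lambda>n. complex_of_real (\<phi> n x) * G x) \<longlonglongrightarrow> indicator U x *\<^sub>R G x"
          by (simp add: scaleR_conv_of_real)
      qed
      show "AE x in lborel. norm (complex_of_real (\<phi> n x) * G x) \<le> norm (G x)" for n
        by (intro AE_I2) (auto simp: \<phi>_def norm_mult infdist_nonneg intro!: mult_left_le_one_le)
      show "(\<lambda>x. complex_of_real (\<phi> n x) * G x) \<in> borel_measurable lborel" for n
        unfolding \<phi>_def by measurable
    qed (use G U in auto)
    moreover have "(LINT x|lborel. complex_of_real (\<phi> n x) * G x) = 0" for n
      by (rule z) (auto simp: \<phi>_def infdist_nonneg intro!: continuous_intros)
    ultimately show ?thesis
      by (simp add: set_lebesgue_integral_def LIMSEQ_const_iff)
  qed
  have si: "set_integrable lborel A G" if "A \<in> sets borel" for A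
    using integrable_mult_indicator[OF _ G, of A] that by (simp add: set_integrable_def)
  have all: "(LINT x:A|lborel. G x) = 0" if "A \<in> sets borel" for A
  proof -
    have sb: "sets borel = sigma_sets (UNIV :: 'a set) {S. open S}" by (simp add: borel_def)
    have "Int_stable {S :: 'a set. open S}" by (auto simp: Int_stable_def)
    moreover have "{S :: 'a set. open S} \<subseteq> Pow UNIV" by simp
    moreover have "A \<in> sigma_sets UNIV {S. open S}" using that sb by simp
    ultimately show ?thesis
    proof (induct rule: sigma_sets_induct_disjoint)
      case (compl A)
      then have A: "A \<in> sets borel" using sb by simp
      have "(LINT x:UNIV|lborel. G x) = (LINT x:A|lborel. G x) + (LINT x:(UNIV - A)|lborel. G x)"
        using set_integral_Un[of A "UNIV - A" lborel G] si[of A] si[of "UNIV - A"] A by simp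
      then show ?case using op[of UNIV] compl by simp
    next
      case (union A)
      then have A: "\<And>i. A i \<in> sets borel" using sb by auto
      then have "(LINT x:(\<Union>i. A i)|lborel. G x) = (\<Sum>i. LINT x:A i|lborel. G x)"
        using union by (intro lebesgue_integral_countable_add si)
          (auto simp: disjoint_family_on_def)
      then show ?case using union by simp
    qed (use op in auto)
  qed
  have c: "AE x in lborel. h (G x) = 0" if h: "bounded_linear h" for h :: "complex \<Rightarrow> real"
  proof (rule density_unique_real)
    show "integrable lborel (\<lambda>x. h (G x))" using integrable_bounded_linear[OF h G] .
    show "(LINT x:A|lborel. h (G x)) = (LINT x:A|lborel. 0)" if "A \<in> sets lborel" for A
    proof -
      have "(LINT x:A|lborel. h (G x)) = h (LINT x:A|lborel. G x)"
        using integral_bounded_linear[OF h, of lborel "\<lambda>x. indicator A x *\<^sub>R G x"] si[of A] that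
        by (simp add: set_lebesgue_integral_def set_integrable_def linear_cmul[OF bounded_linear.linear[OF h]])
      then show ?thesis using all[of A] that linear_0[OF bounded_linear.linear[OF h]]
        by (simp add: set_lebesgue_integral_def)
    qed
  qed auto
  show ?thesis
    using c[OF bounded_linear_Re] c[OF bounded_linear_Im]
    by eventually_elim (simp add: complex_eq_iff)
qed

lemma integrable_shift_pair:
  fixes f g \<phi> :: "'d::finite fn"
  assumes f: "integrable lborel f" and g: "integrable lborel g"
    and [measurable]: "\<phi> \<in> borel_measurable borel" and bd: "\<And>x. norm (\<phi> x) \<le> B"
  shows "integrable (lborel \<Otimes>\<^sub>M lborel) (\<lambda>(z, x). \<phi> x * f (x + t *\<^sub>R z) * g z)"
proof (rule lborel_pair.Fubini_integrable)
  have [measurable]: "f \<in> borel_measurable borel" "g \<in> borel_measurable borel" using f g by auto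
  show "(\<lambda>(z, x). \<phi> x * f (x + t *\<^sub>R z) * g z) \<in> borel_measurable (lborel \<Otimes>\<^sub>M lborel)"
    by measurable
  have fs: "integrable lborel (\<lambda>x. f (x + y))" for y
    using integrable_lborel_affine[OF f, of 1 y] by (simp add: add.commute)
  have B: "0 \<le> B" using bd norm_ge_zero order_trans by blast
  show "AE z in lborel. integrable lborel (\<lambda>x. case (z, x) of (z, x) \<Rightarrow> \<phi> x * f (x + t *\<^sub>R z) * g z)"
    using integrable_mult_bounded[OF fs _ bd] by auto
  show "integrable lborel (\<lambda>z. LINT x|lborel. norm (case (z, x) of (z, x) \<Rightarrow> \<phi> x * f (x + t *\<^sub>R z) * g z))"
  proof (rule Bochner_Integration.integrable_bound[where f = "\<lambda>z. B * (LINT x|lborel. norm (f x)) * norm (g z)"])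
    show "AE z in lborel. norm (LINT x|lborel. norm (case (z, x) of (z, x) \<Rightarrow> \<phi> x * f (x + t *\<^sub>R z) * g z))
      \<le> norm (B * (LINT x|lborel. norm (f x)) * norm (g z))"
    proof (intro AE_I2)
      fix z :: "real^'d"
      have "(LINT x|lborel. norm (\<phi> x * f (x + t *\<^sub>R z) * g z)) \<le> (LINT x|lborel. B * norm (g z) * norm (f (x + t *\<^sub>R z)))"
      proof (rule integral_mono)
        show "integrable lborel (\<lambda>x. norm (\<phi> x * f (x + t *\<^sub>R z) * g z))"
          using integrable_mult_bounded[OF fs _ bd] by auto
        show "integrable lborel (\<lambda>x. B * norm (g z) * norm (f (x + t *\<^sub>R z)))" using fs by simp
        show "norm (\<phi> x * f (x + t *\<^sub>R z) * g z) \<le> B * norm (g z) * norm (f (x + t *\<^sub>R z))" for x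
          using mult_right_mono[OF bd[of x], of "norm (f (x + t *\<^sub>R z)) * norm (g z)"]
          by (simp add: norm_mult mult_ac)
      qed
      also have "\<dots> = B * norm (g z) * (LINT x|lborel. norm (f x))"
        using integral_lborel_shift[of "\<lambda>x. norm (f x)" "t *\<^sub>R z"] by (simp add: add.commute)
      finally show "norm (LINT x|lborel. norm (case (z, x) of (z, x) \<Rightarrow> \<phi> x * f (x + t *\<^sub>R z) * g z))
         \<le> norm (B * (LINT x|lborel. norm (f x)) * norm (g z))"
        using B by (simp add: mult_ac abs_mult)
    qed
  qed (use g in auto)
qed

text \<open>By the regularised inversion all Gaussian averages of \<open>f\<close> vanish. Integrated against a bounded
  continuous function, these averages converge to the integral of \<open>f\<close> against that function.\<close>

lemma fourier_L1_unique:
  fixes f :: "'d::finite fn"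
  assumes f: "integrable lborel f" and F0: "\<And>k. fourier f k = 0"
  shows "AE x in lborel. f x = 0"
proof (rule AE_zero_if_continuous_integrals_zero[OF f])
  have [measurable]: "f \<in> borel_measurable borel" using f by auto
  fix \<phi> :: "real^'d \<Rightarrow> real"
  assume cont: "continuous_on UNIV \<phi>" and bd: "\<And>x. 0 \<le> \<phi> x \<and> \<phi> x \<le> 1"
  have [measurable]: "\<phi> \<in> borel_measurable borel" using cont by (rule borel_measurable_continuous_onI)
  define t where "t n = inverse (real (Suc n))" for n
  have t: "t n > 0" for n by (simp add: t_def)
  have t0: "t \<longlonglongrightarrow> 0" unfolding t_def by (rule LIMSEQ_inverse_real_of_nat)
  define J where "J n z = (LINT x|lborel. complex_of_real (\<phi> (x - t n *\<^sub>R z)) * f x)" for n z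
  let ?L = "LINT x|lborel. complex_of_real (\<phi> x) * f x"
  have [measurable]: "J n \<in> borel_measurable borel" for n unfolding J_def by measurable
  have bd': "norm (complex_of_real (\<phi> y) * f x) \<le> norm (f x)" for y x
    using bd[of y] by (auto simp: norm_mult intro!: mult_left_le_one_le)
  have inti: "integrable lborel (\<lambda>x. complex_of_real (\<phi> (x - y)) * f x)" for y
    by (rule Bochner_Integration.integrable_bound[OF f]) (use bd' in auto)
  have "(\<lambda>n. LINT z|lborel. J n z * of_real (gauss z)) \<longlonglongrightarrow> (LINT z|lborel. ?L * of_real (gauss (z::real^'d)))"
  proof (rule integral_dominated_convergence[where w = "\<lambda>z. (LINT x|lborel. norm (f x)) * gauss z"])
    show "AE z in lborel. (\<lambda>n. J n z * of_real (gauss z)) \<longlonglongrightarrow> ?L * of_real (gauss z)"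
    proof (intro AE_I2 tendsto_mult tendsto_const)
      fix z
      show "(\<lambda>n. J n z) \<longlonglongrightarrow> ?L" unfolding J_def
      proof (rule integral_dominated_convergence[where w = "\<lambda>x. norm (f x)"])
        show "AE x in lborel. (\<lambda>n. complex_of_real (\<phi> (x - t n *\<^sub>R z)) * f x) \<longlonglongrightarrow> complex_of_real (\<phi> x) * f x"
        proof (intro AE_I2 tendsto_mult tendsto_const tendsto_of_real)
          fix x
          have "(\<lambda>n. x - t n *\<^sub>R z) \<longlonglongrightarrow> x - 0 *\<^sub>R z" by (intro tendsto_intros t0)
          moreover have "isCont \<phi> x" using cont by (simp add: continuous_on_eq_continuous_at)
          ultimately show "(\<lambda>n. \<phi> (x - t n *\<^sub>R z)) \<longlonglongrightarrow> \<phi> x"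
            using isCont_tendsto_compose by fastforce
        qed
      qed (use f bd' in auto)
    qed
    show "AE z in lborel. norm (J n z * of_real (gauss z)) \<le> (LINT x|lborel. norm (f x)) * gauss z" for n
    proof (intro AE_I2)
      fix z :: "real^'d"
      have "norm (J n z) \<le> (LINT x|lborel. norm (complex_of_real (\<phi> (x - t n *\<^sub>R z)) * f x))"
        unfolding J_def by (rule integral_norm_bound)
      also have "\<dots> \<le> (LINT x|lborel. norm (f x))"
        using inti f bd' by (intro integral_mono) auto
      finally show "norm (J n z * of_real (gauss z)) \<le> (LINT x|lborel. norm (f x)) * gauss z"
        using gauss_pos[of z] by (simp add: norm_mult mult_right_mono)
    qed
  qed (auto intro: integrable_gauss)
  moreover have "(LINT z|lborel. J n z * of_real (gauss z)) = 0" for n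
  proof -
    have "integrable (lborel \<Otimes>\<^sub>M lborel) (\<lambda>(z, x). complex_of_real (\<phi> x) * f (x + t n *\<^sub>R z) * of_real (gauss z))"
      using bd by (intro integrable_shift_pair[where B = 1] f)
        (auto intro!: integrable_of_real integrable_gauss)
    from lborel_pair.Fubini_integral[OF this]
    have "(LINT z|lborel. LINT x|lborel. complex_of_real (\<phi> x) * f (x + t n *\<^sub>R z) * of_real (gauss z))
      = (LINT x|lborel. LINT z|lborel. complex_of_real (\<phi> x) * f (x + t n *\<^sub>R z) * of_real (gauss z))"
      by simp
    also have "\<dots> = 0"
      using fourier_regularised_inversion[OF f t[of n]] by (simp add: F0 mult.assoc)
    also have "(\<lambda>z. LINT x|lborel. complex_of_real (\<phi> x) * f (x + t n *\<^sub>R z) * of_real (gauss z))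
       = (\<lambda>z. J n z * of_real (gauss z))"
    proof
      fix z
      show "(LINT x|lborel. complex_of_real (\<phi> x) * f (x + t n *\<^sub>R z) * of_real (gauss z)) = J n z * of_real (gauss z)"
        using integral_lborel_shift[of "\<lambda>x. complex_of_real (\<phi> (x - t n *\<^sub>R z)) * f x" "t n *\<^sub>R z"]
        by (simp add: J_def add.commute)
    qed
    finally show ?thesis .
  qed
  ultimately have "(LINT z|lborel. ?L * of_real (gauss (z::real^'d))) = 0"
    by (simp add: LIMSEQ_const_iff)
  then show "?L = 0"
    using integral_gauss[where 'd='d] by auto
qed


section \<open>The Riemann-Lebesgue lemma\<close>

lemma fourier_diff:
  fixes f g :: "'d::finite fn"
  assumes "integrable lborel f" "integrable lborel g"
  shows "fourier (\<lambda>x. f x - g x) k = fourier f k - fourier g k"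
  using integrable_wave[OF assms(1), of k] integrable_wave[OF assms(2), of k]
  by (simp add: fourier_eq algebra_simps)

lemma fourier_add:
  fixes f g :: "'d::finite fn"
  assumes "integrable lborel f" "integrable lborel g"
  shows "fourier (\<lambda>x. f x + g x) k = fourier f k + fourier g k"
  using integrable_wave[OF assms(1), of k] integrable_wave[OF assms(2), of k]
  by (simp add: fourier_eq algebra_simps)

lemma fourier_cmult:
  fixes f :: "'d::finite fn"
  shows "fourier (\<lambda>x. c * f x) k = c * fourier f k"
  by (simp add: fourier_eq mult.left_commute[of _ c])

text \<open>The transform is bounded by the \<open>L1\<close> norm, so vanishing at infinity passes to \<open>L1\<close> limits.\<close>

lemma riemann_lebesgue_approx:
  fixes f :: "'d::finite fn"
  assumes f: "integrable lborel f"
    and app: "\<And>e. 0 < e \<Longrightarrow> \<exists>g. integrable lborel g \<and> (LINT x|lborel. norm (f x - g x)) < e \<and> (fourier g \<longlongrightarrow> 0) at_infinity"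
  shows "(fourier f \<longlongrightarrow> 0) at_infinity"
proof (rule tendstoI)
  fix e :: real assume e: "0 < e"
  let ?c = "fconst TYPE('d)"
  have c: "0 < ?c" by (rule fconst_pos)
  obtain g where g: "integrable lborel g" "(LINT x|lborel. norm (f x - g x)) < e / 2 / ?c" "(fourier g \<longlongrightarrow> 0) at_infinity"
    using app[of "e / 2 / ?c"] e c by auto
  have "\<forall>\<^sub>F k in at_infinity. dist (fourier g k) 0 < e / 2" using tendstoD[OF g(3), of "e/2"] e by simp
  then show "\<forall>\<^sub>F k in at_infinity. dist (fourier f k) 0 < e"
  proof eventually_elim
    case (elim k)
    have "norm (fourier f k - fourier g k) \<le> ?c * (LINT x|lborel. norm (f x - g x))"
      using norm_fourier_le[of "\<lambda>x. f x - g x" k] by (simp add: fourier_diff[OF f g(1)])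
    also have "\<dots> < e / 2" using g(2) c by (simp add: field_simps)
    finally have "norm (fourier f k - fourier g k) < e / 2" .
    then have "norm ((fourier f k - fourier g k) + fourier g k) < e"
      using elim norm_triangle_ineq[of "fourier f k - fourier g k" "fourier g k"] by simp
    then show ?case by simp
  qed
qed

text \<open>Translates of an open set contain each of its points eventually, which makes the overlap converge
  to the full measure by dominated convergence. The pointwise argument uses that the set is open.\<close>

lemma open_shift_continuous:
  fixes U :: "'a::euclidean_space set"
  assumes U: "open U" and fin: "emeasure lborel U < \<infinity>"
  shows "((\<lambda>h. LINT x|lborel. \<bar>indicator U x - indicator U (h + x) :: real\<bar>) \<longlongrightarrow> 0) (at 0)"
proof (subst tendsto_at_iff_sequentially, intro allI impI, unfold o_def)
  have [measurable]: "U \<in> sets borel" using U by auto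
  fix X :: "nat \<Rightarrow> 'a" assume X: "X \<longlonglongrightarrow> 0"
  have iU: "integrable lborel (indicator U :: 'a \<Rightarrow> real)" using fin by (intro integrable_real_indicator) auto
  have iUh: "integrable lborel (\<lambda>x. indicator U (h + x) :: real)" for h
    using integrable_lborel_affine[OF iU, of 1 h] by simp
  have prod: "integrable lborel (\<lambda>x. indicator U x * indicator U (h + x) :: real)" for h
    by (rule Bochner_Integration.integrable_bound[OF iU]) (auto simp: indicator_def)
  have "(LINT x|lborel. \<bar>indicator U x - indicator U (h + x) :: real\<bar>)
      = 2 * measure lborel U - 2 * (LINT x|lborel. indicator U x * indicator U (h + x))" for h
  proof -
    have "\<bar>indicator U x - indicator U (h + x) :: real\<bar> = indicator U x + indicator U (h + x) - 2 * (indicator U x * indicator U (h + x))" for x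
      by (auto simp: indicator_def)
    then show ?thesis
      using iU iUh[of h] prod[of h] integral_lborel_shift[of "indicator U :: 'a \<Rightarrow> real" h] by simp
  qed
  moreover have "(\<lambda>n. LINT x|lborel. indicator U x * indicator U (X n + x) :: real) \<longlonglongrightarrow> (LINT x|lborel. indicator U x)"
  proof (rule integral_dominated_convergence[where w = "indicator U"])
    show "AE x in lborel. (\<lambda>n. indicator U x * indicator U (X n + x) :: real) \<longlonglongrightarrow> indicator U x"
    proof (intro AE_I2)
      fix x
      show "(\<lambda>n. indicator U x * indicator U (X n + x) :: real) \<longlonglongrightarrow> indicator U x"
      proof (cases "x \<in> U")
        case True
        have "(\<lambda>n. X n + x) \<longlonglongrightarrow> 0 + x" by (intro tendsto_intros X)
        then have "\<forall>\<^sub>F n in sequentially. X n + x \<in> U" using topological_tendstoD[OF _ U, of _ "0 + x"] True by simp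
        then have "\<forall>\<^sub>F n in sequentially. indicator U x * indicator U (X n + x) = (1::real)"
          by eventually_elim (use True in simp)
        then show ?thesis using True by (simp add: tendsto_eventually)
      qed simp
    qed
  qed (use iU in \<open>auto simp: indicator_def\<close>)
  then have "(\<lambda>n. 2 * measure lborel U - 2 * (LINT x|lborel. indicator U x * indicator U (X n + x))) \<longlonglongrightarrow> 2 * measure lborel U - 2 * measure lborel U"
    by (intro tendsto_intros) simp
  ultimately show "(\<lambda>n. LINT x|lborel. \<bar>indicator U x - indicator U (X n + x) :: real\<bar>) \<longlonglongrightarrow> 0" by simp
qed

text \<open>A shift by \<open>\<pi> k / |k|^2\<close> changes the sign of the wave with frequency \<open>k\<close>. Hence twice the transform
  is the transform of the difference of \<open>U\<close> and a translate, and the translation tends to 0 as \<open>k\<close>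
  tends to infinity.\<close>

lemma riemann_lebesgue_open:
  fixes U :: "(real ^ 'd::finite) set"
  assumes U: "open U" and fin: "emeasure lborel U < \<infinity>"
  shows "(fourier (\<lambda>x. of_real (indicator U x)) \<longlongrightarrow> 0) at_infinity"
proof -
  have [measurable]: "U \<in> sets borel" using U by auto
  let ?f = "\<lambda>x. complex_of_real (indicator U x)"
  let ?c = "fconst TYPE('d)"
  have iU: "integrable lborel ?f" using fin by (intro integrable_of_real integrable_real_indicator) auto
  \<comment> \<open>the shift that turns the wave of frequency \<open>k\<close> into its negative\<close>
  define h where "h k = (pi / (k \<bullet> k)) *\<^sub>R k" for k :: "real^'d"
  define D where "D h = (LINT x|lborel. \<bar>indicator U x - indicator U (h + x) :: real\<bar>)" for h
  have le: "norm (fourier ?f k) \<le> ?c * D (h k)" if "k \<noteq> 0" for k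
  proof -
    have kh: "wave k (h k) = -1" using that by (simp add: wave_def h_def exp_minus exp_pi_i')
    have ish: "integrable lborel (\<lambda>x. ?f (h k + x))" using integrable_lborel_affine[OF iU, of 1 "h k"] by simp
    have "fourier ?f k = of_real ?c * (LINT x|lborel. wave k (h k + x) * ?f (h k + x))"
      using integral_lborel_shift[of "\<lambda>x. wave k x * ?f x" "h k"] by (simp add: fourier_eq)
    also have "\<dots> = - fourier (\<lambda>x. ?f (h k + x)) k"
      by (simp add: fourier_eq wave_add_right kh)
    finally have "2 * fourier ?f k = fourier ?f k - fourier (\<lambda>x. ?f (h k + x)) k" by simp
    also have "\<dots> = fourier (\<lambda>x. ?f x - ?f (h k + x)) k" by (rule fourier_diff[OF iU ish, symmetric])
    finally have "norm (2 * fourier ?f k) \<le> ?c * (LINT x|lborel. norm (?f x - ?f (h k + x)))"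
      using norm_fourier_le[of "\<lambda>x. ?f x - ?f (h k + x)" k] by simp
    moreover have "norm (?f x - ?f (h k + x)) = \<bar>indicator U x - indicator U (h k + x) :: real\<bar>" for x
      by (auto simp: indicator_def)
    ultimately have "2 * norm (fourier ?f k) \<le> ?c * D (h k)" by (simp add: D_def norm_mult)
    then show ?thesis using norm_ge_zero[of "fourier ?f k"] by linarith
  qed
  have nz: "\<forall>\<^sub>F k in at_infinity. k \<noteq> (0::real^'d)"
    unfolding eventually_at_infinity by (intro exI[of _ 1]) auto
  have "(h \<longlongrightarrow> 0) at_infinity"
  proof (rule Lim_null_comparison)
    show "\<forall>\<^sub>F k in at_infinity. norm (h k) \<le> pi * inverse (norm k)"
      using nz by eventually_elim (simp add: h_def dot_square_norm power2_eq_square field_simps)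
    have "((\<lambda>k::real^'d. inverse (norm k)) \<longlongrightarrow> 0) at_infinity"
      by (rule tendsto_inverse_0_at_top[OF filterlim_norm_at_top])
    from tendsto_mult_right_zero[OF this] show "((\<lambda>k::real^'d. pi * inverse (norm k)) \<longlongrightarrow> 0) at_infinity" .
  qed
  moreover have "\<forall>\<^sub>F k in at_infinity. h k \<noteq> 0"
    using nz by eventually_elim (simp add: h_def)
  ultimately have "filterlim h (at 0) at_infinity" by (simp add: filterlim_at)
  then have "((\<lambda>k. D (h k)) \<longlongrightarrow> 0) at_infinity"
    using filterlim_compose[OF open_shift_continuous[OF U fin]] unfolding D_def by blast
  then have lim: "((\<lambda>k. ?c * D (h k)) \<longlongrightarrow> 0) at_infinity" by (rule tendsto_mult_right_zero)
  show ?thesis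
    by (rule Lim_null_comparison[OF _ lim]) (use nz in \<open>eventually_elim, auto intro: le\<close>)
qed

text \<open>Outer regularity reduces indicators of Borel sets to those of open sets; linear combinations and
  dominated limits reach all integrable functions.\<close>

lemma riemann_lebesgue:
  fixes f :: "'d::finite fn"
  assumes "integrable lborel f"
  shows "(fourier f \<longlongrightarrow> 0) at_infinity"
  using assms
proof (induct rule: integrable_induct)
  case (base A c)
  then have [measurable]: "A \<in> sets borel" by simp
  let ?f = "\<lambda>x. complex_of_real (indicator A x)"
  have iA: "integrable lborel ?f" using base by (intro integrable_of_real integrable_real_indicator) auto
  have "(fourier ?f \<longlongrightarrow> 0) at_infinity"
  proof (rule riemann_lebesgue_approx[OF iA])
    fix e :: real assume e: "0 < e"
    obtain U where U: "open U" "A \<subseteq> U" "emeasure lborel (U - A) < e"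
      using outer_regular_lborel[of A e] e by auto
    then have [measurable]: "U \<in> sets borel" by auto
    have "emeasure lborel U = emeasure lborel A + emeasure lborel (U - A)"
      using U by (subst plus_emeasure) (auto intro!: arg_cong[where f = "emeasure lborel"])
    also have "\<dots> < \<infinity>" using base U(3) by (auto intro: less_trans)
    finally have fin: "emeasure lborel U < \<infinity>" .
    have "norm (?f x - of_real (indicator U x)) = indicator (U - A) x" for x
      using U(2) by (auto simp: indicator_def)
    then have "(LINT x|lborel. norm (?f x - of_real (indicator U x))) = measure lborel (U - A)" by simp
    also have "\<dots> < e" using U(3) e emeasure_eq_ennreal_measure[of lborel "U - A"] by (cases "emeasure lborel (U - A) = top") (auto simp: ennreal_less_iff)
    finally show "\<exists>g. integrable lborel g \<and> (LINT x|lborel. norm (?f x - g x)) < e \<and> (fourier g \<longlongrightarrow> 0) at_infinity"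
      using riemann_lebesgue_open[OF U(1) fin] fin
      by (intro exI[of _ "\<lambda>x. of_real (indicator U x)"]) (auto intro!: integrable_of_real integrable_real_indicator)
  qed
  then have *: "((\<lambda>k. c * fourier ?f k) \<longlongrightarrow> 0) at_infinity" by (rule tendsto_mult_right_zero)
  have eq: "(\<lambda>x. indicator A x *\<^sub>R c) = (\<lambda>x. c * ?f x)" by (simp add: fun_eq_iff scaleR_conv_of_real)
  have "fourier (\<lambda>x. c * ?f x) = (\<lambda>k. c * fourier ?f k)" by (rule ext) (rule fourier_cmult)
  then show ?case unfolding eq using * by simp
next
  case (add f g)
  then have "fourier (\<lambda>x. f x + g x) = (\<lambda>k. fourier f k + fourier g k)" by (simp add: fun_eq_iff fourier_add)
  then show ?case using tendsto_add[OF add(2,4)] by simp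
next
  case (lim f s)
  then have [measurable]: "f \<in> borel_measurable borel" "s i \<in> borel_measurable borel" for i by auto
  show ?case
  proof (rule riemann_lebesgue_approx[OF lim(5)])
    fix e :: real assume e: "0 < e"
    have "(\<lambda>i. LINT x|lborel. norm (f x - s i x)) \<longlonglongrightarrow> (LINT x|lborel. norm (f x - f x))"
    proof (rule integral_dominated_convergence[where w = "\<lambda>x. 3 * norm (f x)"])
      show "AE x in lborel. (\<lambda>i. norm (f x - s i x)) \<longlonglongrightarrow> norm (f x - f x)"
        using lim(3) by (intro AE_I2 tendsto_intros) auto
      show "AE x in lborel. norm (norm (f x - s i x)) \<le> 3 * norm (f x)" for i
      proof (intro AE_I2)
        fix x
        show "norm (norm (f x - s i x)) \<le> 3 * norm (f x)"
          using lim(4)[of x i] norm_triangle_ineq4[of "f x" "s i x"] by simp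
      qed
    qed (use lim(5) in auto)
    then have "\<forall>\<^sub>F i in sequentially. (LINT x|lborel. norm (f x - s i x)) < e"
      using order_tendstoD(2)[OF _ e] by simp
    then obtain i where "(LINT x|lborel. norm (f x - s i x)) < e" by (auto simp: eventually_sequentially)
    then show "\<exists>g. integrable lborel g \<and> (LINT x|lborel. norm (f x - g x)) < e \<and> (fourier g \<longlongrightarrow> 0) at_infinity"
      using lim by blast
  qed
qed


section \<open>The transform contracts the square norm\<close>

lemma norm_integral_le_nn_integral:
  fixes f :: "'a \<Rightarrow> 'b::{banach, second_countable_topology}"
  shows "ennreal (norm (integral\<^sup>L M f)) \<le> (\<integral>\<^sup>+x. norm (f x) \<partial>M)"
  by (cases "integrable M f") (auto simp: integral_norm_bound_ennreal not_integrable_integral_eq)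

lemma fourier_cnj:
  fixes f :: "'d::finite fn"
  shows "cnj (fourier f k) = of_real (fconst TYPE('d)) * (LINT y|lborel. wave (- k) y * cnj (f y))"
proof -
  have "cnj (LINT y|lborel. wave k y * f y) = (LINT y|lborel. cnj (wave k y * f y))"
    by (rule integral_bounded_linear'[OF bounded_linear_cnj bounded_linear_cnj, symmetric]) simp
  then show ?thesis by (simp add: fourier_eq cnj_wave)
qed

text \<open>The regularised inversion writes the left-hand side as a Gaussian average over \<open>z\<close> of the
  correlations \<open>\<integral> cnj (f y) * f (y + t z)\<close>, and each correlation is bounded by the squared norm of \<open>f\<close>.\<close>

lemma fourier_L2_regularised:
  fixes f :: "'d::finite fn"
  assumes f: "integrable lborel f" and t: "0 < t"
  shows "(\<integral>\<^sup>+k. ennreal ((norm (fourier f k))\<^sup>2 * gauss (t *\<^sub>R k)) \<partial>lborel) \<le> (\<integral>\<^sup>+x. ennreal ((norm (f x))\<^sup>2) \<partial>lborel)"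
proof -
  have [measurable]: "f \<in> borel_measurable borel" using f by auto
  let ?c = "fconst TYPE('d)"
  let ?A = "\<integral>\<^sup>+x. ennreal ((norm (f x))\<^sup>2) \<partial>lborel"
  have c: "0 < ?c" by (rule fconst_pos)
  have ig: "integrable lborel (\<lambda>k. complex_of_real (gauss (t *\<^sub>R k :: real^'d)))"
    using t by (intro integrable_of_real integrable_gauss_scaled) auto
  have iF: "integrable lborel (\<lambda>k. fourier f k * of_real (gauss (t *\<^sub>R k)))"
    by (rule integrable_mult_bounded[OF ig _ norm_fourier_le]) measurable
  have icf: "integrable lborel (\<lambda>y. cnj (f y))" using f by simp
  have [measurable]: "cnj \<in> borel_measurable borel"
    by (intro borel_measurable_continuous_onI continuous_on_cnj continuous_on_id)
  have "integrable lborel (\<lambda>k. cnj (fourier f k) * (fourier f k * of_real (gauss (t *\<^sub>R k))))"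
    by (rule integrable_mult_bounded[OF iF, where B = "?c * (LINT x|lborel. norm (f x))"])
      (use norm_fourier_le[of f] in auto)
  moreover have sq: "cnj (fourier f k) * (fourier f k * of_real (gauss (t *\<^sub>R k)))
      = of_real ((norm (fourier f k))\<^sup>2 * gauss (t *\<^sub>R k))" for k
    using complex_norm_square[of "fourier f k"] by (simp add: mult_ac)
  ultimately have isq: "integrable lborel (\<lambda>k. complex_of_real ((norm (fourier f k))\<^sup>2 * gauss (t *\<^sub>R k)))"
    by simp
  let ?I = "LINT k|lborel. (norm (fourier f k))\<^sup>2 * gauss (t *\<^sub>R k)"
  have "complex_of_real ?I = (LINT k|lborel. cnj (fourier f k) * (fourier f k * of_real (gauss (t *\<^sub>R k))))"
    unfolding sq by (rule integral_complex_of_real[symmetric])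
  also have "\<dots> = of_real ?c * (LINT k|lborel. LINT y|lborel. wave (- k) y * ((fourier f k * of_real (gauss (t *\<^sub>R k))) * cnj (f y)))"
  proof -
    have "cnj (fourier f k) * (fourier f k * of_real (gauss (t *\<^sub>R k)))
      = of_real ?c * (LINT y|lborel. wave (- k) y * ((fourier f k * of_real (gauss (t *\<^sub>R k))) * cnj (f y)))" for k
      unfolding fourier_cnj integral_mult_left_zero[symmetric] mult.assoc[of "of_real ?c"]
      by (simp add: mult_ac)
    then show ?thesis by (simp only: integral_mult_right_zero)
  qed
  also have "(LINT k|lborel. LINT y|lborel. wave (- k) y * ((fourier f k * of_real (gauss (t *\<^sub>R k))) * cnj (f y)))
     = (LINT y|lborel. LINT k|lborel. wave (- k) y * ((fourier f k * of_real (gauss (t *\<^sub>R k))) * cnj (f y)))"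
    by (rule lborel_pair.Fubini_integral[symmetric])
      (use integrable_pair_kernel[OF iF icf, of "\<lambda>k y. wave (- k) y" 1] in \<open>simp\<close>)
  also have "\<dots> = (LINT y|lborel. cnj (f y) * (LINT z|lborel. f (y + t *\<^sub>R z) * of_real (gauss z)))"
  proof (rule Bochner_Integration.integral_cong[OF refl])
    fix y
    have "(LINT k|lborel. wave (- k) y * ((fourier f k * of_real (gauss (t *\<^sub>R k))) * cnj (f y)))
       = (LINT k|lborel. cnj (f y) * (fourier f k * (wave (- y) k * of_real (gauss (t *\<^sub>R k)))))"
      by (intro Bochner_Integration.integral_cong refl) (metis (no_types, lifting) mult.assoc mult.commute wave_commute wave_minus_right)
    then show "(LINT k|lborel. wave (- k) y * ((fourier f k * of_real (gauss (t *\<^sub>R k))) * cnj (f y)))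
       = cnj (f y) * (LINT z|lborel. f (y + t *\<^sub>R z) * of_real (gauss z))"
      by (simp add: fourier_regularised_inversion[OF f t])
  qed
  finally have I: "complex_of_real ?I = of_real ?c * (LINT y|lborel. cnj (f y) * (LINT z|lborel. f (y + t *\<^sub>R z) * of_real (gauss z)))" .
  have I0: "0 \<le> ?I" by (intro integral_nonneg_AE) auto
  have "ennreal ?I = ennreal (norm (complex_of_real ?I))" using I0 by simp
  also have "\<dots> = ennreal ?c * ennreal (norm (LINT y|lborel. cnj (f y) * (LINT z|lborel. f (y + t *\<^sub>R z) * of_real (gauss z))))"
    unfolding I using c by (simp add: norm_mult ennreal_mult)
  also have "\<dots> \<le> ennreal ?c * (\<integral>\<^sup>+y. norm (cnj (f y) * (LINT z|lborel. f (y + t *\<^sub>R z) * of_real (gauss z))) \<partial>lborel)"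
    by (intro mult_left_mono norm_integral_le_nn_integral) simp
  also have "\<dots> \<le> ennreal ?c * (\<integral>\<^sup>+y. \<integral>\<^sup>+z. ennreal (((norm (f y))\<^sup>2 + (norm (f (y + t *\<^sub>R z)))\<^sup>2) / 2 * gauss z) \<partial>lborel \<partial>lborel)"
  proof (intro mult_left_mono nn_integral_mono)
    fix y
    have "ennreal (norm (cnj (f y) * (LINT z|lborel. f (y + t *\<^sub>R z) * of_real (gauss z))))
      = ennreal (norm (LINT z|lborel. f y * (f (y + t *\<^sub>R z) * of_real (gauss z))))"
      by (simp add: norm_mult)
    also have "\<dots> \<le> (\<integral>\<^sup>+z. norm (f y * (f (y + t *\<^sub>R z) * of_real (gauss z))) \<partial>lborel)"
      by (rule norm_integral_le_nn_integral)
    also have "\<dots> \<le> (\<integral>\<^sup>+z. ennreal (((norm (f y))\<^sup>2 + (norm (f (y + t *\<^sub>R z)))\<^sup>2) / 2 * gauss z) \<partial>lborel)"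
    proof (intro nn_integral_mono ennreal_leI)
      fix z :: "real^'d"
      have "0 \<le> (norm (f y) - norm (f (y + t *\<^sub>R z)))\<^sup>2" by simp
      then have "norm (f y) * norm (f (y + t *\<^sub>R z)) \<le> ((norm (f y))\<^sup>2 + (norm (f (y + t *\<^sub>R z)))\<^sup>2) / 2"
        unfolding power2_diff by simp
      from mult_right_mono[OF this gauss_nonneg[of z]]
      show "norm (f y * (f (y + t *\<^sub>R z) * of_real (gauss z))) \<le> ((norm (f y))\<^sup>2 + (norm (f (y + t *\<^sub>R z)))\<^sup>2) / 2 * gauss z"
        by (simp add: norm_mult mult.assoc)
    qed
    finally show "ennreal (norm (cnj (f y) * (LINT z|lborel. f (y + t *\<^sub>R z) * of_real (gauss z))))
      \<le> (\<integral>\<^sup>+z. ennreal (((norm (f y))\<^sup>2 + (norm (f (y + t *\<^sub>R z)))\<^sup>2) / 2 * gauss z) \<partial>lborel)" .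
  qed simp
  also have "(\<integral>\<^sup>+y. \<integral>\<^sup>+z. ennreal (((norm (f y))\<^sup>2 + (norm (f (y + t *\<^sub>R z)))\<^sup>2) / 2 * gauss z) \<partial>lborel \<partial>lborel)
     = (\<integral>\<^sup>+z. \<integral>\<^sup>+y. ennreal (((norm (f y))\<^sup>2 + (norm (f (y + t *\<^sub>R z)))\<^sup>2) / 2 * gauss z) \<partial>lborel \<partial>lborel)"
    by (rule lborel_pair.Fubini') measurable
  also have "\<dots> = (\<integral>\<^sup>+z. ?A * ennreal (gauss (z :: real^'d)) \<partial>lborel)"
  proof (rule nn_integral_cong)
    fix z :: "real^'d"
    have sh: "(\<integral>\<^sup>+y. ennreal ((norm (f (y + t *\<^sub>R z)))\<^sup>2) \<partial>lborel) = ?A"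
      using nn_integral_lborel_affine[of "\<lambda>x. ennreal ((norm (f x))\<^sup>2)" 1 "t *\<^sub>R z"] by (simp add: add.commute)
    have "(\<integral>\<^sup>+y. ennreal (((norm (f y))\<^sup>2 + (norm (f (y + t *\<^sub>R z)))\<^sup>2) / 2 * gauss z) \<partial>lborel)
        = (\<integral>\<^sup>+y. (ennreal ((norm (f y))\<^sup>2) + ennreal ((norm (f (y + t *\<^sub>R z)))\<^sup>2)) * ennreal (gauss z / 2) \<partial>lborel)"
      by (intro nn_integral_cong) (simp flip: ennreal_mult ennreal_plus)
    also have "\<dots> = (?A + ?A) * ennreal (gauss z / 2)"
      by (subst nn_integral_multc) (auto simp: nn_integral_add sh)
    also have "\<dots> = ?A * (2 * ennreal (gauss z / 2))"
      by (simp add: mult_2 distrib_left distrib_right)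
    also have "2 * ennreal (gauss z / 2) = ennreal (gauss z)"
      by (subst ennreal_numeral[symmetric], subst ennreal_mult[symmetric]) auto
    finally show "(\<integral>\<^sup>+y. ennreal (((norm (f y))\<^sup>2 + (norm (f (y + t *\<^sub>R z)))\<^sup>2) / 2 * gauss z) \<partial>lborel) = ?A * ennreal (gauss z)" .
  qed
  also have "\<dots> = ?A * ennreal (LINT z|lborel. gauss (z :: real^'d))"
    by (subst nn_integral_cmult) (auto simp: nn_integral_eq_integral integrable_gauss)
  also have "ennreal ?c * (?A * ennreal (LINT z|lborel. gauss (z :: real^'d))) = ?A * ennreal (?c * (LINT z|lborel. gauss (z :: real^'d)))"
    using c by (subst ennreal_mult) (auto simp: mult_ac)
  also have "\<dots> = ?A" by (simp add: integral_gauss)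
  finally have "ennreal ?I \<le> ?A" .
  moreover have "(\<integral>\<^sup>+k. ennreal ((norm (fourier f k))\<^sup>2 * gauss (t *\<^sub>R k)) \<partial>lborel) = ennreal ?I"
    using isq[unfolded complex_of_real_integrable_eq] by (intro nn_integral_eq_integral) auto
  ultimately show ?thesis by simp
qed

lemma fourier_L2_contraction:
  fixes f :: "'d::finite fn"
  assumes f: "integrable lborel f"
  shows "(\<integral>\<^sup>+k. ennreal ((norm (fourier f k))\<^sup>2) \<partial>lborel) \<le> (\<integral>\<^sup>+x. ennreal ((norm (f x))\<^sup>2) \<partial>lborel)"
proof -
  have [measurable]: "f \<in> borel_measurable borel" using f by auto
  define t where "t n = inverse (real (Suc n))" for n
  let ?u = "\<lambda>n k. ennreal ((norm (fourier f k))\<^sup>2 * gauss (t n *\<^sub>R k))"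
  have "(\<integral>\<^sup>+k. ennreal ((norm (fourier f k))\<^sup>2) \<partial>lborel) = (\<integral>\<^sup>+k. liminf (\<lambda>n. ?u n k) \<partial>lborel)"
  proof (rule nn_integral_cong)
    fix k :: "real^'d"
    have "(\<lambda>n. Re (complex_of_real (gauss (t n *\<^sub>R k)))) \<longlonglongrightarrow> Re 1"
      unfolding t_def by (intro tendsto_Re gauss_scaled_tendsto)
    then have "(\<lambda>n. ?u n k) \<longlonglongrightarrow> ennreal ((norm (fourier f k))\<^sup>2 * 1)"
      by (intro tendsto_ennrealI tendsto_mult tendsto_const) simp
    then show "ennreal ((norm (fourier f k))\<^sup>2) = liminf (\<lambda>n. ?u n k)"
      using lim_imp_Liminf[OF sequentially_bot] by fastforce
  qed
  also have "\<dots> \<le> liminf (\<lambda>n. \<integral>\<^sup>+k. ?u n k \<partial>lborel)"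
    by (rule nn_integral_liminf) measurable
  also have "\<dots> \<le> liminf (\<lambda>n. \<integral>\<^sup>+x. ennreal ((norm (f x))\<^sup>2) \<partial>lborel)"
    by (intro Liminf_mono always_eventually allI fourier_L2_regularised[OF f]) (simp add: t_def)
  finally show ?thesis by (simp add: Liminf_const)
qed

section \<open>The Fourier transform on square integrable functions\<close>

lemma nn_integral_sq_limit_le:
  fixes s :: "nat \<Rightarrow> 'a \<Rightarrow> complex"
  assumes [measurable]: "\<And>l. s l \<in> borel_measurable M" "f \<in> borel_measurable M"
    and lim: "AE x in M. (\<lambda>l. s l x) \<longlonglongrightarrow> f x"
    and bd: "\<forall>\<^sub>F l in sequentially. (\<integral>\<^sup>+x. ennreal ((norm (s l x))\<^sup>2) \<partial>M) \<le> C"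
  shows "(\<integral>\<^sup>+x. ennreal ((norm (f x))\<^sup>2) \<partial>M) \<le> C"
proof -
  have "(\<integral>\<^sup>+x. ennreal ((norm (f x))\<^sup>2) \<partial>M) = (\<integral>\<^sup>+x. liminf (\<lambda>l. ennreal ((norm (s l x))\<^sup>2)) \<partial>M)"
  proof (rule nn_integral_cong_AE)
    show "AE x in M. ennreal ((norm (f x))\<^sup>2) = liminf (\<lambda>l. ennreal ((norm (s l x))\<^sup>2))"
      using lim
    proof eventually_elim
      case (elim x)
      then have "(\<lambda>l. ennreal ((norm (s l x))\<^sup>2)) \<longlonglongrightarrow> ennreal ((norm (f x))\<^sup>2)"
        by (intro tendsto_ennrealI tendsto_intros)
      then show ?case using lim_imp_Liminf[OF sequentially_bot] by fastforce
    qed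
  qed
  also have "\<dots> \<le> liminf (\<lambda>l. \<integral>\<^sup>+x. ennreal ((norm (s l x))\<^sup>2) \<partial>M)"
    by (rule nn_integral_liminf) measurable
  also have "\<dots> \<le> liminf (\<lambda>l. C)" by (rule Liminf_mono[OF bd])
  finally show ?thesis by (simp add: Liminf_const)
qed

lemma nn_integral_sq_diff_le:
  fixes f g h :: "'a \<Rightarrow> complex"
  assumes [measurable]: "f \<in> borel_measurable M" "g \<in> borel_measurable M" "h \<in> borel_measurable M"
    and f: "(\<integral>\<^sup>+x. ennreal ((norm (h x - f x))\<^sup>2) \<partial>M) \<le> ennreal a"
    and g: "(\<integral>\<^sup>+x. ennreal ((norm (h x - g x))\<^sup>2) \<partial>M) \<le> ennreal b"
    and ab: "0 \<le> a" "0 \<le> b"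
  shows "(\<integral>\<^sup>+x. ennreal ((norm (f x - g x))\<^sup>2) \<partial>M) \<le> ennreal (2 * a + 2 * b)"
proof -
  have "(norm (f x - g x))\<^sup>2 \<le> 2 * (norm (h x - f x))\<^sup>2 + 2 * (norm (h x - g x))\<^sup>2" for x
  proof -
    have "norm (f x - g x) \<le> norm (h x - f x) + norm (h x - g x)"
      using norm_triangle_ineq4[of "h x - g x" "h x - f x"] by (simp add: algebra_simps)
    then have "(norm (f x - g x))\<^sup>2 \<le> (norm (h x - f x) + norm (h x - g x))\<^sup>2"
      by (intro power_mono) auto
    also have "\<dots> \<le> 2 * (norm (h x - f x))\<^sup>2 + 2 * (norm (h x - g x))\<^sup>2"
      using zero_le_power2[of "norm (h x - f x) - norm (h x - g x)"]
      unfolding power2_sum power2_diff by linarith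
    finally show ?thesis .
  qed
  then have "(\<integral>\<^sup>+x. ennreal ((norm (f x - g x))\<^sup>2) \<partial>M)
    \<le> (\<integral>\<^sup>+x. 2 * ennreal ((norm (h x - f x))\<^sup>2) + 2 * ennreal ((norm (h x - g x))\<^sup>2) \<partial>M)"
    by (intro nn_integral_mono, rule order_trans[OF ennreal_leI]) (auto simp: ennreal_mult)
  also have "\<dots> = 2 * (\<integral>\<^sup>+x. ennreal ((norm (h x - f x))\<^sup>2) \<partial>M) + 2 * (\<integral>\<^sup>+x. ennreal ((norm (h x - g x))\<^sup>2) \<partial>M)"
    by (simp add: nn_integral_add nn_integral_cmult)
  also have "\<dots> \<le> 2 * ennreal a + 2 * ennreal b"
    by (intro add_mono mult_left_mono f g) auto
  also have "\<dots> = ennreal (2 * a + 2 * b)" using ab by (simp add: ennreal_mult)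
  finally show ?thesis .
qed

lemma L2_weak_limit:
  fixes f \<psi> :: "'a \<Rightarrow> complex" and s :: "nat \<Rightarrow> 'a \<Rightarrow> complex"
  assumes [measurable]: "\<And>k. s k \<in> borel_measurable M" "f \<in> borel_measurable M" "\<psi> \<in> borel_measurable M"
    and f: "integrable M (\<lambda>x. (norm (f x))\<^sup>2)" and s: "\<And>k. integrable M (\<lambda>x. (norm (s k x))\<^sup>2)"
    and \<psi>: "integrable M (\<lambda>x. (norm (\<psi> x))\<^sup>2)"
    and le: "\<And>k. (\<integral>\<^sup>+x. ennreal ((norm (f x - s k x))\<^sup>2) \<partial>M) \<le> ennreal (C * (1/4) ^ k)" and C: "0 \<le> C"
  shows "(\<lambda>k. LINT x|M. s k x * \<psi> x) \<longlonglongrightarrow> (LINT x|M. f x * \<psi> x)"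
proof -
  let ?B = "LINT x|M. (norm (\<psi> x))\<^sup>2"
  have B: "0 \<le> ?B" by auto
  have bound: "norm ((LINT x|M. s k x * \<psi> x) - (LINT x|M. f x * \<psi> x)) \<le> sqrt (C * ?B) * (1/2) ^ k" for k
  proof -
    have i: "integrable M (\<lambda>x. (norm (f x - s k x))\<^sup>2)"
      using le[of k] by (intro integrableI_bounded) (auto intro: le_less_trans)
    have "(LINT x|M. (norm (f x - s k x))\<^sup>2) \<le> C * (1/4) ^ k"
      using le[of k] C by (subst (asm) nn_integral_eq_integral[OF i]) auto
    then have "(norm (LINT x|M. (f x - s k x) * \<psi> x))\<^sup>2 \<le> C * (1/4) ^ k * ?B"
      using L2_product(3)[OF _ _ i \<psi>] mult_right_mono[OF _ B] by fastforce
    also have "(LINT x|M. (f x - s k x) * \<psi> x) = (LINT x|M. f x * \<psi> x) - (LINT x|M. s k x * \<psi> x)"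
      using L2_product(1)[OF _ _ f \<psi>] L2_product(1)[OF _ _ s \<psi>, of k] by (simp add: left_diff_distrib)
    finally have "norm ((LINT x|M. f x * \<psi> x) - (LINT x|M. s k x * \<psi> x)) \<le> sqrt (C * (1/4) ^ k * ?B)"
      by (rule real_le_rsqrt)
    also have "C * (1/4) ^ k * ?B = (C * ?B) * ((1/2) ^ k)\<^sup>2"
      by (simp add: power2_eq_square flip: power_mult_distrib)
    finally show ?thesis by (simp add: real_sqrt_mult norm_minus_commute)
  qed
  have "(\<lambda>k. sqrt (C * ?B) * (1/2) ^ k) \<longlonglongrightarrow> 0"
    by (intro tendsto_mult_right_zero LIMSEQ_realpow_zero) auto
  then have "(\<lambda>k. (LINT x|M. s k x * \<psi> x) - (LINT x|M. f x * \<psi> x)) \<longlonglongrightarrow> 0"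
    by (rule Lim_null_comparison[rotated]) (use bound in auto)
  then show ?thesis by (simp add: LIM_zero_iff)
qed

text \<open>The completeness of \<open>L2\<close> in the form that is used: geometric decay of the increments makes
  \<open>\<Sum>k. 2^k |w (k+1) - w k|^2\<close> finite almost everywhere, and this sum controls \<open>\<Sum>k. |w (k+1) - w k|\<close>.\<close>

lemma L2_fast_Cauchy_limit:
  fixes w :: "nat \<Rightarrow> 'a \<Rightarrow> complex"
  assumes [measurable]: "\<And>k. w k \<in> borel_measurable M"
    and C: "0 \<le> C" and fast: "\<And>k. (\<integral>\<^sup>+x. ennreal ((norm (w (Suc k) x - w k x))\<^sup>2) \<partial>M) \<le> ennreal (C * (1/4) ^ k)"
  shows "AE x in M. convergent (\<lambda>k. w k x)"
proof -
  let ?u = "\<lambda>k x. 2 ^ k * (norm (w (Suc k) x - w k x))\<^sup>2"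
  have "(\<integral>\<^sup>+x. (\<Sum>k. ennreal (?u k x)) \<partial>M) = (\<Sum>k. \<integral>\<^sup>+x. ennreal (?u k x) \<partial>M)"
    by (rule nn_integral_suminf) measurable
  also have "\<dots> \<le> (\<Sum>k. ennreal (C * (1/2) ^ k))"
  proof (intro suminf_le)
    fix k
    have "(\<integral>\<^sup>+x. ennreal (?u k x) \<partial>M) = ennreal (2 ^ k) * (\<integral>\<^sup>+x. ennreal ((norm (w (Suc k) x - w k x))\<^sup>2) \<partial>M)"
      by (subst nn_integral_cmult[symmetric]) (auto simp: ennreal_mult)
    also have "\<dots> \<le> ennreal (2 ^ k) * ennreal (C * (1/4) ^ k)" by (intro mult_left_mono fast) auto
    also have "\<dots> = ennreal (C * (1/2) ^ k)"
      using C by (subst ennreal_mult[symmetric]) (auto simp: mult.left_commute simp flip: power_mult_distrib)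
    finally show "(\<integral>\<^sup>+x. ennreal (?u k x) \<partial>M) \<le> ennreal (C * (1/2) ^ k)" .
  qed auto
  also have "\<dots> < \<infinity>"
    using C by (subst suminf_ennreal2) (auto intro!: summable_mult summable_geometric)
  finally have "AE x in M. (\<Sum>k. ennreal (?u k x)) \<noteq> \<infinity>"
    by (intro nn_integral_PInf_AE) auto
  then show ?thesis
  proof eventually_elim
    case (elim x)
    then have su: "summable (\<lambda>k. ?u k x)"
      by (intro summable_suminf_not_top) (auto simp: infinity_ennreal_def)
    have "summable (\<lambda>k. norm (w (Suc k) x - w k x))"
    proof (rule summable_comparison_test'[OF summable_add[OF su summable_geometric[of "1/2::real"]]])
      fix k
      let ?y = "norm (w (Suc k) x - w k x)"
      have young: "y \<le> s * y\<^sup>2 + inverse s" if "0 < s" "0 \<le> y" for s y :: real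
      proof -
        have "0 \<le> (s * y - 1)\<^sup>2 + s * y" using that by simp
        then have "s * y \<le> s * (s * y\<^sup>2 + inverse s)"
          using that by (simp add: power2_eq_square algebra_simps)
        then show ?thesis using that by simp
      qed
      show "norm (norm (w (Suc k) x - w k x)) \<le> 2 ^ k * ?y\<^sup>2 + (1/2) ^ k"
        using young[of "2 ^ k" ?y] by (simp add: power_one_over inverse_eq_divide)
    qed auto
    then have "summable (\<lambda>k. w (Suc k) x - w k x)" by (rule summable_norm_cancel)
    then have "convergent (\<lambda>n. \<Sum>k<n. w (Suc k) x - w k x)" by (simp add: summable_iff_convergent)
    then have "convergent (\<lambda>n. w n x - w 0 x)" by (simp add: sum_lessThan_telescope[of "\<lambda>n. w n x"])
    then show ?case using convergent_add[OF _ convergent_const[of "w 0 x"]] by fastforce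
  qed
qed

text \<open>The function \<open>v\<close> is the \<open>L2\<close> limit of the transforms of truncations of \<open>u\<close> to balls. It is
  characterised by the multiplication formula, which is all that the later sections use.\<close>

lemma fourier_L2_extension:
  fixes u :: "'d::finite fn"
  assumes "u \<in> L2_fun"
  obtains v where "v \<in> L2_fun" "(LINT x|lborel. (norm (v x))\<^sup>2) \<le> (LINT x|lborel. (norm (u x))\<^sup>2)"
    "\<And>\<psi>. integrable lborel \<psi> \<Longrightarrow> integrable lborel (\<lambda>x. (norm (\<psi> x))\<^sup>2) \<Longrightarrow>
      (LINT x|lborel. v x * \<psi> x) = (LINT x|lborel. u x * fourier \<psi> x)"
proof -
  have [measurable]: "u \<in> borel_measurable borel" and iu: "integrable lborel (\<lambda>x. (norm (u x))\<^sup>2)"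
    using assms by (auto simp: L2_fun_def)
  let ?N = "\<lambda>f. \<integral>\<^sup>+x. ennreal ((norm (f x))\<^sup>2) \<partial>(lborel :: (real^'d) measure)"
  have N: "integrable lborel (\<lambda>x. (norm (f x))\<^sup>2)" if "f \<in> borel_measurable borel" "?N f \<le> ennreal a" for f :: "'d fn" and a
    using that by (intro integrableI_bounded) (auto intro: le_less_trans)
  define t where "t m x = indicator (ball 0 (real m)) x *\<^sub>R u x" for m x
  have [measurable]: "t m \<in> borel_measurable borel" for m
    unfolding t_def by (intro borel_measurable_scaleR borel_measurable_indicator) auto
  have tle: "norm (t m x) \<le> norm (u x)" for m x by (simp add: t_def indicator_def)
  have it: "integrable lborel (t m)" for m
  proof (rule Bochner_Integration.integrable_bound)
    show "integrable lborel (\<lambda>x. indicator (ball 0 (real m)) x + (norm (u x))\<^sup>2)"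
      by (intro Bochner_Integration.integrable_add integrable_real_indicator iu) (auto simp: emeasure_lborel_ball_finite[unfolded infinity_ennreal_def])
    show "AE x in lborel. norm (t m x) \<le> norm (indicator (ball 0 (real m)) x + (norm (u x))\<^sup>2)"
    proof (intro AE_I2)
      fix x
      have "0 \<le> (norm (u x) - 1)\<^sup>2" by simp
      then have "norm (u x) \<le> 1 + (norm (u x))\<^sup>2" unfolding power2_diff power_one mult_1_right using norm_ge_zero[of "u x"] by linarith
      then show "norm (t m x) \<le> norm (indicator (ball 0 (real m)) x + (norm (u x))\<^sup>2)"
        by (simp add: t_def indicator_def)
    qed
  qed simp
  have it2: "integrable lborel (\<lambda>x. (norm (t m x))\<^sup>2)" for m
    by (rule Bochner_Integration.integrable_bound[OF iu]) (use tle in \<open>auto intro!: power_mono\<close>)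
  have "(\<lambda>m. LINT x|lborel. (norm (u x - t m x))\<^sup>2) \<longlonglongrightarrow> (LINT x|lborel. (norm (u x - u x))\<^sup>2)"
  proof (rule integral_dominated_convergence[OF _ _ iu])
    show "AE x in lborel. (\<lambda>m. (norm (u x - t m x))\<^sup>2) \<longlonglongrightarrow> (norm (u x - u x))\<^sup>2"
    proof (intro AE_I2 tendsto_intros)
      fix x :: "real^'d"
      obtain M where M: "norm x < real M" using reals_Archimedean2 by blast
      have "\<forall>\<^sub>F m in sequentially. t m x = u x"
        unfolding eventually_sequentially using M by (intro exI[of _ M]) (auto simp: t_def)
      then show "(\<lambda>m. t m x) \<longlonglongrightarrow> u x" by (rule tendsto_eventually)
    qed
    show "AE x in lborel. norm ((norm (u x - t m x))\<^sup>2) \<le> (norm (u x))\<^sup>2" for m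
      by (intro AE_I2) (simp add: t_def indicator_def)
  qed measurable
  then have "\<forall>\<^sub>F m in sequentially. (LINT x|lborel. (norm (u x - t m x))\<^sup>2) < (1/4) ^ k" for k
    by (intro order_tendstoD(2)) auto
  \<comment> \<open>a subsequence of truncations with geometric rate, as required by \<open>L2_fast_Cauchy_limit\<close>\<close>
  then have "\<exists>m. (LINT x|lborel. (norm (u x - t m x))\<^sup>2) < (1/4) ^ k" for k
    unfolding eventually_sequentially by blast
  then obtain r where r: "\<And>k. (LINT x|lborel. (norm (u x - t (r k) x))\<^sup>2) < (1/4) ^ k" by metis
  have iut: "integrable lborel (\<lambda>x. (norm (u x - t m x))\<^sup>2)" for m
    by (rule Bochner_Integration.integrable_bound[OF iu]) (auto simp: t_def indicator_def)
  have Nut: "?N (\<lambda>x. u x - t (r k) x) \<le> ennreal (1 * (1/4) ^ k)" for k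
    using r[of k] by (subst nn_integral_eq_integral[OF iut]) auto
  have Ntt: "?N (\<lambda>x. t (r l) x - t (r k) x) \<le> ennreal (2 * (1/4) ^ l + 2 * (1/4) ^ k)" for k l
    using nn_integral_sq_diff_le[of "t (r l)" lborel "t (r k)" u, OF _ _ _ Nut Nut] by simp
  define w where "w k = fourier (t (r k))" for k
  have [measurable]: "w k \<in> borel_measurable borel" for k unfolding w_def by measurable
  have Nw: "?N (w k) \<le> ennreal (LINT x|lborel. (norm (u x))\<^sup>2)" for k
  proof -
    have "?N (w k) \<le> ?N (t (r k))" unfolding w_def by (rule fourier_L2_contraction[OF it])
    also have "\<dots> \<le> ?N u" using tle by (intro nn_integral_mono) (auto intro!: power_mono)
    also have "\<dots> = ennreal (LINT x|lborel. (norm (u x))\<^sup>2)" by (rule nn_integral_eq_integral[OF iu]) auto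
    finally show ?thesis .
  qed
  have Nww: "?N (\<lambda>x. w l x - w k x) \<le> ennreal (2 * (1/4) ^ l + 2 * (1/4) ^ k)" for k l
  proof -
    have "?N (\<lambda>x. w l x - w k x) = ?N (fourier (\<lambda>x. t (r l) x - t (r k) x))"
      unfolding w_def by (simp add: fourier_diff[OF it it])
    also have "\<dots> \<le> ?N (\<lambda>x. t (r l) x - t (r k) x)"
      by (rule fourier_L2_contraction) (intro Bochner_Integration.integrable_diff it)
    also note Ntt
    finally show ?thesis .
  qed
  have mono4: "(1/4::real) ^ l \<le> (1/4) ^ k" if "k \<le> l" for k l :: nat
    using that by (intro power_decreasing) auto
  have Nw4: "?N (\<lambda>x. w l x - w k x) \<le> ennreal (4 * (1/4) ^ k)" if "k \<le> l" for k l
  proof -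
    have "2 * (1/4::real) ^ l + 2 * (1/4) ^ k \<le> 4 * (1/4) ^ k" using mono4[OF that] by simp
    then show ?thesis using order_trans[OF Nww ennreal_leI] by blast
  qed
  define v where "v x = lim (\<lambda>k. w k x)" for x
  have [measurable]: "v \<in> borel_measurable borel" unfolding v_def by measurable
  have "AE x in lborel. convergent (\<lambda>k. w k x)"
    by (rule L2_fast_Cauchy_limit[of w lborel 4]) (use Nw4 in auto)
  then have lim: "AE x in lborel. (\<lambda>k. w k x) \<longlonglongrightarrow> v x"
    unfolding v_def by eventually_elim (simp add: convergent_LIMSEQ_iff)
  have Nv: "?N v \<le> ennreal (LINT x|lborel. (norm (u x))\<^sup>2)"
    by (rule nn_integral_sq_limit_le[OF _ _ lim]) (auto simp: Nw)
  have iv: "integrable lborel (\<lambda>x. (norm (v x))\<^sup>2)" by (rule N[OF _ Nv]) simp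
  have iw: "integrable lborel (\<lambda>x. (norm (w k x))\<^sup>2)" for k by (rule N[OF _ Nw]) simp
  have Nvw: "?N (\<lambda>x. v x - w k x) \<le> ennreal (4 * (1/4) ^ k)" for k
  proof (rule nn_integral_sq_limit_le[where s = "\<lambda>l x. w l x - w k x"])
    show "AE x in lborel. (\<lambda>l. w l x - w k x) \<longlonglongrightarrow> v x - w k x"
      using lim by eventually_elim (intro tendsto_intros)
    show "\<forall>\<^sub>F l in sequentially. ?N (\<lambda>x. w l x - w k x) \<le> ennreal (4 * (1/4) ^ k)"
      unfolding eventually_sequentially using Nw4 by blast
  qed auto
  show thesis
  proof
    show "v \<in> L2_fun" using iv by (simp add: L2_fun_def)
    show "(LINT x|lborel. (norm (v x))\<^sup>2) \<le> (LINT x|lborel. (norm (u x))\<^sup>2)"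
      using Nv by (subst (asm) nn_integral_eq_integral[OF iv]) auto
    fix \<psi> :: "'d fn" assume \<psi>: "integrable lborel \<psi>" and \<psi>2: "integrable lborel (\<lambda>x. (norm (\<psi> x))\<^sup>2)"
    have [measurable]: "\<psi> \<in> borel_measurable borel" using \<psi> by auto
    have "?N (fourier \<psi>) \<le> ennreal (LINT x|lborel. (norm (\<psi> x))\<^sup>2)"
      using fourier_L2_contraction[OF \<psi>] by (subst (asm) nn_integral_eq_integral[OF \<psi>2]) auto
    then have F\<psi>2: "integrable lborel (\<lambda>x. (norm (fourier \<psi> x))\<^sup>2)" by (rule N[rotated]) simp
    have "(\<lambda>k. LINT x|lborel. w k x * \<psi> x) \<longlonglongrightarrow> (LINT x|lborel. v x * \<psi> x)"
      by (rule L2_weak_limit[OF _ _ _ iv iw \<psi>2 Nvw]) auto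
    moreover have "(\<lambda>k. LINT x|lborel. t (r k) x * fourier \<psi> x) \<longlonglongrightarrow> (LINT x|lborel. u x * fourier \<psi> x)"
      by (rule L2_weak_limit[OF _ _ _ iu it2 F\<psi>2 Nut]) auto
    moreover have "(LINT x|lborel. w k x * \<psi> x) = (LINT x|lborel. t (r k) x * fourier \<psi> x)" for k
      unfolding w_def by (rule fourier_multiplication[OF it \<psi>])
    ultimately show "(LINT x|lborel. v x * \<psi> x) = (LINT x|lborel. u x * fourier \<psi> x)"
      using LIMSEQ_unique by simp
  qed
qed

section \<open>Partial derivatives\<close>

lemma partials_Nil [simp]: "partials [] f = f"
  and partials_Cons: "partials (i # is) f = partial i (partials is f)"
  and partials_snoc: "partials (is @ [i]) f = partials is (partial i f)"
  by (simp_all add: partials_def)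

lemma partial_has_derivative: "(f has_derivative D) (at x) \<Longrightarrow> partial i f x = D (axis i 1)"
  by (simp add: partial_def frechet_derivative_at[symmetric])

lemma differentiable_has_derivative:
  "f differentiable (at x) \<Longrightarrow> (f has_derivative frechet_derivative f (at x)) (at x)"
  by (simp add: frechet_derivative_works)

lemma frechet_partials:
  fixes f :: "'d::finite fn"
  assumes "f differentiable (at x)"
  shows "frechet_derivative f (at x) v = (\<Sum>i\<in>UNIV. v $ i *\<^sub>R partial i f x)"
proof -
  interpret linear "frechet_derivative f (at x)"
    using linear_frechet_derivative[OF assms] .
  have "frechet_derivative f (at x) (\<Sum>i\<in>UNIV. v $ i *\<^sub>R axis i 1) = (\<Sum>i\<in>UNIV. v $ i *\<^sub>R partial i f x)"
    by (simp add: sum scaleR partial_def)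
  moreover have "(\<Sum>i\<in>UNIV. v $ i *\<^sub>R axis i 1) = v"
    by (simp add: vec_eq_iff axis_def if_distrib cong: if_cong)
  ultimately show ?thesis by simp
qed

lemma partial_add:
  "f differentiable (at x) \<Longrightarrow> g differentiable (at x) \<Longrightarrow>
    partial i (\<lambda>x. f x + g x) x = partial i f x + partial i g x"
  by (subst partial_has_derivative[OF has_derivative_add[OF differentiable_has_derivative differentiable_has_derivative]])
     (auto simp: partial_def)

lemma partial_mult:
  "f differentiable (at x) \<Longrightarrow> g differentiable (at x) \<Longrightarrow>
    partial i (\<lambda>x. f x * g x) x = f x * partial i g x + partial i f x * g x"
  by (subst partial_has_derivative[OF has_derivative_mult[OF differentiable_has_derivative differentiable_has_derivative]])
     (auto simp: partial_def)

lemma partial_cmult: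
  "f differentiable (at x) \<Longrightarrow> partial i (\<lambda>x. c * f x) x = c * partial i f x"
  by (subst partial_has_derivative[OF has_derivative_mult_right[OF differentiable_has_derivative]])
     (auto simp: partial_def)

lemma coord_has_derivative: "((\<lambda>x. complex_of_real (x $ i)) has_derivative (\<lambda>h. of_real (h $ i))) (at x)"
  by (intro bounded_linear_imp_has_derivative bounded_linear_compose[OF bounded_linear_of_real] bounded_linear_vec_nth)

lemma partial_coord: "partial l (\<lambda>x. complex_of_real (x $ i)) x = (if l = i then 1 else 0)"
  by (subst partial_has_derivative[OF coord_has_derivative]) (simp add: axis_def)

lemma differentiable_coord: "(\<lambda>x. complex_of_real (x $ i)) differentiable (at x)"
  using coord_has_derivative by (auto simp: differentiable_def)

lemma partial_reflect:
  fixes f :: "'d::finite fn"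
  assumes "f differentiable (at (- x))"
  shows "(\<lambda>x. f (- x)) differentiable (at x)" "partial i (\<lambda>x. f (- x)) x = - partial i f (- x)"
proof -
  have D: "(f has_derivative frechet_derivative f (at (- x))) (at (- x))"
    by (rule differentiable_has_derivative[OF assms])
  have "((\<lambda>x::real^'d. - x) has_derivative (\<lambda>h. - h)) (at x)"
    by (intro derivative_intros)
  from has_derivative_compose[OF this D]
  have *: "((\<lambda>x. f (- x)) has_derivative (\<lambda>h. frechet_derivative f (at (- x)) (- h))) (at x)" .
  then show "(\<lambda>x. f (- x)) differentiable (at x)" by (auto simp: differentiable_def)
  show "partial i (\<lambda>x. f (- x)) x = - partial i f (- x)"
    by (subst partial_has_derivative[OF *])
      (simp add: linear_neg[OF linear_frechet_derivative[OF assms]] partial_def)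
qed

section \<open>The Schwartz space\<close>

lemma partials_closed:
  assumes "f \<in> A" and "\<And>f i. f \<in> A \<Longrightarrow> partial i f \<in> A"
  shows "partials is f \<in> A"
  using assms by (induct "is") (auto simp: partials_Cons)

text \<open>Membership in the Schwartz space concerns all iterated partial derivatives; it is shown for a whole
  family that is closed under partial derivatives at once.\<close>

lemma schwartz_coinduct:
  fixes f :: "'d::finite fn"
  assumes "f \<in> A" and diff: "\<And>f x. f \<in> A \<Longrightarrow> f differentiable (at x)"
    and "\<And>f i. f \<in> A \<Longrightarrow> partial i f \<in> A"
    and decay: "\<And>f N. f \<in> A \<Longrightarrow> \<exists>C. \<forall>x. (1 + norm x) ^ N * norm (f x) \<le> C"
  shows "f \<in> schwartz"
proof -
  have A: "partials is f \<in> A" for "is" by (rule partials_closed) fact+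
  have "bdd_above (range (\<lambda>x. (1 + norm x) ^ N * norm (partials is f x)))" for N "is"
  proof -
    obtain C where "\<And>x. (1 + norm x) ^ N * norm (partials is f x) \<le> C" using decay[OF A] by blast
    then show ?thesis by (rule bdd_aboveI2)
  qed
  then show ?thesis using diff[OF A] by (simp add: schwartz_def smooth_def)
qed

lemma schwartz_differentiable: "f \<in> schwartz \<Longrightarrow> f differentiable (at x)"
  unfolding schwartz_def smooth_def by (auto dest: spec[of _ "[]"])

lemma schwartz_partial: "f \<in> schwartz \<Longrightarrow> partial i f \<in> schwartz"
  unfolding schwartz_def smooth_def by (auto simp flip: partials_snoc)

lemma schwartz_partials: "f \<in> schwartz \<Longrightarrow> partials is f \<in> schwartz"
  by (rule partials_closed) (auto intro: schwartz_partial)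

lemma schwartz_seminorm_upper:
  assumes "f \<in> schwartz"
  shows "(1 + norm x) ^ N * norm (partials is f x) \<le> schwartz_seminorm N is f"
  using assms unfolding schwartz_seminorm_def schwartz_def by (auto intro!: cSUP_upper)

lemma schwartz_seminorm_nonneg: "f \<in> schwartz \<Longrightarrow> 0 \<le> schwartz_seminorm N is f"
  using order_trans[OF norm_ge_zero, of "partials is f 0"] schwartz_seminorm_upper[of f 0 N "is"] by simp

lemma schwartz_decay:
  assumes "f \<in> schwartz"
  shows "\<exists>C. \<forall>x. (1 + norm x) ^ N * norm (f x) \<le> C"
  by (intro exI allI) (rule schwartz_seminorm_upper[OF assms, of _ N "[]", unfolded partials_Nil])

lemma schwartz_continuous: "f \<in> schwartz \<Longrightarrow> continuous_on UNIV f"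
  by (simp add: continuous_on_eq_continuous_at differentiable_imp_continuous_within schwartz_differentiable)

lemma schwartz_measurable [measurable_dest]: "f \<in> schwartz \<Longrightarrow> f \<in> borel_measurable borel"
  by (simp add: borel_measurable_continuous_onI schwartz_continuous)

lemma schwartz_bounded:
  assumes "f \<in> schwartz" obtains B where "\<And>x. norm (f x) \<le> B"
  using schwartz_decay[OF assms, of 0] by auto

lemma integrable_decay:
  fixes f :: "'d::finite fn"
  assumes [measurable]: "f \<in> borel_measurable borel"
    and C: "\<And>x. (1 + norm x) ^ (2 * CARD('d)) * norm (f x) \<le> C"
  shows "integrable lborel f"
    and "(LINT x|lborel. norm (f x)) \<le> C * (LINT x|lborel. inverse ((1 + norm (x::real^'d)) ^ (2 * CARD('d))))"
proof -
  have le: "norm (f x) \<le> C * inverse ((1 + norm x) ^ (2 * CARD('d)))" for x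
  proof -
    have "0 < (1 + norm x) ^ (2 * CARD('d))" by (intro zero_less_power) (simp add: add_pos_nonneg)
    then show ?thesis using C[of x] by (simp add: field_simps)
  qed
  have int: "integrable lborel (\<lambda>x::real^'d. C * inverse ((1 + norm x) ^ (2 * CARD('d))))"
    by (intro integrable_mult_right integrable_weight)
  show f: "integrable lborel f"
    by (rule Bochner_Integration.integrable_bound[OF int]) (use le in \<open>auto intro: order_trans[OF _ abs_ge_self]\<close>)
  have "(LINT x|lborel. norm (f x)) \<le> (LINT x|lborel. C * inverse ((1 + norm (x::real^'d)) ^ (2 * CARD('d))))"
    by (rule integral_mono) (use f int le in auto)
  then show "(LINT x|lborel. norm (f x)) \<le> C * (LINT x|lborel. inverse ((1 + norm (x::real^'d)) ^ (2 * CARD('d))))"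
    by simp
qed

lemma schwartz_integrable:
  fixes f :: "'d::finite fn"
  assumes "f \<in> schwartz" shows "integrable lborel f"
proof -
  obtain C where "\<And>x. (1 + norm x) ^ (2 * CARD('d)) * norm (f x) \<le> C" using schwartz_decay[OF assms] by blast
  then show ?thesis by (rule integrable_decay(1)[OF schwartz_measurable[OF assms]])
qed

lemma schwartz_add:
  fixes f g :: "'d::finite fn"
  assumes "f \<in> schwartz" "g \<in> schwartz"
  shows "(\<lambda>x. f x + g x) \<in> schwartz"
proof (rule schwartz_coinduct[of _ "{\<lambda>x. f x + g x | f g. f \<in> schwartz \<and> g \<in> (schwartz :: 'd fn set)}"])
  fix h N assume "h \<in> {\<lambda>x. f x + g x | f g. f \<in> schwartz \<and> g \<in> (schwartz :: 'd fn set)}"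
  then obtain f g :: "'d fn" where h: "h = (\<lambda>x. f x + g x)" "f \<in> schwartz" "g \<in> schwartz" by auto
  obtain C where C: "\<And>x. (1 + norm x) ^ N * norm (f x) \<le> C" using schwartz_decay[OF h(2)] by blast
    obtain D where D: "\<And>x. (1 + norm x) ^ N * norm (g x) \<le> D" using schwartz_decay[OF h(3)] by blast
  have "(1 + norm x) ^ N * norm (h x) \<le> C + D" for x
  proof -
    have "(1 + norm x) ^ N * norm (h x) \<le> (1 + norm x) ^ N * (norm (f x) + norm (g x))"
      unfolding h by (intro mult_left_mono norm_triangle_ineq) auto
    then show ?thesis using C[of x] D[of x] by (simp add: distrib_left)
  qed
  then show "\<exists>C. \<forall>x. (1 + norm x) ^ N * norm (h x) \<le> C" by blast
next
  fix h i assume "h \<in> {\<lambda>x. f x + g x | f g. f \<in> schwartz \<and> g \<in> (schwartz :: 'd fn set)}"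
  then obtain f g :: "'d fn" where h: "h = (\<lambda>x. f x + g x)" "f \<in> schwartz" "g \<in> schwartz" by auto
  have "partial i h = (\<lambda>x. partial i f x + partial i g x)"
    unfolding h by (rule ext) (intro partial_add schwartz_differentiable h)
  then show "partial i h \<in> {\<lambda>x. f x + g x | f g. f \<in> schwartz \<and> g \<in> (schwartz :: 'd fn set)}"
    using h schwartz_partial by blast
qed (use assms in \<open>auto intro!: differentiable_add[OF schwartz_differentiable schwartz_differentiable]\<close>)

lemma schwartz_cmult:
  fixes f :: "'d::finite fn"
  assumes "f \<in> schwartz"
  shows "(\<lambda>x. c * f x) \<in> schwartz"
proof (rule schwartz_coinduct[of _ "{\<lambda>x. c * f x | f. f \<in> (schwartz :: 'd fn set)}"])
  fix h N assume "h \<in> {\<lambda>x. c * f x | f. f \<in> (schwartz :: 'd fn set)}"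
  then obtain f :: "'d fn" where h: "h = (\<lambda>x. c * f x)" "f \<in> schwartz" by auto
  obtain C where C: "\<And>x. (1 + norm x) ^ N * norm (f x) \<le> C" using schwartz_decay[OF h(2)] by blast
  have "(1 + norm x) ^ N * norm (h x) \<le> norm c * C" for x
    using mult_left_mono[OF C, of "norm c" x] by (simp add: h norm_mult mult_ac)
  then show "\<exists>C. \<forall>x. (1 + norm x) ^ N * norm (h x) \<le> C" by blast
next
  fix h i assume "h \<in> {\<lambda>x. c * f x | f. f \<in> (schwartz :: 'd fn set)}"
  then obtain f :: "'d fn" where h: "h = (\<lambda>x. c * f x)" "f \<in> schwartz" by auto
  have "partial i h = (\<lambda>x. c * partial i f x)"
    unfolding h by (rule ext) (intro partial_cmult schwartz_differentiable h)
  then show "partial i h \<in> {\<lambda>x. c * f x | f. f \<in> (schwartz :: 'd fn set)}"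
    using h schwartz_partial by blast
qed (use assms in \<open>auto intro!: differentiable_mult[OF differentiable_const schwartz_differentiable]\<close>)

lemma schwartz_0: "(\<lambda>_. 0 :: complex) \<in> (schwartz :: 'd::finite fn set)"
proof (rule schwartz_coinduct[of _ "{\<lambda>_. 0}"])
  have "partial i (\<lambda>_. 0) x = 0" for i and x :: "real^'d"
    by (subst partial_has_derivative[OF has_derivative_const]) simp
  then have "partial i (\<lambda>_. 0 :: complex) = (\<lambda>_. 0)" for i :: 'd by (rule ext)
  then show "partial i f \<in> {\<lambda>_. 0}" if "f \<in> {\<lambda>_. 0}" for f :: "'d fn" and i
    using that by auto
qed auto

lemma schwartz_coord_mult:
  fixes f :: "'d::finite fn"
  assumes "f \<in> schwartz"
  shows "(\<lambda>x. of_real (x $ i) * f x) \<in> schwartz"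
proof -
  define A where "A = {\<lambda>x. of_real (x $ i) * f x + g x | f g. f \<in> schwartz \<and> g \<in> (schwartz :: 'd fn set)}"
  show ?thesis
  proof (rule schwartz_coinduct[of _ A])
    show "(\<lambda>x. of_real (x $ i) * f x) \<in> A"
      unfolding A_def by (intro CollectI exI[of _ f] exI[of _ "\<lambda>_. 0"]) (simp add: assms schwartz_0)
  next
    fix h N assume "h \<in> A"
    then obtain f g where h: "h = (\<lambda>x. of_real (x $ i) * f x + g x)" "f \<in> schwartz" "g \<in> schwartz"
      by (auto simp: A_def)
    obtain C where C: "\<And>x. (1 + norm x) ^ Suc N * norm (f x) \<le> C" using schwartz_decay[OF h(2)] by blast
      obtain D where D: "\<And>x. (1 + norm x) ^ N * norm (g x) \<le> D" using schwartz_decay[OF h(3)] by blast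
    have "(1 + norm x) ^ N * norm (h x) \<le> C + D" for x
    proof -
      have "norm (h x) \<le> norm (of_real (x $ i) * f x) + norm (g x)"
        unfolding h by (rule norm_triangle_ineq)
      also have "norm (of_real (x $ i) * f x) \<le> (1 + norm x) * norm (f x)"
        using component_le_norm_cart[of x i] by (auto simp: norm_mult intro!: mult_right_mono)
      finally have "(1 + norm x) ^ N * norm (h x) \<le> (1 + norm x) ^ N * ((1 + norm x) * norm (f x) + norm (g x))"
        by (intro mult_left_mono) auto
      also have "\<dots> = (1 + norm x) ^ Suc N * norm (f x) + (1 + norm x) ^ N * norm (g x)"
        by (simp add: algebra_simps)
      finally show ?thesis using C[of x] D[of x] by linarith
    qed
    then show "\<exists>C. \<forall>x. (1 + norm x) ^ N * norm (h x) \<le> C" by blast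
  next
    fix h l assume "h \<in> A"
    then obtain f g where h: "h = (\<lambda>x. of_real (x $ i) * f x + g x)" "f \<in> schwartz" "g \<in> schwartz"
      by (auto simp: A_def)
    note d = schwartz_differentiable[OF h(2)] schwartz_differentiable[OF h(3)] differentiable_coord
    have "partial l h = (\<lambda>x. of_real (x $ i) * partial l f x + ((if l = i then 1 else 0) * f x + partial l g x))"
      unfolding h by (rule ext) (simp add: partial_add partial_mult partial_coord d differentiable_mult)
    moreover have "(\<lambda>x. (if l = i then 1 else 0) * f x + partial l g x) \<in> schwartz"
      by (intro schwartz_add schwartz_cmult schwartz_partial h)
    ultimately show "partial l h \<in> A"
      using schwartz_partial[OF h(2), of l] unfolding A_def by (intro CollectI exI conjI)
  next
    fix h x assume "h \<in> A"
    then show "h differentiable (at x)"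
      by (auto simp: A_def intro!: differentiable_add[OF differentiable_mult[OF differentiable_coord schwartz_differentiable] schwartz_differentiable])
  qed
qed

lemma schwartz_coords_mult:
  fixes f :: "'d::finite fn"
  assumes "f \<in> schwartz"
  shows "(\<lambda>x. of_real (\<Prod>i\<leftarrow>is. x $ i) * f x) \<in> schwartz"
  using assms
proof (induct "is")
  case (Cons i "is")
  show ?case using schwartz_coord_mult[OF Cons(1)[OF Cons(2)], of i] by (simp add: mult_ac)
qed simp

lemma schwartz_reflect:
  fixes f :: "'d::finite fn"
  assumes "f \<in> schwartz"
  shows "(\<lambda>x. f (- x)) \<in> schwartz"
proof (rule schwartz_coinduct[of _ "{\<lambda>x. f (- x) | f. f \<in> schwartz}"])
  fix h N assume "h \<in> {\<lambda>x. f (- x) | f. f \<in> (schwartz :: 'd fn set)}"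
  then obtain f :: "'d fn" where h: "h = (\<lambda>x. f (- x))" "f \<in> schwartz" by auto
  obtain C where C: "\<And>x. (1 + norm x) ^ N * norm (f x) \<le> C" using schwartz_decay[OF h(2)] by blast
  then have "(1 + norm x) ^ N * norm (h x) \<le> C" for x using C[of "- x"] by (simp add: h)
  then show "\<exists>C. \<forall>x. (1 + norm x) ^ N * norm (h x) \<le> C" by blast
next
  fix h i assume "h \<in> {\<lambda>x. f (- x) | f. f \<in> (schwartz :: 'd fn set)}"
  then obtain f :: "'d fn" where h: "h = (\<lambda>x. f (- x))" "f \<in> schwartz" by auto
  have "partial i h = (\<lambda>x. (\<lambda>y. (-1) * partial i f y) (- x))"
    unfolding h by (rule ext) (simp add: partial_reflect(2) schwartz_differentiable h)
  moreover have "(\<lambda>y. (-1) * partial i f y) \<in> schwartz" by (intro schwartz_cmult schwartz_partial h)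
  ultimately show "partial i h \<in> {\<lambda>x. f (- x) | f. f \<in> (schwartz :: 'd fn set)}"
    by (intro CollectI exI conjI)
qed (use assms in \<open>auto intro!: partial_reflect(1)[OF schwartz_differentiable]\<close>)

lemma partials_reflect:
  fixes f :: "'d::finite fn"
  assumes "f \<in> schwartz"
  shows "partials is (\<lambda>x. f (- x)) = (\<lambda>x. (-1) ^ length is * partials is f (- x))"
proof (induct "is")
  case (Cons i "is")
  have d: "partials is f differentiable (at y)" for y by (intro schwartz_differentiable schwartz_partials assms)
  show ?case
    by (rule ext) (simp add: partials_Cons Cons partial_cmult partial_reflect[OF d])
qed simp

section \<open>The Fourier transform on the Schwartz space\<close>

lemma wave_approx: "norm (wave v x - 1 + \<i> * of_real (v \<bullet> x)) \<le> (v \<bullet> x)\<^sup>2 / 2"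
proof -
  have e: "iexp t - (\<Sum>k\<le>1. (\<i> * t) ^ k / fact k) = exp (\<i> * t) - 1 - \<i> * t" for t :: real by simp
  show ?thesis
    using iexp_approx1[of "- (v \<bullet> x)" 1] unfolding e by (simp add: wave_def algebra_simps power2_eq_square)
qed

text \<open>Differentiation under the integral, with the second order remainder of the wave giving an explicit
  quadratic error bound.\<close>

lemma fourier_has_derivative:
  fixes f :: "'d::finite fn"
  assumes f: "f \<in> schwartz"
  shows "(fourier f has_derivative (\<lambda>v. \<Sum>i\<in>UNIV. v $ i *\<^sub>R fourier (\<lambda>x. - \<i> * (of_real (x $ i) * f x)) k)) (at k)"
proof -
  let ?c = "fconst TYPE('d)"
  have c: "0 < ?c" by (rule fconst_pos)
  have fi: "integrable lborel f" by (rule schwartz_integrable[OF f])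
  have xi: "integrable lborel (\<lambda>x. of_real (x $ i) * f x)" for i
    by (intro schwartz_integrable schwartz_coord_mult f)
  obtain C where C: "\<And>x. (1 + norm x) ^ (2 * CARD('d) + 2) * norm (f x) \<le> C" using schwartz_decay[OF f] by blast
  have x2: "integrable lborel (\<lambda>x. of_real ((norm x)\<^sup>2) * f x)"
  proof (rule integrable_decay(1)[where C = C])
    fix x :: "real^'d"
    have "(1 + norm x) ^ (2 * CARD('d)) * norm (of_real ((norm x)\<^sup>2) * f x)
       = (1 + norm x) ^ (2 * CARD('d)) * (norm x)\<^sup>2 * norm (f x)" by (simp add: norm_mult norm_power)
    also have "\<dots> \<le> (1 + norm x) ^ (2 * CARD('d)) * (1 + norm x)\<^sup>2 * norm (f x)"
      by (intro mult_right_mono mult_left_mono power_mono) auto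
    also have "\<dots> \<le> C" using C[of x] unfolding power_add .
    finally show "(1 + norm x) ^ (2 * CARD('d)) * norm (of_real ((norm x)\<^sup>2) * f x) \<le> C" .
  qed (use schwartz_measurable[OF f] in simp)
  let ?M = "LINT x|lborel. norm (of_real ((norm x)\<^sup>2) * f x)"
  let ?D = "\<lambda>v. \<Sum>i\<in>UNIV. v $ i *\<^sub>R fourier (\<lambda>x. - \<i> * (of_real (x $ i) * f x)) k"
  have D: "?D v = of_real ?c * (LINT x|lborel. wave k x * (- \<i> * of_real (v \<bullet> x) * f x))" for v
  proof -
    have "(\<Sum>i\<in>UNIV. of_real (v $ i) * (LINT x|lborel. wave k x * (- \<i> * (of_real (x $ i) * f x))))
       = (LINT x|lborel. (\<Sum>i\<in>UNIV. of_real (v $ i) * (wave k x * (- \<i> * (of_real (x $ i) * f x)))))"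
      using integrable_wave[OF integrable_mult_right[OF xi]]
      by (subst Bochner_Integration.integral_sum) (auto intro!: integrable_mult_right)
    also have "(\<lambda>x. \<Sum>i\<in>UNIV. of_real (v $ i) * (wave k x * (- \<i> * (of_real (x $ i) * f x))))
       = (\<lambda>x. wave k x * (- \<i> * of_real (v \<bullet> x) * f x))"
    proof
      fix x
      have "(\<Sum>i\<in>UNIV. of_real (v $ i) * (wave k x * (- \<i> * (of_real (x $ i) * f x))))
        = (\<Sum>i\<in>UNIV. of_real (v $ i * x $ i) * (wave k x * (- \<i> * f x)))"
        by (intro sum.cong refl) (simp add: mult_ac)
      also have "\<dots> = of_real (v \<bullet> x) * (wave k x * (- \<i> * f x))"
        unfolding sum_distrib_right[symmetric] by (simp add: inner_vec_def)
      finally show "(\<Sum>i\<in>UNIV. of_real (v $ i) * (wave k x * (- \<i> * (of_real (x $ i) * f x))))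
        = wave k x * (- \<i> * of_real (v \<bullet> x) * f x)"
        by (simp add: mult_ac)
    qed
    finally have *: "(\<Sum>i\<in>UNIV. of_real (v $ i) * (LINT x|lborel. wave k x * (- \<i> * (of_real (x $ i) * f x))))
       = (LINT x|lborel. wave k x * (- \<i> * of_real (v \<bullet> x) * f x))" .
    have "?D v = (\<Sum>i\<in>UNIV. of_real ?c * (of_real (v $ i) * (LINT x|lborel. wave k x * (- \<i> * (of_real (x $ i) * f x)))))"
      unfolding fourier_eq scaleR_conv_of_real by (intro sum.cong refl mult.left_commute)
    also have "\<dots> = of_real ?c * (LINT x|lborel. wave k x * (- \<i> * of_real (v \<bullet> x) * f x))"
      unfolding sum_distrib_left[symmetric] * ..
    finally show ?thesis .
  qed
  have est: "norm (fourier f (k + v) - fourier f k - ?D v) \<le> ?c * ?M / 2 * norm v * norm v" for v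
  proof -
    have vx: "integrable lborel (\<lambda>x. - \<i> * of_real (v \<bullet> x) * f x)"
    proof -
      have "(\<lambda>x. - \<i> * of_real (v \<bullet> x) * f x) = (\<lambda>x. \<Sum>i\<in>UNIV. (- \<i> * of_real (v $ i)) * (of_real (x $ i) * f x))"
      proof
        fix x
        have "(\<Sum>i\<in>UNIV. (- \<i> * of_real (v $ i)) * (of_real (x $ i) * f x)) = (\<Sum>i\<in>UNIV. of_real (v $ i * x $ i) * (- \<i> * f x))"
          by (intro sum.cong refl) (simp add: mult_ac)
        also have "\<dots> = of_real (v \<bullet> x) * (- \<i> * f x)"
          unfolding sum_distrib_right[symmetric] by (simp add: inner_vec_def)
        finally show "- \<i> * of_real (v \<bullet> x) * f x = (\<Sum>i\<in>UNIV. (- \<i> * of_real (v $ i)) * (of_real (x $ i) * f x))"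
          by (simp add: mult_ac)
      qed
      moreover have "integrable lborel (\<lambda>x. \<Sum>i\<in>UNIV. (- \<i> * of_real (v $ i)) * (of_real (x $ i) * f x))"
        by (intro Bochner_Integration.integrable_sum integrable_mult_right xi)
      ultimately show ?thesis by simp
    qed
    let ?a = "\<lambda>x. wave k x * (wave v x * f x)"
    let ?b = "\<lambda>x. wave k x * f x"
    let ?d = "\<lambda>x. wave k x * (- \<i> * of_real (v \<bullet> x) * f x)"
    let ?r = "\<lambda>x. wave k x * ((wave v x - 1 + \<i> * of_real (v \<bullet> x)) * f x)"
    have int: "integrable lborel ?a" "integrable lborel ?b" "integrable lborel ?d"
      by (intro integrable_wave fi vx)+
    have r: "?r = (\<lambda>x. ?a x - ?b x - ?d x)" by (rule ext) (simp add: algebra_simps)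
    have ir: "integrable lborel ?r" unfolding r by (intro Bochner_Integration.integrable_diff int)
    have "fourier f (k + v) = of_real ?c * integral\<^sup>L lborel ?a"
      by (simp only: fourier_eq wave_add mult.assoc)
    moreover have "fourier f k = of_real ?c * integral\<^sup>L lborel ?b" by (simp only: fourier_eq)
    moreover have "integral\<^sup>L lborel ?r = integral\<^sup>L lborel ?a - integral\<^sup>L lborel ?b - integral\<^sup>L lborel ?d"
      unfolding r using int by (subst Bochner_Integration.integral_diff) (auto intro!: Bochner_Integration.integrable_diff)
    ultimately have eq: "fourier f (k + v) - fourier f k - ?D v = of_real ?c * integral\<^sup>L lborel ?r"
      unfolding D by (simp only: right_diff_distrib)
    have "norm (integral\<^sup>L lborel ?r) \<le> (LINT x|lborel. (norm v)\<^sup>2 / 2 * norm (of_real ((norm x)\<^sup>2) * f x))"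
    proof (rule Bochner_Integration.integral_norm_bound_integral[OF ir])
      show "integrable lborel (\<lambda>x. (norm v)\<^sup>2 / 2 * norm (of_real ((norm x)\<^sup>2) * f x))"
        using x2 by (intro integrable_mult_right integrable_norm)
      fix x :: "real^'d"
      have "\<bar>v \<bullet> x\<bar> \<le> \<bar>norm v * norm x\<bar>" using Cauchy_Schwarz_ineq2[of v x] by simp
      then have "(v \<bullet> x)\<^sup>2 \<le> (norm v * norm x)\<^sup>2" unfolding abs_le_square_iff .
      then have "norm (wave v x - 1 + \<i> * of_real (v \<bullet> x)) \<le> (norm v)\<^sup>2 / 2 * (norm x)\<^sup>2"
        using wave_approx[of v x] by (simp add: power_mult_distrib)
      from mult_right_mono[OF this norm_ge_zero[of "f x"]]
      show "norm (?r x) \<le> (norm v)\<^sup>2 / 2 * norm (of_real ((norm x)\<^sup>2) * f x)"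
        by (simp add: norm_mult norm_power mult.assoc)
    qed
    also have "\<dots> = (norm v)\<^sup>2 / 2 * ?M" by simp
    finally have "?c * norm (integral\<^sup>L lborel ?r) \<le> ?c * ((norm v)\<^sup>2 / 2 * ?M)"
      by (intro mult_left_mono) (use c in auto)
    also have "\<dots> = ?c * ?M / 2 * norm v * norm v" by (simp add: power2_eq_square)
    finally show ?thesis
      unfolding eq norm_mult using c by simp
  qed
  show ?thesis
    unfolding has_derivative_at
  proof
    show "bounded_linear ?D"
      by (intro bounded_linear_sum bounded_linear_compose[OF bounded_linear_scaleR_left] bounded_linear_vec_nth)
    have "((\<lambda>v::real^'d. ?c * ?M / 2 * norm v) \<longlongrightarrow> ?c * ?M / 2 * norm (0::real^'d)) (at 0)"
      by (intro tendsto_intros)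
    then have lim: "((\<lambda>v::real^'d. ?c * ?M / 2 * norm v) \<longlongrightarrow> 0) (at 0)" by simp
    show "(\<lambda>v. norm (fourier f (k + v) - fourier f k - ?D v) / norm v) \<midarrow>0\<rightarrow> 0"
    proof (rule Lim_null_comparison[OF _ lim])
      have "\<forall>\<^sub>F v in at 0. v \<noteq> (0::real^'d)" by (simp add: eventually_at_filter)
      then show "\<forall>\<^sub>F v in at 0. norm (norm (fourier f (k + v) - fourier f k - ?D v) / norm v) \<le> ?c * ?M / 2 * norm v"
        by eventually_elim (use est in \<open>simp add: divide_le_eq\<close>)
    qed
  qed
qed

lemma fourier_differentiable: "f \<in> schwartz \<Longrightarrow> fourier f differentiable (at k)"
  using fourier_has_derivative by (auto simp: differentiable_def)

lemma partial_fourier: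
  assumes "f \<in> schwartz"
  shows "partial i (fourier f) = fourier (\<lambda>x. - \<i> * (of_real (x $ i) * f x))"
  by (rule ext, subst partial_has_derivative[OF fourier_has_derivative[OF assms]])
     (simp add: axis_def if_distrib[of "\<lambda>r. r *\<^sub>R _"] cong: if_cong)

lemma partials_fourier:
  assumes "f \<in> schwartz"
  shows "partials is (fourier f) = fourier (\<lambda>x. (- \<i>) ^ length is * (of_real (\<Prod>i\<leftarrow>is. x $ i) * f x))"
proof (induct "is")
  case (Cons i "is")
  have s: "(\<lambda>x. (- \<i>) ^ length is * (of_real (\<Prod>i\<leftarrow>is. x $ i) * f x)) \<in> schwartz"
    by (intro schwartz_cmult schwartz_coords_mult assms)
  show ?case
    unfolding partials_Cons Cons partial_fourier[OF s] by (simp add: mult_ac)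
qed simp


text \<open>The integral of a difference quotient vanishes by translation invariance, and the decay of the
  derivative dominates the difference quotients.\<close>

lemma integral_partial_zero:
  fixes g :: "'d::finite fn"
  assumes g: "integrable lborel g" and d: "\<And>x. g differentiable (at x)"
    and C: "\<And>x. (1 + norm x) ^ (2 * CARD('d)) * norm (partial i g x) \<le> C"
    and [measurable]: "partial i g \<in> borel_measurable borel"
  shows "(LINT x|lborel. partial i g x) = 0"
proof -
  have [measurable]: "g \<in> borel_measurable borel" using g by auto
  let ?e = "axis i 1 :: real^'d"
  define t where "t n = inverse (real (Suc n))" for n
  have t: "0 < t n" "t n \<le> 1" for n by (auto simp: t_def inverse_le_1_iff)
  have t0: "t \<longlonglongrightarrow> 0" unfolding t_def by (rule LIMSEQ_inverse_real_of_nat)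
  have C0: "0 \<le> C" using order_trans[OF _ C[of 0]] by simp
  have line: "((\<lambda>s. g (x + s *\<^sub>R ?e)) has_derivative (\<lambda>h. h *\<^sub>R partial i g (x + s *\<^sub>R ?e))) (at s within S)" for x s S
  proof -
    have D: "(g has_derivative frechet_derivative g (at (x + s *\<^sub>R ?e))) (at (x + s *\<^sub>R ?e))"
      by (rule differentiable_has_derivative[OF d])
    have "((\<lambda>s. x + s *\<^sub>R ?e) has_derivative (\<lambda>h. h *\<^sub>R ?e)) (at s within S)"
      by (auto intro!: derivative_eq_intros)
    from has_derivative_compose[OF this D] show ?thesis
      using linear_scale[OF linear_frechet_derivative[OF d]] by (simp add: partial_def)
  qed
  let ?q = "\<lambda>n x. (g (x + t n *\<^sub>R ?e) - g x) /\<^sub>R t n"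
  have lim: "(\<lambda>n. LINT x|lborel. ?q n x) \<longlonglongrightarrow> (LINT x|lborel. partial i g x)"
  proof (rule integral_dominated_convergence[where w = "\<lambda>x. C * 2 ^ (2 * CARD('d)) * inverse ((1 + norm x) ^ (2 * CARD('d)))"])
    show "AE x in lborel. (\<lambda>n. ?q n x) \<longlonglongrightarrow> partial i g x"
    proof (intro AE_I2)
      fix x
      let ?G = "\<lambda>h. (g (x + h *\<^sub>R ?e) - g x) /\<^sub>R h"
      have lim: "((\<lambda>h. norm (g (x + h *\<^sub>R ?e) - g x - h *\<^sub>R partial i g x) / norm h) \<longlongrightarrow> 0) (at 0)"
        using line[of x 0 UNIV] by (simp add: has_derivative_at)
      have "((\<lambda>h. ?G h - partial i g x) \<longlongrightarrow> 0) (at 0)"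
      proof (rule Lim_null_comparison[OF _ lim])
        have "\<forall>\<^sub>F h in at 0. h \<noteq> (0::real)" by (simp add: eventually_at_filter)
        then show "\<forall>\<^sub>F h in at 0. norm (?G h - partial i g x) \<le> norm (g (x + h *\<^sub>R ?e) - g x - h *\<^sub>R partial i g x) / norm h"
        proof eventually_elim
          case (elim h)
          then have "?G h - partial i g x = (g (x + h *\<^sub>R ?e) - g x - h *\<^sub>R partial i g x) /\<^sub>R h"
            by (simp add: scaleR_diff_right)
          then show ?case by (simp add: divide_inverse)
        qed
      qed
      then have "(?G \<longlongrightarrow> partial i g x) (at 0)" by (rule LIM_zero_cancel)
      then show "(\<lambda>n. ?q n x) \<longlonglongrightarrow> partial i g x"
        using t0 t(1) by (auto simp: tendsto_at_iff_sequentially o_def less_imp_neq[symmetric])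
    qed
    show "AE x in lborel. norm (?q n x) \<le> C * 2 ^ (2 * CARD('d)) * inverse ((1 + norm x) ^ (2 * CARD('d)))" for n
    proof (intro AE_I2)
      fix x :: "real^'d"
      let ?B = "C * 2 ^ (2 * CARD('d)) * inverse ((1 + norm x) ^ (2 * CARD('d)))"
      have "norm (g (x + t n *\<^sub>R ?e) - g (x + 0 *\<^sub>R ?e)) \<le> ?B * norm (t n - 0)"
      proof (rule differentiable_bound[where S = "{0..1}" and f = "\<lambda>s. g (x + s *\<^sub>R ?e)", OF _ line])
        fix s :: real assume s: "s \<in> {0..1}"
        have "norm x \<le> norm (x + s *\<^sub>R ?e) + norm (s *\<^sub>R ?e)"
          using norm_triangle_ineq4[of "x + s *\<^sub>R ?e" "s *\<^sub>R ?e"] by simp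
        moreover have "norm (s *\<^sub>R ?e) \<le> 1" using s by simp
        moreover have "1 + a \<le> 2 * (1 + b)" if "a \<le> b + c" "c \<le> 1" "0 \<le> b" for a b c :: real
          using that by simp
        ultimately have "1 + norm x \<le> 2 * (1 + norm (x + s *\<^sub>R ?e))" using norm_ge_zero by blast
        then have "(1 + norm x) ^ (2 * CARD('d)) \<le> (2 * (1 + norm (x + s *\<^sub>R ?e))) ^ (2 * CARD('d))"
          by (intro power_mono) auto
        then have "(1 + norm x) ^ (2 * CARD('d)) * norm (partial i g (x + s *\<^sub>R ?e))
          \<le> (2 * (1 + norm (x + s *\<^sub>R ?e))) ^ (2 * CARD('d)) * norm (partial i g (x + s *\<^sub>R ?e))"
          by (intro mult_right_mono) auto
        also have "\<dots> \<le> 2 ^ (2 * CARD('d)) * C"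
          using mult_left_mono[OF C[of "x + s *\<^sub>R ?e"], of "2 ^ (2 * CARD('d))"]
          unfolding power_mult_distrib mult.assoc by simp
        finally have "(1 + norm x) ^ (2 * CARD('d)) * norm (partial i g (x + s *\<^sub>R ?e)) \<le> 2 ^ (2 * CARD('d)) * C" .
        moreover have "0 < (1 + norm x) ^ (2 * CARD('d))" by (intro zero_less_power) (simp add: add_pos_nonneg)
        ultimately have "norm (partial i g (x + s *\<^sub>R ?e)) \<le> ?B" by (simp add: field_simps)
        then show "onorm (\<lambda>h. h *\<^sub>R partial i g (x + s *\<^sub>R ?e)) \<le> ?B"
          using onorm_scaleR_left[OF bounded_linear_ident, of "partial i g (x + s *\<^sub>R ?e)"] by (simp add: onorm_id)
      qed (use t[of n] in auto)
      then have le: "norm (g (x + t n *\<^sub>R ?e) - g x) \<le> ?B * t n" using t(1)[of n] by simp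
      have "norm (?q n x) = norm (g (x + t n *\<^sub>R ?e) - g x) / t n"
        unfolding norm_scaleR using t(1)[of n] by (simp add: divide_inverse)
      also have "\<dots> \<le> ?B" using le t(1)[of n] by (simp only: pos_divide_le_eq)
      finally show "norm (?q n x) \<le> ?B" .
    qed
  qed (auto intro!: integrable_mult_right integrable_weight)
  have "(LINT x|lborel. ?q n x) = 0" for n
  proof -
    have "integrable lborel (\<lambda>x. g (x + t n *\<^sub>R ?e))"
      using integrable_lborel_affine[OF g, of 1 "t n *\<^sub>R ?e"] by (simp add: add.commute)
    then show ?thesis
      using g integral_lborel_shift[of g "t n *\<^sub>R ?e"] by (simp add: add.commute)
  qed
  then have "(\<lambda>n. LINT x|lborel. ?q n x) = (\<lambda>_. 0)" by (rule ext)
  with lim show ?thesis by (simp only: LIMSEQ_const_iff)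
qed

lemma wave_has_derivative: "(wave k has_derivative (\<lambda>h. wave k x * (- \<i> * of_real (k \<bullet> h)))) (at x)"
proof -
  have "((\<lambda>x. - (\<i> * of_real (k \<bullet> x))) has_derivative (\<lambda>h. - (\<i> * of_real (k \<bullet> h)))) (at x)"
    by (intro has_derivative_minus has_derivative_mult_right bounded_linear_imp_has_derivative
        bounded_linear_compose[OF bounded_linear_of_real] bounded_linear_inner_right)
  from has_derivative_compose[OF this DERIV_exp[unfolded has_field_derivative_def]]
  show ?thesis by (simp add: wave_def[abs_def])
qed

lemma partial_wave: "partial i (wave k) x = - \<i> * of_real (k $ i) * wave k x"
  by (subst partial_has_derivative[OF wave_has_derivative]) (simp add: inner_axis)

lemma differentiable_wave: "wave k differentiable (at x)"
  using wave_has_derivative by (auto simp: differentiable_def)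

lemma fourier_partial:
  fixes f :: "'d::finite fn"
  assumes f: "f \<in> schwartz"
  shows "fourier (partial i f) k = \<i> * of_real (k $ i) * fourier f k"
proof -
  note fd = schwartz_differentiable[OF f]
  have pf: "partial i f \<in> schwartz" by (rule schwartz_partial[OF f])
  have eq: "partial i (\<lambda>x. wave k x * f x) = (\<lambda>x. wave k x * partial i f x - \<i> * of_real (k $ i) * (wave k x * f x))"
    by (rule ext) (simp add: partial_mult[OF differentiable_wave fd] partial_wave)
  obtain C where C: "\<And>x. (1 + norm x) ^ (2 * CARD('d)) * norm (f x) \<le> C" using schwartz_decay[OF f] by blast
  obtain D where D: "\<And>x. (1 + norm x) ^ (2 * CARD('d)) * norm (partial i f x) \<le> D" using schwartz_decay[OF pf] by blast
  have "(LINT x|lborel. partial i (\<lambda>x. wave k x * f x) x) = 0"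
  proof (rule integral_partial_zero[where C = "D + \<bar>k $ i\<bar> * C"])
    show "integrable lborel (\<lambda>x. wave k x * f x)" by (intro integrable_wave schwartz_integrable f)
    show "(\<lambda>x. wave k x * f x) differentiable (at x)" for x by (intro differentiable_mult differentiable_wave fd)
    show "partial i (\<lambda>x. wave k x * f x) \<in> borel_measurable borel"
      unfolding eq using schwartz_measurable[OF f] schwartz_measurable[OF pf] by measurable
    fix x :: "real^'d"
    have "norm (partial i (\<lambda>x. wave k x * f x) x) \<le> norm (partial i f x) + \<bar>k $ i\<bar> * norm (f x)"
      unfolding eq using norm_triangle_ineq4[of "wave k x * partial i f x" "\<i> * of_real (k $ i) * (wave k x * f x)"]
      by (simp add: norm_mult)
    then have "(1 + norm x) ^ (2 * CARD('d)) * norm (partial i (\<lambda>x. wave k x * f x) x)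
        \<le> (1 + norm x) ^ (2 * CARD('d)) * (norm (partial i f x) + \<bar>k $ i\<bar> * norm (f x))"
      by (intro mult_left_mono) auto
    also have "\<dots> = (1 + norm x) ^ (2 * CARD('d)) * norm (partial i f x) + \<bar>k $ i\<bar> * ((1 + norm x) ^ (2 * CARD('d)) * norm (f x))"
      by (simp add: algebra_simps)
    also have "\<dots> \<le> D + \<bar>k $ i\<bar> * C"
      by (intro add_mono mult_left_mono C D) auto
    finally show "(1 + norm x) ^ (2 * CARD('d)) * norm (partial i (\<lambda>x. wave k x * f x) x) \<le> D + \<bar>k $ i\<bar> * C" .
  qed
  then have "(LINT x|lborel. wave k x * partial i f x) = \<i> * of_real (k $ i) * (LINT x|lborel. wave k x * f x)"
    unfolding eq using integrable_wave[OF schwartz_integrable[OF f], of k] integrable_wave[OF schwartz_integrable[OF pf], of k]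
    by simp
  then show ?thesis by (simp add: fourier_eq)
qed

lemma fourier_partial_power:
  assumes "f \<in> schwartz"
  shows "fourier (partials (replicate n i) f) k = (\<i> * of_real (k $ i)) ^ n * fourier f k"
  by (induct n) (simp_all add: partials_Cons fourier_partial schwartz_partials assms)

lemma one_plus_norm_power_le:
  fixes k :: "real ^ 'd::finite"
  shows "(1 + norm k) ^ N \<le> (2 * real CARD('d)) ^ N * (1 + (\<Sum>i\<in>UNIV. \<bar>k $ i\<bar> ^ N))"
proof -
  obtain l where l: "\<And>i. \<bar>k $ i\<bar> \<le> \<bar>k $ l\<bar>"
  proof -
    have "Max (range (\<lambda>i. \<bar>k $ i\<bar>)) \<in> range (\<lambda>i. \<bar>k $ i\<bar>)" by (intro Max_in) auto
    then obtain l where "Max (range (\<lambda>i. \<bar>k $ i\<bar>)) = \<bar>k $ l\<bar>" by (rule imageE)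
    then have "\<bar>k $ i\<bar> \<le> \<bar>k $ l\<bar>" for i using Max_ge[of "range (\<lambda>i. \<bar>k $ i\<bar>)" "\<bar>k $ i\<bar>"] by simp
    then show thesis by (rule that)
  qed
  let ?d = "real CARD('d)"
  have d: "1 \<le> ?d" using zero_less_card_finite[where 'a='d] by linarith
  have "norm k \<le> (\<Sum>i\<in>UNIV. \<bar>k $ i\<bar>)" by (rule norm_le_l1_cart)
  also have "\<dots> \<le> ?d * \<bar>k $ l\<bar>" using sum_bounded_above[of UNIV "\<lambda>i. \<bar>k $ i\<bar>", OF l] by simp
  finally have nk: "norm k \<le> ?d * \<bar>k $ l\<bar>" .
  let ?m = "max 1 \<bar>k $ l\<bar>"
  have "1 + norm k \<le> ?d * ?m + ?d * ?m"
  proof (rule add_mono)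
    show "1 \<le> ?d * ?m" using mult_mono[OF d, of 1 ?m] by simp
    show "norm k \<le> ?d * ?m" using nk d by (meson max.cobounded2 mult_left_mono of_nat_0_le_iff order_trans)
  qed
  then have "(1 + norm k) ^ N \<le> (2 * ?d * ?m) ^ N" by (intro power_mono) auto
  also have "\<dots> = (2 * ?d) ^ N * ?m ^ N" by (rule power_mult_distrib)
  also have "?m ^ N \<le> 1 + \<bar>k $ l\<bar> ^ N" by (simp add: max_def)
  also have "\<bar>k $ l\<bar> ^ N \<le> (\<Sum>i\<in>UNIV. \<bar>k $ i\<bar> ^ N)" by (rule member_le_sum) auto
  finally show ?thesis by (simp add: mult_left_mono)
qed

text \<open>The finite sum of seminorms of \<open>f\<close> that controls the decay of order \<open>N\<close> of its transform. It is
  what makes functionals given by densities continuous on \<open>Phi\<close>.\<close>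

definition fourier_bound :: "nat \<Rightarrow> 'd::finite fn \<Rightarrow> real" where
  "fourier_bound N f = schwartz_seminorm (2 * CARD('d)) [] f
     + (\<Sum>i\<in>UNIV. schwartz_seminorm (2 * CARD('d)) (replicate N i) f)"

text \<open>Powers of a coordinate of \<open>k\<close> become derivatives of \<open>f\<close>, and \<open>(1 + norm k)^N\<close> is bounded by a
  multiple of 1 plus the sum of the \<open>N\<close>-th powers of the coordinates.\<close>

lemma fourier_decay:
  obtains K where "0 \<le> K"
    "\<And>f k. f \<in> schwartz \<Longrightarrow> (1 + norm k) ^ N * norm (fourier f k) \<le> K * fourier_bound N (f :: 'd::finite fn)"
proof
  let ?c = "fconst TYPE('d)"
  let ?W = "LINT x|lborel. inverse ((1 + norm (x::real^'d)) ^ (2 * CARD('d)))"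
  let ?K = "(2 * real CARD('d)) ^ N * (?c * ?W)"
  have c: "0 < ?c" by (rule fconst_pos)
  have W: "0 \<le> ?W" by (intro integral_nonneg_AE) auto
  show "0 \<le> ?K" using c W by simp
  fix f :: "'d fn" and k assume f: "f \<in> schwartz"
  have b: "norm (fourier (partials is f) k) \<le> ?c * ?W * schwartz_seminorm (2 * CARD('d)) is f" for "is"
  proof -
    have "norm (fourier (partials is f) k) \<le> ?c * (LINT x|lborel. norm (partials is f x))"
      by (rule norm_fourier_le)
    also have "\<dots> \<le> ?c * (schwartz_seminorm (2 * CARD('d)) is f * ?W)"
      using c by (intro mult_left_mono integrable_decay(2) schwartz_measurable schwartz_partials schwartz_seminorm_upper f) auto
    finally show ?thesis by (simp add: mult_ac)
  qed
  have "(1 + norm k) ^ N * norm (fourier f k) \<le> (2 * real CARD('d)) ^ N * (1 + (\<Sum>i\<in>UNIV. \<bar>k $ i\<bar> ^ N)) * norm (fourier f k)"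
    by (intro mult_right_mono one_plus_norm_power_le) auto
  also have "\<dots> = (2 * real CARD('d)) ^ N * (norm (fourier f k) + (\<Sum>i\<in>UNIV. norm (fourier (partials (replicate N i) f) k)))"
    by (simp add: fourier_partial_power[OF f] norm_mult norm_power distrib_left distrib_right sum_distrib_left sum_distrib_right mult.assoc)
  also have "\<dots> \<le> (2 * real CARD('d)) ^ N * (?c * ?W * schwartz_seminorm (2 * CARD('d)) [] f
     + (\<Sum>i\<in>UNIV. ?c * ?W * schwartz_seminorm (2 * CARD('d)) (replicate N i) f))"
    using b[of "[]"] by (intro mult_left_mono add_mono sum_mono b) auto
  also have "\<dots> = ?K * fourier_bound N f"
    by (simp add: fourier_bound_def distrib_left sum_distrib_left mult.assoc)
  finally show "(1 + norm k) ^ N * norm (fourier f k) \<le> ?K * fourier_bound N f" .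
qed

lemma fourier_schwartz:
  fixes f :: "'d::finite fn"
  assumes "f \<in> schwartz"
  shows "fourier f \<in> schwartz"
proof (rule schwartz_coinduct[of _ "fourier ` schwartz"])
  fix g :: "'d fn" and N assume "g \<in> fourier ` schwartz"
  then obtain f where f: "g = fourier f" "f \<in> schwartz" by auto
  obtain K where "\<And>f k. f \<in> schwartz \<Longrightarrow> (1 + norm k) ^ N * norm (fourier f k) \<le> K * fourier_bound N (f :: 'd fn)"
    using fourier_decay[of N] by blast
  then show "\<exists>C. \<forall>x. (1 + norm x) ^ N * norm (g x) \<le> C" using f by blast
next
  fix g :: "'d fn" and i assume "g \<in> fourier ` schwartz"
  then obtain f where f: "g = fourier f" "f \<in> schwartz" by auto
  have "(\<lambda>x. - \<i> * (of_real (x $ i) * f x)) \<in> schwartz"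
    by (intro schwartz_cmult schwartz_coord_mult f)
  then show "partial i g \<in> fourier ` schwartz"
    unfolding f(1) partial_fourier[OF f(2)] by (rule imageI)
qed (use assms in \<open>auto intro: fourier_differentiable\<close>)

lemma fourier_fourier:
  fixes f :: "'d::finite fn"
  assumes f: "f \<in> schwartz"
  shows "fourier (fourier f) x = f (- x)"
proof -
  obtain B where "\<And>x. norm (f x) \<le> B" using schwartz_bounded[OF f] by blast
  then show ?thesis
    by (intro fourier_inversion schwartz_integrable fourier_schwartz schwartz_continuous f)
qed

lemma inj_on_fourier: "inj_on fourier (schwartz :: 'd::finite fn set)"
proof (rule inj_onI, rule ext)
  fix f g :: "'d fn" and x assume "f \<in> schwartz" "g \<in> schwartz" "fourier f = fourier g"
  then show "f x = g x" using fourier_fourier[of f "- x"] fourier_fourier[of g "- x"] by simp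
qed

text \<open>The inverse transform of a reflected function is a transform, so that \<open>fourier_dual\<close> amounts to
  composition with \<open>fourier\<close>.\<close>

lemma inv_fourier_reflect:
  fixes f :: "'d::finite fn"
  assumes "f \<in> schwartz"
  shows "inv_into schwartz fourier (\<lambda>k. f (- k)) = fourier f"
  by (rule inv_into_f_eq[OF inj_on_fourier fourier_schwartz[OF assms]]) (simp add: fun_eq_iff fourier_fourier assms)

lemma fourier_Phi:
  fixes \<phi> :: "'d::finite fn"
  assumes "\<phi> \<in> Phi"
  shows "fourier \<phi> \<in> Psi"
proof -
  have s: "\<phi> \<in> schwartz" and m: "(LINT x|lborel. of_real (\<Prod>i\<leftarrow>is. x $ i) * \<phi> x) = 0" for "is"
    using assms by (auto simp: Phi_def)
  have "partials is (fourier \<phi>) 0 = 0" for "is"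
    unfolding partials_fourier[OF s] fourier_cmult by (simp add: fourier_eq m)
  then show ?thesis using fourier_schwartz[OF s] by (simp add: Psi_def)
qed

text \<open>The moments of the transform are, by inversion, derivatives of the reflected function at 0.\<close>

lemma fourier_Psi:
  fixes \<psi> :: "'d::finite fn"
  assumes "\<psi> \<in> Psi"
  shows "fourier \<psi> \<in> Phi"
proof -
  have s: "\<psi> \<in> schwartz" and p: "partials is \<psi> 0 = 0" for "is" using assms by (auto simp: Psi_def)
  have Fs: "fourier \<psi> \<in> schwartz" by (rule fourier_schwartz[OF s])
  have "(LINT x|lborel. of_real (\<Prod>i\<leftarrow>is. x $ i) * fourier \<psi> x) = 0" for "is"
  proof -
    have "partials is (fourier (fourier \<psi>)) 0 = 0"
      using partials_reflect[OF s, of "is"] p by (simp add: fourier_fourier[OF s, abs_def])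
    then have "fourier (\<lambda>x. of_real (\<Prod>i\<leftarrow>is. x $ i) * fourier \<psi> x) 0 = 0"
      unfolding partials_fourier[OF Fs] fourier_cmult by simp
    then show ?thesis using fconst_pos[where 'd='d] by (simp add: fourier_eq)
  qed
  then show ?thesis using Fs by (simp add: Phi_def)
qed

lemma Psi_reflect:
  fixes \<psi> :: "'d::finite fn"
  assumes "\<psi> \<in> Psi" shows "(\<lambda>k. \<psi> (- k)) \<in> Psi"
  using assms schwartz_reflect[of \<psi>] partials_reflect[of \<psi>] by (simp add: Psi_def)

lemma Psi_schwartz: "\<psi> \<in> Psi \<Longrightarrow> \<psi> \<in> schwartz" and Phi_schwartz: "\<phi> \<in> Phi \<Longrightarrow> \<phi> \<in> schwartz"
  by (auto simp: Psi_def Phi_def)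

section \<open>Functions that vanish to infinite order at the origin\<close>

lemma partials_cmult:
  fixes f :: "'d::finite fn"
  assumes f: "f \<in> schwartz"
  shows "partials is (\<lambda>x. c * f x) = (\<lambda>x. c * partials is f x)"
proof (induct "is")
  case (Cons i "is")
  show ?case unfolding partials_Cons Cons
    by (rule ext) (intro partial_cmult schwartz_differentiable schwartz_partials f)
qed simp

lemma Psi_partial: "f \<in> Psi \<Longrightarrow> partial i f \<in> Psi"
  by (simp add: Psi_def schwartz_partial flip: partials_snoc)

lemma Psi_0: "f \<in> Psi \<Longrightarrow> f 0 = 0"
  unfolding Psi_def by (auto dest: spec[of _ "[]"])

text \<open>The closure of a family under the operations that preserve \<open>Psi\<close> and that occur when the members of
  the family are differentiated.\<close>

inductive_set poly_span :: "'d::finite fn set \<Rightarrow> 'd fn set" for B where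
  base: "f \<in> B \<Longrightarrow> f \<in> poly_span B"
| add: "f \<in> poly_span B \<Longrightarrow> g \<in> poly_span B \<Longrightarrow> (\<lambda>x. f x + g x) \<in> poly_span B"
| cmult: "f \<in> poly_span B \<Longrightarrow> (\<lambda>x. c * f x) \<in> poly_span B"
| coord: "f \<in> poly_span B \<Longrightarrow> (\<lambda>x. of_real (x $ i) * f x) \<in> poly_span B"

lemma quadratic_zero_has_derivative:
  fixes f :: "'d::finite fn"
  assumes f0: "f 0 = 0" and C: "\<And>k. norm k \<le> 1 \<Longrightarrow> norm (f k) \<le> C * (norm k)\<^sup>2"
  shows "(f has_derivative (\<lambda>_. 0)) (at 0)"
  unfolding has_derivative_at
proof
  have lim: "((\<lambda>h::real^'d. C * norm h) \<longlongrightarrow> 0) (at 0)"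
    by (intro tendsto_mult_right_zero tendsto_norm_zero tendsto_ident_at)
  show "(\<lambda>h. norm (f (0 + h) - f 0 - 0) / norm h) \<midarrow>0\<rightarrow> 0"
  proof (rule Lim_null_comparison[OF _ lim])
    have "\<forall>\<^sub>F h in at 0. norm (h::real^'d) < 1 \<and> h \<noteq> 0"
      unfolding eventually_at by (intro exI[of _ 1]) auto
    then show "\<forall>\<^sub>F h in at 0. norm (norm (f (0 + h) - f 0 - 0) / norm h) \<le> C * norm h"
      by eventually_elim (use C f0 in \<open>simp add: divide_le_eq power2_eq_square mult.assoc\<close>)
  qed
qed (rule bounded_linear_zero)

lemma partial_coord_mult:
  assumes "f differentiable (at x)"
  shows "partial l (\<lambda>x. of_real (x $ i) * f x) x = of_real (x $ i) * partial l f x + (if l = i then 1 else 0) * f x"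
  by (simp add: partial_mult partial_coord differentiable_coord assms)

text \<open>A criterion for \<open>Psi\<close> that asks for derivatives away from the origin only: the quadratic bound makes
  each function differentiable at 0 with derivative 0, and this is also the value at 0 of the function
  that represents its partial derivative elsewhere. Hence the span is closed under partial derivatives.\<close>

lemma poly_span_Psi:
  fixes B :: "'d::finite fn set"
  assumes z: "\<And>f. f \<in> B \<Longrightarrow> f 0 = 0"
    and flat: "\<And>f. f \<in> B \<Longrightarrow> \<exists>C. \<forall>k. norm k \<le> 1 \<longrightarrow> norm (f k) \<le> C * (norm k)\<^sup>2"
    and decay: "\<And>f N. f \<in> B \<Longrightarrow> \<exists>C. \<forall>k. 1 \<le> norm k \<longrightarrow> (1 + norm k) ^ N * norm (f k) \<le> C"
    and diff: "\<And>f k. f \<in> B \<Longrightarrow> k \<noteq> 0 \<Longrightarrow> f differentiable (at k)"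
    and part: "\<And>f i. f \<in> B \<Longrightarrow> \<exists>g\<in>poly_span B. \<forall>k. k \<noteq> 0 \<longrightarrow> partial i f k = g k"
  shows "poly_span B \<subseteq> Psi"
proof
  have z: "f 0 = 0" if "f \<in> poly_span B" for f using that by induct (auto simp: z)
  have flat: "\<exists>C. \<forall>k. norm k \<le> 1 \<longrightarrow> norm (f k) \<le> C * (norm k)\<^sup>2" if "f \<in> poly_span B" for f
    using that
  proof induct
    case (base f) then show ?case by (rule flat)
  next
    case (add f g)
    then obtain C D where C: "\<And>k. norm k \<le> 1 \<Longrightarrow> norm (f k) \<le> C * (norm k)\<^sup>2"
      and D: "\<And>k. norm k \<le> 1 \<Longrightarrow> norm (g k) \<le> D * (norm k)\<^sup>2" by blast
    have "norm (f k + g k) \<le> (C + D) * (norm k)\<^sup>2" if "norm k \<le> 1" for k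
      using norm_triangle_ineq[of "f k" "g k"] C[OF that] D[OF that] unfolding distrib_right by linarith
    then show ?case by blast
  next
    case (cmult f c)
    then obtain C where C: "\<And>k. norm k \<le> 1 \<Longrightarrow> norm (f k) \<le> C * (norm k)\<^sup>2" by blast
    have "norm (c * f k) \<le> (norm c * C) * (norm k)\<^sup>2" if "norm k \<le> 1" for k
      using mult_left_mono[OF C[OF that] norm_ge_zero[of c]] by (simp add: norm_mult mult.assoc)
    then show ?case by blast
  next
    case (coord f i)
    then obtain C where C: "\<And>k. norm k \<le> 1 \<Longrightarrow> norm (f k) \<le> C * (norm k)\<^sup>2" by blast
    have "norm (of_real (k $ i) * f k) \<le> C * (norm k)\<^sup>2" if "norm k \<le> 1" for k
    proof -
      have "norm (of_real (k $ i) * f k) \<le> norm (f k)"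
        using component_le_norm_cart[of k i] that by (simp add: norm_mult mult_left_le_one_le)
      then show ?thesis using C[OF that] by linarith
    qed
    then show ?case by blast
  qed
  have decay: "\<exists>C. \<forall>k. 1 \<le> norm k \<longrightarrow> (1 + norm k) ^ N * norm (f k) \<le> C" if "f \<in> poly_span B" for f N
    using that
  proof (induct arbitrary: N)
    case (base f) then show ?case by (rule decay)
  next
    case (add f g)
    obtain C where C: "\<And>k. 1 \<le> norm k \<Longrightarrow> (1 + norm k) ^ N * norm (f k) \<le> C" using add(2) by blast
    obtain D where D: "\<And>k. 1 \<le> norm k \<Longrightarrow> (1 + norm k) ^ N * norm (g k) \<le> D" using add(4) by blast
    have "(1 + norm k) ^ N * norm (f k + g k) \<le> C + D" if "1 \<le> norm k" for k
    proof -
      have "(1 + norm k) ^ N * norm (f k + g k) \<le> (1 + norm k) ^ N * (norm (f k) + norm (g k))"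
        by (intro mult_left_mono norm_triangle_ineq) auto
      then show ?thesis using C[OF that] D[OF that] unfolding distrib_left by linarith
    qed
    then show ?case by blast
  next
    case (cmult f c)
    obtain C where C: "\<And>k. 1 \<le> norm k \<Longrightarrow> (1 + norm k) ^ N * norm (f k) \<le> C" using cmult(2) by blast
    have "(1 + norm k) ^ N * norm (c * f k) \<le> norm c * C" if "1 \<le> norm k" for k
      using mult_left_mono[OF C[OF that] norm_ge_zero[of c]] by (simp add: norm_mult mult.left_commute)
    then show ?case by blast
  next
    case (coord f i)
    obtain C where C: "\<And>k. 1 \<le> norm k \<Longrightarrow> (1 + norm k) ^ Suc N * norm (f k) \<le> C" using coord(2) by blast
    have "(1 + norm k) ^ N * norm (of_real (k $ i) * f k) \<le> C" if "1 \<le> norm k" for k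
    proof -
      have "\<bar>k $ i\<bar> \<le> 1 + norm k" using component_le_norm_cart[of k i] by simp
      then have "norm (of_real (k $ i) * f k) \<le> (1 + norm k) * norm (f k)"
        by (simp add: norm_mult mult_right_mono)
      then have "(1 + norm k) ^ N * norm (of_real (k $ i) * f k) \<le> (1 + norm k) ^ N * ((1 + norm k) * norm (f k))"
        by (intro mult_left_mono) auto
      also have "\<dots> = (1 + norm k) ^ Suc N * norm (f k)" by simp
      finally show ?thesis using C[OF that] by linarith
    qed
    then show ?case by blast
  qed
  have D0: "(f has_derivative (\<lambda>_. 0)) (at 0)" if "f \<in> poly_span B" for f
    using flat[OF that] quadratic_zero_has_derivative[of f, OF z[OF that]] by blast
  have diff0: "f differentiable (at k)" if "f \<in> poly_span B" "k \<noteq> 0" for f k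
    using that by induct (auto intro!: diff differentiable_add differentiable_mult differentiable_coord)
  have diff: "f differentiable (at k)" if "f \<in> poly_span B" for f k
    using diff0[OF that] D0[OF that] by (cases "k = 0") (auto simp: differentiable_def)
  have part': "\<exists>g\<in>poly_span B. \<forall>k. k \<noteq> 0 \<longrightarrow> partial i f k = g k" if "f \<in> poly_span B" for f i
    using that
  proof induct
    case (base f) then show ?case by (rule part)
  next
    case (add f g)
    then obtain f' g' where fg: "f' \<in> poly_span B" "\<And>k. k \<noteq> 0 \<Longrightarrow> partial i f k = f' k"
      "g' \<in> poly_span B" "\<And>k. k \<noteq> 0 \<Longrightarrow> partial i g k = g' k" by blast
    then show ?case using add(1,3)
      by (intro bexI[OF _ poly_span.add[OF fg(1,3)]]) (auto simp: partial_add diff)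
  next
    case (cmult f c)
    then obtain f' where f: "f' \<in> poly_span B" "\<And>k. k \<noteq> 0 \<Longrightarrow> partial i f k = f' k" by blast
    then show ?case using cmult(1)
      by (intro bexI[OF _ poly_span.cmult[OF f(1)]]) (auto simp: partial_cmult diff)
  next
    case (coord f l)
    then obtain f' where f: "f' \<in> poly_span B" "\<And>k. k \<noteq> 0 \<Longrightarrow> partial i f k = f' k" by blast
    then show ?case using coord(1)
      by (intro bexI[OF _ poly_span.add[OF poly_span.coord[OF f(1), of l]
            poly_span.cmult[OF coord(1), of "if i = l then 1 else 0"]]])
        (auto simp: partial_coord_mult diff)
  qed
  have part: "partial i f \<in> poly_span B" if f: "f \<in> poly_span B" for f i
  proof -
    obtain g where g: "g \<in> poly_span B" "\<And>k. k \<noteq> 0 \<Longrightarrow> partial i f k = g k" using part'[OF f] by blast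
    have "partial i f k = g k" for k
      using g(2)[of k] z[OF g(1)] partial_has_derivative[OF D0[OF f]] by (cases "k = 0") auto
    then have "partial i f = g" by (rule ext)
    then show ?thesis using g(1) by simp
  qed
  fix f assume f: "f \<in> poly_span B"
  have "f \<in> schwartz"
  proof (rule schwartz_coinduct[OF f diff part])
    fix f N assume f: "f \<in> poly_span B"
    obtain C where C: "\<And>k. norm k \<le> 1 \<Longrightarrow> norm (f k) \<le> C * (norm k)\<^sup>2" using flat[OF f] by blast
    obtain D where D: "\<And>k. 1 \<le> norm k \<Longrightarrow> (1 + norm k) ^ N * norm (f k) \<le> D" using decay[OF f] by blast
    have "(1 + norm k) ^ N * norm (f k) \<le> max D (2 ^ N * \<bar>C\<bar>)" for k
    proof (cases "1 \<le> norm k")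
      case False
      then have "C * (norm k)\<^sup>2 \<le> \<bar>C\<bar> * 1" by (intro mult_mono) (auto simp: power_le_one)
      then have "norm (f k) \<le> \<bar>C\<bar>" using C[of k] False by simp
      then have "(1 + norm k) ^ N * norm (f k) \<le> 2 ^ N * \<bar>C\<bar>"
        using False by (intro mult_mono power_mono) auto
      then show ?thesis by simp
    qed (use D[of k] in auto)
    then show "\<exists>C. \<forall>x. (1 + norm x) ^ N * norm (f x) \<le> C" by blast
  qed
  moreover have "partials is f \<in> poly_span B" for "is" by (rule partials_closed[OF f part])
  ultimately show "f \<in> Psi" using z by (simp add: Psi_def)
qed

lemma frechet_norm_le:
  fixes f :: "'d::finite fn"
  assumes "f differentiable (at x)"
  shows "onorm (frechet_derivative f (at x)) \<le> (\<Sum>i\<in>UNIV. norm (partial i f x))"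
proof (rule onorm_le)
  fix v
  have "norm (frechet_derivative f (at x) v) \<le> (\<Sum>i\<in>UNIV. norm (v $ i *\<^sub>R partial i f x))"
    unfolding frechet_partials[OF assms] by (rule norm_sum)
  also have "\<dots> \<le> (\<Sum>i\<in>UNIV. norm v * norm (partial i f x))"
    using component_le_norm_cart[of v] by (intro sum_mono) (simp add: mult_right_mono)
  finally show "norm (frechet_derivative f (at x) v) \<le> (\<Sum>i\<in>UNIV. norm (partial i f x)) * norm v"
    by (simp add: mult.commute flip: sum_distrib_left)
qed

text \<open>Induction on the order, for all elements of \<open>Psi\<close> simultaneously: the partial derivatives belong to
  \<open>Psi\<close> again, and the mean value theorem on a ball gains one power.\<close>

lemma Psi_flat:
  fixes f :: "'d::finite fn"
  assumes "f \<in> Psi"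
  shows "\<exists>C. \<forall>k. norm k \<le> 1 \<longrightarrow> norm (f k) \<le> C * norm k ^ M"
  using assms
proof (induct M arbitrary: f)
  case 0
  then obtain B where "\<And>x. norm (f x) \<le> B" using schwartz_bounded[of f] by (auto simp: Psi_def)
  then show ?case by auto
next
  case (Suc M)
  have "\<forall>i. \<exists>C. \<forall>k. norm k \<le> 1 \<longrightarrow> norm (partial i f k) \<le> C * norm k ^ M"
    using Suc(1)[OF Psi_partial[OF Suc(2)]] by blast
  then obtain C where C: "\<And>i k. norm k \<le> 1 \<Longrightarrow> norm (partial i f k) \<le> C i * norm k ^ M" by metis
  have d: "f differentiable (at x)" for x using Suc(2) schwartz_differentiable by (auto simp: Psi_def)
  have "norm (f k) \<le> (\<Sum>i\<in>UNIV. \<bar>C i\<bar>) * norm k ^ Suc M" if k: "norm k \<le> 1" for k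
  proof -
    have "norm (f k - f 0) \<le> ((\<Sum>i\<in>UNIV. \<bar>C i\<bar>) * norm k ^ M) * norm (k - 0)"
    proof (rule differentiable_bound[where S = "cball 0 (norm k)" and f' = "\<lambda>x. frechet_derivative f (at x)"])
      show "(f has_derivative frechet_derivative f (at x)) (at x within cball 0 (norm k))" for x :: "real^'d"
        using differentiable_has_derivative[OF d] by (rule has_derivative_at_withinI)
      fix x :: "real^'d" assume x: "x \<in> cball 0 (norm k)"
      have "onorm (frechet_derivative f (at x)) \<le> (\<Sum>i\<in>UNIV. norm (partial i f x))"
        by (rule frechet_norm_le[OF d])
      also have "\<dots> \<le> (\<Sum>i\<in>UNIV. \<bar>C i\<bar> * norm k ^ M)"
      proof (rule sum_mono)
        fix i
        have "norm (partial i f x) \<le> C i * norm x ^ M" using C[of x i] x k by simp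
        also have "\<dots> \<le> \<bar>C i\<bar> * norm k ^ M" using x by (intro mult_mono power_mono) auto
        finally show "norm (partial i f x) \<le> \<bar>C i\<bar> * norm k ^ M" .
      qed
      finally show "onorm (frechet_derivative f (at x)) \<le> (\<Sum>i\<in>UNIV. \<bar>C i\<bar>) * norm k ^ M"
        by (simp add: sum_distrib_right)
    qed auto
    then show ?thesis using Psi_0[OF Suc(2)] by (simp add: mult_ac)
  qed
  then show ?case by blast
qed

lemma norm_powr_le_power:
  fixes k :: "'a::real_normed_vector"
  assumes "\<bar>s\<bar> \<le> real m"
  shows "norm k \<le> 1 \<Longrightarrow> norm k powr s * norm k ^ (m + 2) \<le> (norm k)\<^sup>2"
    and "1 \<le> norm k \<Longrightarrow> norm k powr s \<le> norm k ^ m"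
proof -
  show "norm k powr s * norm k ^ (m + 2) \<le> (norm k)\<^sup>2" if "norm k \<le> 1"
  proof (cases "k = 0")
    case False
    then have n: "0 < norm k" by simp
    have "norm k powr s * norm k ^ (m + 2) = norm k powr (s + real (m + 2))"
      unfolding powr_add powr_realpow[OF n] ..
    also have "\<dots> \<le> norm k powr (real 2)"
      by (rule powr_mono') (use assms that in auto)
    also have "\<dots> = (norm k)\<^sup>2" by (rule powr_realpow[OF n])
    finally show ?thesis .
  qed simp
  show "norm k powr s \<le> norm k ^ m" if "1 \<le> norm k"
  proof -
    have "norm k powr s \<le> norm k powr real m" by (rule powr_mono) (use assms that in auto)
    also have "\<dots> = norm k ^ m" by (rule powr_realpow) (use that in linarith)
    finally show ?thesis .
  qed
qed

lemma norm_powr_has_derivative: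
  fixes k :: "real ^ 'd::finite"
  assumes "k \<noteq> 0"
  shows "((\<lambda>k. norm k powr s) has_derivative (\<lambda>h. s * norm k powr (s - 2) * (k \<bullet> h))) (at k)"
proof -
  have n: "0 < norm k" using assms by simp
  have "((\<lambda>t. t powr s) has_derivative (*) (s * norm k powr (s - 1))) (at (norm k))"
    using has_real_derivative_powr[OF n] by (simp add: has_field_derivative_def)
  from has_derivative_compose[OF has_derivative_norm[OF assms] this]
  have D: "((\<lambda>k. norm k powr s) has_derivative (\<lambda>h. s * norm k powr (s - 1) * (h \<bullet> sgn k))) (at k)" .
  have b: "norm k powr (s - 2) = norm k powr (s - 1) / norm k"
  proof -
    have "norm k powr (s - 1) = norm k powr (s - 2 + 1)" by simp
    also have "\<dots> = norm k powr (s - 2) * norm k" unfolding powr_add using n by simp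
    finally show ?thesis using n by simp
  qed
  have "s * norm k powr (s - 1) * (h \<bullet> sgn k) = s * norm k powr (s - 2) * (k \<bullet> h)" for h
    unfolding b sgn_div_norm inner_scaleR_right by (simp add: inner_commute divide_inverse)
  then have "(\<lambda>h. s * norm k powr (s - 1) * (h \<bullet> sgn k)) = (\<lambda>h. s * norm k powr (s - 2) * (k \<bullet> h))" by (rule ext)
  with D show ?thesis by (simp only:)
qed

lemma of_real_has_derivative:
  "(f has_derivative D) F \<Longrightarrow> ((\<lambda>x. complex_of_real (f x)) has_derivative (\<lambda>h. of_real (D h))) F"
  by (rule bounded_linear.has_derivative[OF bounded_linear_of_real])

text \<open>The products \<open>|k|^s \<psi>\<close>, with all real \<open>s\<close> and \<open>\<psi>\<close> in \<open>Psi\<close>, form a family to which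
  \<open>poly_span_Psi\<close> applies, since differentiation lowers \<open>s\<close> by 2 and produces a coordinate.\<close>

lemma Psi_norm_powr_mult:
  fixes \<psi> :: "'d::finite fn"
  assumes "\<psi> \<in> Psi"
  shows "(\<lambda>k. of_real (norm k powr s) * \<psi> k) \<in> Psi"
proof -
  define B where "B = {\<lambda>k. of_real (norm k powr s) * \<psi> k | s \<psi>. \<psi> \<in> (Psi :: 'd fn set)}"
  have "poly_span B \<subseteq> Psi"
  proof (rule poly_span_Psi)
    fix f assume "f \<in> B"
    then obtain s \<psi> where f: "f = (\<lambda>k. of_real (norm k powr s) * \<psi> k)" and \<psi>: "\<psi> \<in> Psi" by (auto simp: B_def)
    have \<psi>s: "\<psi> \<in> schwartz" using \<psi> by (simp add: Psi_def)
    obtain m :: nat where m: "\<bar>s\<bar> \<le> real m" using real_arch_simple by blast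
    show "f 0 = 0" by (simp add: f)
    obtain C where C: "\<And>k. norm k \<le> 1 \<Longrightarrow> norm (\<psi> k) \<le> C * norm k ^ (m + 2)" using Psi_flat[OF \<psi>] by blast
    have "norm (f k) \<le> \<bar>C\<bar> * (norm k)\<^sup>2" if k: "norm k \<le> 1" for k
    proof -
      have "norm (f k) = norm k powr s * norm (\<psi> k)" by (simp add: f norm_mult)
      also have "\<dots> \<le> norm k powr s * (\<bar>C\<bar> * norm k ^ (m + 2))"
        using C[OF k] abs_ge_self[of C] mult_right_mono[OF abs_ge_self[of C], of "norm k ^ (m + 2)"]
        by (intro mult_left_mono) (auto simp del: power_add)
      also have "\<dots> = \<bar>C\<bar> * (norm k powr s * norm k ^ (m + 2))" by simp
      also have "\<dots> \<le> \<bar>C\<bar> * (norm k)\<^sup>2" by (intro mult_left_mono norm_powr_le_power(1)[OF m k]) auto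
      finally show ?thesis .
    qed
    then show "\<exists>C. \<forall>k. norm k \<le> 1 \<longrightarrow> norm (f k) \<le> C * (norm k)\<^sup>2" by blast
    show "\<exists>C. \<forall>k. 1 \<le> norm k \<longrightarrow> (1 + norm k) ^ N * norm (f k) \<le> C" for N
    proof -
      obtain C where C: "\<And>k. (1 + norm k) ^ (N + m) * norm (\<psi> k) \<le> C" using schwartz_decay[OF \<psi>s] by blast
      have "(1 + norm k) ^ N * norm (f k) \<le> C" if k: "1 \<le> norm k" for k
      proof -
        have "norm k powr s \<le> norm k ^ m" by (rule norm_powr_le_power(2)[OF m k])
        also have "\<dots> \<le> (1 + norm k) ^ m" by (intro power_mono) auto
        finally have "(1 + norm k) ^ N * (norm k powr s * norm (\<psi> k)) \<le> (1 + norm k) ^ N * ((1 + norm k) ^ m * norm (\<psi> k))"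
          by (intro mult_left_mono mult_right_mono) auto
        also have "\<dots> \<le> C" using C[of k] by (simp add: power_add mult.assoc)
        finally show ?thesis by (simp add: f norm_mult)
      qed
      then show ?thesis by blast
    qed
    have D: "((\<lambda>k. complex_of_real (norm k powr s)) has_derivative (\<lambda>h. of_real (s * norm k powr (s - 2) * (k \<bullet> h)))) (at k)"
      if "k \<noteq> 0" for k :: "real^'d"
      by (rule of_real_has_derivative[OF norm_powr_has_derivative[OF that]])
    then have d: "(\<lambda>k. complex_of_real (norm k powr s)) differentiable (at k)" if "k \<noteq> 0" for k :: "real^'d"
      using that by (auto simp: differentiable_def)
    show "f differentiable (at k)" if "k \<noteq> 0" for k
      unfolding f by (intro differentiable_mult d that schwartz_differentiable \<psi>s)
    fix i
    let ?g = "\<lambda>k. of_real s * (of_real (k $ i) * (of_real (norm k powr (s - 2)) * \<psi> k)) + of_real (norm k powr s) * partial i \<psi> k"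
    show "\<exists>g\<in>poly_span B. \<forall>k. k \<noteq> 0 \<longrightarrow> partial i f k = g k"
    proof (intro bexI[of _ ?g] allI impI)
      show "?g \<in> poly_span B"
        using \<psi> Psi_partial[OF \<psi>, of i]
        by (intro poly_span.add poly_span.cmult poly_span.coord poly_span.base) (auto simp: B_def)
      show "partial i f k = ?g k" if "k \<noteq> 0" for k
        unfolding f partial_mult[OF d[OF that] schwartz_differentiable[OF \<psi>s]]
        by (subst partial_has_derivative[OF D[OF that]]) (simp add: inner_axis mult_ac)
    qed
  qed
  moreover have "(\<lambda>k. of_real (norm k powr s) * \<psi> k) \<in> poly_span B"
    using assms by (intro poly_span.base) (auto simp: B_def)
  ultimately show ?thesis by blast
qed


section \<open>Gaussians with a flat cutoff\<close>

text \<open>A smooth function that is flat at 0 and differs from 1 only by a Gaussian tail at infinity; its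
  transition takes place at distance about \<open>b^(-1/2)\<close> from the origin. A cutoff of the form
  \<open>exp (- 1 / |k|^2)\<close> would approach 1 too slowly for its complement to be a Schwartz function.\<close>

definition flat_cutoff :: "real \<Rightarrow> real ^ 'd::finite \<Rightarrow> real" where
  "flat_cutoff b k = (if k = 0 then 0 else exp (- (exp (- b * (k \<bullet> k)) / (b * (k \<bullet> k)))))"

lemma flat_cutoff_bounds: "0 \<le> flat_cutoff b k" "0 < b \<Longrightarrow> flat_cutoff b k \<le> 1"
  "k \<noteq> 0 \<Longrightarrow> 0 < flat_cutoff b k" "flat_cutoff b 0 = 0"
  by (auto simp: flat_cutoff_def)

lemma exp_minus_le_power:
  fixes y :: real
  assumes y: "0 < y" and M: "0 < M"
  shows "exp (- y) \<le> (real M / y) ^ M"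
proof -
  have "y / real M \<le> exp (y / real M)" using exp_ge_add_one_self[of "y / real M"] by linarith
  then have "(y / real M) ^ M \<le> exp (y / real M) ^ M" using y by (intro power_mono) auto
  also have "\<dots> = exp y" using M by (simp flip: exp_of_nat_mult)
  finally have "inverse (exp y) \<le> inverse ((y / real M) ^ M)"
    using y M by (intro le_imp_inverse_le) auto
  then show ?thesis by (simp add: exp_minus power_divide divide_inverse power_inverse mult.commute power_mult_distrib)
qed

lemma flat_cutoff_flat:
  assumes b: "0 < b"
  obtains C where "0 \<le> C" "\<And>k :: real^'d::finite. norm k \<le> 1 \<Longrightarrow> flat_cutoff b k \<le> C * norm k ^ M"
proof
  let ?c = "exp (- b) / b"
  let ?C = "(real (Suc M) / ?c) ^ Suc M"
  have c: "0 < ?c" using b by simp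
  show "0 \<le> ?C" using c by (intro zero_le_power divide_nonneg_pos) auto
  fix k :: "real^'d" assume k: "norm k \<le> 1"
  show "flat_cutoff b k \<le> ?C * norm k ^ M"
  proof (cases "k = 0")
    case False
    let ?q = "k \<bullet> k"
    have q: "0 < ?q" "?q = (norm k)\<^sup>2" using False by (auto simp: dot_square_norm)
    have q1: "?q \<le> 1" using k q(2) by (simp add: power_le_one)
    have "exp (- b) \<le> exp (- b * ?q)" using b q1 by (simp add: mult_left_le)
    then have "?c / ?q \<le> exp (- b * ?q) / (b * ?q)" using b q(1) by (simp add: divide_right_mono)
    then have "flat_cutoff b k \<le> exp (- (?c / ?q))" using False by (simp add: flat_cutoff_def)
    also have "\<dots> \<le> (real (Suc M) / (?c / ?q)) ^ Suc M"
      by (rule exp_minus_le_power) (use b q(1) in auto)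
    also have "\<dots> = ?C * ?q ^ Suc M"
      by (simp only: divide_divide_eq_right times_divide_eq_left[symmetric] power_mult_distrib mult_ac)
    also have "\<dots> \<le> ?C * norm k ^ M"
    proof (rule mult_left_mono)
      have "?q ^ Suc M = norm k ^ (2 * Suc M)" unfolding q(2) by (rule power_mult[symmetric])
      also have "\<dots> \<le> norm k ^ M" using k by (intro power_decreasing) auto
      finally show "?q ^ Suc M \<le> norm k ^ M" .
    qed (use c in \<open>intro zero_le_power divide_nonneg_pos, auto\<close>)
    finally show ?thesis .
  qed (use b in \<open>auto simp: flat_cutoff_bounds intro!: mult_nonneg_nonneg zero_le_power divide_nonneg_pos\<close>)
qed

lemma inner_self_has_derivative: "((\<lambda>k. k \<bullet> k) has_derivative (\<lambda>h. 2 * (k \<bullet> h))) (at k)"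
  by (rule derivative_eq_intros has_derivative_ident)+ (simp add: inner_commute)

lemma gauss_cutoff_has_derivative:
  fixes k :: "real^'d::finite"
  assumes b: "0 < b" and k: "k \<noteq> 0"
  shows "((\<lambda>k. exp (- p * (k \<bullet> k)) * flat_cutoff b k) has_derivative
     (\<lambda>h. (- p * exp (- p * (k \<bullet> k)) * flat_cutoff b k
       + exp (- (p + b) * (k \<bullet> k)) * flat_cutoff b k * (1 / (k \<bullet> k) + 1 / (b * (k \<bullet> k)\<^sup>2))) * (2 * (k \<bullet> h)))) (at k)"
proof -
  let ?G = "\<lambda>q. exp (- p * q) * exp (- (exp (- b * q) / (b * q)))"
  let ?q = "k \<bullet> k"
  have q: "?q \<noteq> 0" using k by simp
  have E: "exp (- (p + b) * q) = exp (- p * q) * exp (- b * q)" for q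
    by (simp add: algebra_simps flip: exp_add)
  have "(?G has_real_derivative (- p * exp (- p * ?q) * exp (- (exp (- b * ?q) / (b * ?q)))
       + exp (- (p + b) * ?q) * exp (- (exp (- b * ?q) / (b * ?q))) * (1 / ?q + 1 / (b * ?q\<^sup>2)))) (at ?q)"
    unfolding E
    by (rule derivative_eq_intros refl | use b q in \<open>simp; fail\<close>)+
       (use b q in \<open>simp add: field_simps power2_eq_square\<close>)
  then have G: "(?G has_derivative (*) (- p * exp (- p * ?q) * exp (- (exp (- b * ?q) / (b * ?q)))
       + exp (- (p + b) * ?q) * exp (- (exp (- b * ?q) / (b * ?q))) * (1 / ?q + 1 / (b * ?q\<^sup>2)))) (at ?q)"
    by (simp add: has_field_derivative_def)
  have D: "((\<lambda>k. ?G (k \<bullet> k)) has_derivative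
     (\<lambda>h. (- p * exp (- p * ?q) * flat_cutoff b k
       + exp (- (p + b) * ?q) * flat_cutoff b k * (1 / ?q + 1 / (b * ?q\<^sup>2))) * (2 * (k \<bullet> h)))) (at k)"
    using has_derivative_compose[OF inner_self_has_derivative G] k by (simp add: flat_cutoff_def)
  show ?thesis
    by (rule has_derivative_transform_within_open[OF D, of "- {0}"]) (use k in \<open>auto simp: flat_cutoff_def\<close>)
qed

text \<open>The parameter \<open>s\<close> is needed because differentiating the cutoff produces negative powers of the norm.
  As \<open>0 powr s = 0\<close> for all \<open>s\<close>, the value at the origin is 0 in every case.\<close>

definition cutoff_gauss :: "real \<Rightarrow> real ^ 'd::finite \<Rightarrow> real \<Rightarrow> real \<Rightarrow> 'd fn" where
  "cutoff_gauss b a p s k = of_real (norm k powr s) * (of_real (exp (- p * (k \<bullet> k)) * flat_cutoff b k) * wave a k)"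

lemma cutoff_gauss_partial:
  fixes k :: "real^'d::finite"
  assumes b: "0 < b" and k: "k \<noteq> 0"
  shows "cutoff_gauss b a p s differentiable (at k)"
    and "partial i (cutoff_gauss b a p s) k =
      (of_real s * (of_real (k $ i) * cutoff_gauss b a p (s - 2) k)
      + (of_real (- 2 * p) * (of_real (k $ i) * cutoff_gauss b a p s k)
      + (2 * (of_real (k $ i) * cutoff_gauss b a (p + b) (s - 2) k)
      + of_real (2 / b) * (of_real (k $ i) * cutoff_gauss b a (p + b) (s - 4) k))))
      + (- \<i> * of_real (a $ i)) * cutoff_gauss b a p s k"
proof -
  note D1 = of_real_has_derivative[OF norm_powr_has_derivative[OF k, of s]]
  note D2 = of_real_has_derivative[OF gauss_cutoff_has_derivative[OF b k, of p]]
  have d1: "(\<lambda>k. complex_of_real (norm k powr s)) differentiable (at k)"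
    and d2: "(\<lambda>k. complex_of_real (exp (- p * (k \<bullet> k)) * flat_cutoff b k)) differentiable (at k)"
    using D1 D2 unfolding differentiable_def by blast+
  note d3 = differentiable_wave[of a k]
  note d23 = differentiable_mult[OF d2 d3]
  show "cutoff_gauss b a p s differentiable (at k)"
    unfolding cutoff_gauss_def[abs_def] by (rule differentiable_mult[OF d1 d23])
  have n: "0 < norm k" using k by simp
  have q: "k \<bullet> k = norm k powr 2" using n by (simp add: dot_square_norm powr_numeral)
  have q2: "norm k powr s / (k \<bullet> k) = norm k powr (s - 2)"
    unfolding q by (rule powr_diff[symmetric])
  have q4: "norm k powr s / (k \<bullet> k)\<^sup>2 = norm k powr (s - 4)"
  proof -
    have "(k \<bullet> k)\<^sup>2 = norm k powr 4" unfolding q power2_eq_square by (simp flip: powr_add)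
    then show ?thesis by (simp add: powr_diff)
  qed
  let ?F = "complex_of_real (flat_cutoff b k) * wave a k"
  let ?e = "exp (- p * (k \<bullet> k))"
  let ?e' = "exp (- (p + b) * (k \<bullet> k))"
  have P1: "partial i (\<lambda>k. complex_of_real (norm k powr s)) k = of_real (s * norm k powr (s - 2) * k $ i)"
    by (subst partial_has_derivative[OF D1]) (simp add: inner_axis)
  have P2: "partial i (\<lambda>k. complex_of_real (exp (- p * (k \<bullet> k)) * flat_cutoff b k)) k
      = of_real ((- p * ?e * flat_cutoff b k + ?e' * flat_cutoff b k * (1 / (k \<bullet> k) + 1 / (b * (k \<bullet> k)\<^sup>2))) * (2 * k $ i))"
    by (subst partial_has_derivative[OF D2]) (simp add: inner_axis)
  have "norm k powr s * ((- p * ?e + ?e' * (1 / (k \<bullet> k) + 1 / (b * (k \<bullet> k)\<^sup>2))) * (2 * k $ i))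
     = - 2 * p * k $ i * norm k powr s * ?e + 2 * k $ i * (norm k powr s / (k \<bullet> k)) * ?e'
       + 2 / b * k $ i * (norm k powr s / (k \<bullet> k)\<^sup>2) * ?e'"
    by (simp add: field_simps)
  then have key: "norm k powr s * ((- p * ?e + ?e' * (1 / (k \<bullet> k) + 1 / (b * (k \<bullet> k)\<^sup>2))) * (2 * k $ i))
     = - 2 * p * k $ i * norm k powr s * ?e + 2 * k $ i * norm k powr (s - 2) * ?e'
       + 2 / b * k $ i * norm k powr (s - 4) * ?e'"
    unfolding q2 q4 .
  have "partial i (cutoff_gauss b a p s) k
     = of_real (s * norm k powr (s - 2) * k $ i * ?e) * ?F
     + of_real (norm k powr s * ((- p * ?e + ?e' * (1 / (k \<bullet> k) + 1 / (b * (k \<bullet> k)\<^sup>2))) * (2 * k $ i))) * ?F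
     + (- \<i> * of_real (a $ i)) * cutoff_gauss b a p s k"
    unfolding cutoff_gauss_def[abs_def] partial_mult[OF d1 d23] partial_mult[OF d2 d3] P1 P2 partial_wave
    by (simp add: algebra_simps)
  then show "partial i (cutoff_gauss b a p s) k =
      (of_real s * (of_real (k $ i) * cutoff_gauss b a p (s - 2) k)
      + (of_real (- 2 * p) * (of_real (k $ i) * cutoff_gauss b a p s k)
      + (2 * (of_real (k $ i) * cutoff_gauss b a (p + b) (s - 2) k)
      + of_real (2 / b) * (of_real (k $ i) * cutoff_gauss b a (p + b) (s - 4) k))))
      + (- \<i> * of_real (a $ i)) * cutoff_gauss b a p s k"
    unfolding key by (simp add: cutoff_gauss_def algebra_simps)
qed

lemma cutoff_gauss_span_Psi:
  fixes a :: "real^'d::finite"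
  assumes b: "0 < b"
  shows "poly_span {cutoff_gauss b a p s | p s. 0 < p} \<subseteq> Psi"
proof (rule poly_span_Psi)
  let ?B = "{cutoff_gauss b a p s | p s. 0 < p}"
  fix f assume "f \<in> ?B"
  then obtain p s where f: "f = cutoff_gauss b a p s" and p: "0 < p" by auto
  obtain m :: nat where m: "\<bar>s\<bar> \<le> real m" using real_arch_simple by blast
  have nf: "norm (f k) = norm k powr s * (exp (- p * (k \<bullet> k)) * flat_cutoff b k)" for k
    by (simp add: f cutoff_gauss_def norm_mult flat_cutoff_bounds)
  show "f 0 = 0" by (simp add: f cutoff_gauss_def)
  show "f differentiable (at k)" if "k \<noteq> 0" for k unfolding f by (rule cutoff_gauss_partial(1)[OF b that])
  show "\<exists>C. \<forall>k. norm k \<le> 1 \<longrightarrow> norm (f k) \<le> C * (norm k)\<^sup>2"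
  proof -
    obtain C where C: "0 \<le> C" "\<And>k :: real^'d. norm k \<le> 1 \<Longrightarrow> flat_cutoff b k \<le> C * norm k ^ (m + 2)"
      using flat_cutoff_flat[OF b] by blast
    have "norm (f k) \<le> C * (norm k)\<^sup>2" if k: "norm k \<le> 1" for k
    proof -
      have "exp (- p * (k \<bullet> k)) * flat_cutoff b k \<le> 1 * (C * norm k ^ (m + 2))"
        using C(2)[OF k] p by (intro mult_mono) (auto simp: flat_cutoff_bounds)
      then have "norm (f k) \<le> norm k powr s * (C * norm k ^ (m + 2))"
        unfolding nf by (intro mult_left_mono) auto
      also have "\<dots> = C * (norm k powr s * norm k ^ (m + 2))" by (rule mult.left_commute)
      also have "\<dots> \<le> C * (norm k)\<^sup>2" by (intro mult_left_mono norm_powr_le_power(1)[OF m k] C(1))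
      finally show ?thesis .
    qed
    then show ?thesis by blast
  qed
  show "\<exists>C. \<forall>k. 1 \<le> norm k \<longrightarrow> (1 + norm k) ^ N * norm (f k) \<le> C" for N
  proof -
    let ?L = "N + m + 1"
    have "(1 + norm k) ^ N * norm (f k) \<le> 2 ^ N * (real ?L / p) ^ ?L" if k: "1 \<le> norm k" for k
    proof -
      have q: "k \<bullet> k = (norm k)\<^sup>2" by (simp add: dot_square_norm)
      have n0: "0 < norm k" using k by linarith
      have "exp (- (p * (norm k)\<^sup>2)) \<le> (real ?L / (p * (norm k)\<^sup>2)) ^ ?L"
        by (rule exp_minus_le_power) (use p n0 in auto)
      also have "\<dots> = (real ?L / p) ^ ?L * inverse ((norm k)\<^sup>2 ^ ?L)"
        by (simp add: power_divide power_mult_distrib divide_inverse power_inverse)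
      finally have e: "exp (- p * (k \<bullet> k)) * flat_cutoff b k \<le> ((real ?L / p) ^ ?L * inverse ((norm k)\<^sup>2 ^ ?L)) * 1"
        unfolding q using flat_cutoff_bounds b p by (intro mult_mono) auto
      have "norm (f k) \<le> norm k ^ m * (((real ?L / p) ^ ?L * inverse ((norm k)\<^sup>2 ^ ?L)) * 1)"
        unfolding nf by (intro mult_mono norm_powr_le_power(2)[OF m k] e) (auto simp: flat_cutoff_bounds)
      then have "(1 + norm k) ^ N * norm (f k) \<le> (2 * norm k) ^ N * (norm k ^ m * (((real ?L / p) ^ ?L * inverse ((norm k)\<^sup>2 ^ ?L)) * 1))"
        using k by (intro mult_mono power_mono) auto
      also have "\<dots> = 2 ^ N * (real ?L / p) ^ ?L * (norm k ^ (N + m) * inverse ((norm k)\<^sup>2 ^ ?L))"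
        by (simp add: power_mult_distrib power_add)
      also have "\<dots> \<le> 2 ^ N * (real ?L / p) ^ ?L * 1"
      proof (rule mult_left_mono)
        have "norm k ^ (N + m) \<le> (norm k)\<^sup>2 ^ ?L"
          unfolding power_mult[symmetric] using k by (intro power_increasing) auto
        then show "norm k ^ (N + m) * inverse ((norm k)\<^sup>2 ^ ?L) \<le> 1"
          using n0 by (simp add: divide_inverse[symmetric] divide_le_eq_1)
      qed (use p in auto)
      finally show ?thesis by simp
    qed
    then show ?thesis by blast
  qed
  fix i
  have B: "cutoff_gauss b a p' s' \<in> poly_span ?B" if "0 < p'" for p' s'
    using that by (intro poly_span.base) auto
  have p': "0 < p + b" using p b by simp
  show "\<exists>g\<in>poly_span ?B. \<forall>k. k \<noteq> 0 \<longrightarrow> partial i f k = g k"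
    unfolding f
  proof (intro bexI[of _ "\<lambda>k. (of_real s * (of_real (k $ i) * cutoff_gauss b a p (s - 2) k)
      + (of_real (- 2 * p) * (of_real (k $ i) * cutoff_gauss b a p s k)
      + (2 * (of_real (k $ i) * cutoff_gauss b a (p + b) (s - 2) k)
      + of_real (2 / b) * (of_real (k $ i) * cutoff_gauss b a (p + b) (s - 4) k))))
      + (- \<i> * of_real (a $ i)) * cutoff_gauss b a p s k"] allI impI)
  qed (rule cutoff_gauss_partial(2)[OF b], assumption, intro poly_span.add poly_span.cmult poly_span.coord B p p')
qed

lemma cutoff_gauss_Psi: "0 < b \<Longrightarrow> 0 < p \<Longrightarrow> cutoff_gauss b a p s \<in> Psi"
  using cutoff_gauss_span_Psi[of b a] poly_span.base[of "cutoff_gauss b a p s" "{cutoff_gauss b a p s | p s. 0 < p}"] by auto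

text \<open>The derivatives of the complement lie in \<open>Psi\<close>, being combinations of \<open>cutoff_gauss\<close>; the complement
  itself decays because \<open>1 - exp (- y) \<le> y\<close>.\<close>

lemma cutoff_complement_schwartz:
  assumes b: "0 < b"
  shows "(\<lambda>k::real^'d::finite. complex_of_real (1 - flat_cutoff b k)) \<in> schwartz"
proof (rule schwartz_coinduct[of _ "insert (\<lambda>k. complex_of_real (1 - flat_cutoff b k)) Psi"])
  let ?\<chi> = "\<lambda>k::real^'d. complex_of_real (1 - flat_cutoff b k)"
  have D0: "(?\<chi> has_derivative (\<lambda>_. 0)) (at 0)"
  proof -
    obtain C where C: "\<And>k :: real^'d. norm k \<le> 1 \<Longrightarrow> flat_cutoff b k \<le> C * norm k ^ 2"
      using flat_cutoff_flat[OF b] by blast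
    have "((\<lambda>k::real^'d. complex_of_real (flat_cutoff b k)) has_derivative (\<lambda>_. 0)) (at 0)"
      by (rule quadratic_zero_has_derivative[where C = C]) (use C in \<open>auto simp: flat_cutoff_bounds\<close>)
    from has_derivative_diff[OF has_derivative_const[of 1] this] show ?thesis by simp
  qed
  have D: "(?\<chi> has_derivative (\<lambda>h. - of_real (exp (- b * (k \<bullet> k)) * flat_cutoff b k * (1 / (k \<bullet> k) + 1 / (b * (k \<bullet> k)\<^sup>2)) * (2 * (k \<bullet> h))))) (at k)"
    if k: "k \<noteq> 0" for k
    using has_derivative_diff[OF has_derivative_const[of 1] of_real_has_derivative[OF gauss_cutoff_has_derivative[OF b k, of 0]]]
    by simp
  have d: "?\<chi> differentiable (at k)" for k
    using D0 D unfolding differentiable_def by (cases "k = 0") blast+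
  show "f differentiable (at k)" if "f \<in> insert ?\<chi> Psi" for f and k :: "real^'d"
    using that d by (auto intro: schwartz_differentiable Psi_schwartz)
  show "partial i f \<in> insert ?\<chi> Psi" if "f \<in> insert ?\<chi> Psi" for f i
  proof -
    let ?g = "\<lambda>k. (- 2) * (of_real (k $ i) * cutoff_gauss b 0 b (- 2) k) + of_real (- 2 / b) * (of_real (k $ i) * cutoff_gauss b 0 b (- 4) k)"
    have "?g \<in> Psi"
      by (rule subsetD[OF cutoff_gauss_span_Psi[OF b]])
         (intro poly_span.add poly_span.cmult poly_span.coord poly_span.base; use b in auto)
    moreover have "partial i ?\<chi> k = ?g k" for k
    proof (cases "k = 0")
      case True
      then show ?thesis using partial_has_derivative[OF D0] by (simp add: cutoff_gauss_def)
    next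
      case False
      then have n: "0 < norm k" by simp
      have q: "k \<bullet> k = norm k powr 2" using n by (simp add: dot_square_norm powr_numeral)
      have q2: "1 / (k \<bullet> k) = norm k powr (- 2)" unfolding q by (simp add: powr_minus_divide)
      have q4: "1 / (b * (k \<bullet> k)\<^sup>2) = norm k powr (- 4) / b"
      proof -
        have "(k \<bullet> k)\<^sup>2 = norm k powr 4" unfolding q power2_eq_square by (simp flip: powr_add)
        then show ?thesis by (simp add: powr_minus_divide)
      qed
      have "partial i ?\<chi> k = - of_real (exp (- b * (k \<bullet> k)) * flat_cutoff b k * (norm k powr (- 2) + norm k powr (- 4) / b) * (2 * k $ i))"
        by (subst partial_has_derivative[OF D[OF False]], subst q2, subst q4) (simp add: inner_axis)
      then show ?thesis by (simp add: cutoff_gauss_def algebra_simps)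
    qed
    then have "partial i ?\<chi> = ?g" by (rule ext)
    ultimately show ?thesis using that Psi_partial by auto
  qed
  show "\<exists>C. \<forall>k. (1 + norm k) ^ N * norm (f k) \<le> C" if "f \<in> insert ?\<chi> Psi" for f and N
  proof (cases "f \<in> Psi")
    case True
    then show ?thesis using schwartz_decay Psi_schwartz by blast
  next
    case False
    then have f: "f = ?\<chi>" using that by simp
    have nf: "norm (f k) = 1 - flat_cutoff b k" for k
      unfolding f norm_of_real using flat_cutoff_bounds(2)[OF b, of k] by simp
    have "(1 + norm k) ^ N * norm (f k) \<le> max (2 ^ N) (2 ^ N * (real (Suc N) / b) ^ Suc N / b)" for k
    proof (cases "1 \<le> norm k")
      case False
      have "norm (f k) \<le> 1" unfolding nf using flat_cutoff_bounds(1)[of b k] by simp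
      then have "(1 + norm k) ^ N * norm (f k) \<le> 2 ^ N * 1" using False by (intro mult_mono power_mono) auto
      then show ?thesis by simp
    next
      case k: True
      then have n0: "0 < norm k" by linarith
      have q: "k \<bullet> k = (norm k)\<^sup>2" by (simp add: dot_square_norm)
      let ?y = "exp (- (b * (norm k)\<^sup>2)) / (b * (norm k)\<^sup>2)"
      have "norm (f k) = 1 - exp (- ?y)" unfolding nf using n0 by (simp add: flat_cutoff_def q)
      also have "\<dots> \<le> ?y" using exp_ge_add_one_self[of "- ?y"] by simp
      also have "?y \<le> exp (- (b * (norm k)\<^sup>2)) / (b * 1)"
        using b k by (intro divide_left_mono mult_left_mono) (auto intro!: mult_pos_pos zero_less_power n0)
      also have "\<dots> \<le> (real (Suc N) / (b * (norm k)\<^sup>2)) ^ Suc N / (b * 1)"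
        by (intro divide_right_mono exp_minus_le_power) (use b n0 in auto)
      also have "\<dots> = (real (Suc N) / b) ^ Suc N / b * inverse ((norm k)\<^sup>2 ^ Suc N)"
        by (simp only: power_divide power_mult_distrib divide_inverse mult_1_right inverse_mult_distrib inverse_1 mult_1_left power_inverse mult_ac)
      finally have "(1 + norm k) ^ N * norm (f k) \<le> (2 * norm k) ^ N * ((real (Suc N) / b) ^ Suc N / b * inverse ((norm k)\<^sup>2 ^ Suc N))"
        using k by (intro mult_mono power_mono) auto
      also have "\<dots> = 2 ^ N * (real (Suc N) / b) ^ Suc N / b * (norm k ^ N * inverse ((norm k)\<^sup>2 ^ Suc N))"
        by (simp add: power_mult_distrib)
      also have "\<dots> \<le> 2 ^ N * (real (Suc N) / b) ^ Suc N / b * 1"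
      proof (rule mult_left_mono)
        have "norm k ^ N \<le> (norm k)\<^sup>2 ^ Suc N"
          unfolding power_mult[symmetric] using k by (intro power_increasing) auto
        then show "norm k ^ N * inverse ((norm k)\<^sup>2 ^ Suc N) \<le> 1"
          using n0 by (simp add: divide_inverse[symmetric] divide_le_eq_1 del: power_Suc)
      qed (use b in auto)
      finally show ?thesis by simp
    qed
    then show ?thesis by blast
  qed
qed simp

section \<open>Tempered densities\<close>

definition tempered :: "'d::finite fn \<Rightarrow> bool" where
  "tempered g \<longleftrightarrow> g \<in> borel_measurable borel \<and>
     (\<exists>N. integrable lborel (\<lambda>k. of_real (inverse ((1 + norm k) ^ N)) * g k))"

lemma tempered_measurable [measurable_dest]: "tempered g \<Longrightarrow> g \<in> borel_measurable borel"
  by (simp add: tempered_def)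

lemma tempered_bound:
  fixes g :: "'d::finite fn"
  assumes "tempered g"
  shows "\<exists>N. \<exists>C\<ge>0. \<forall>\<psi> B. \<psi> \<in> borel_measurable borel \<longrightarrow> (\<forall>k. (1 + norm k) ^ N * norm (\<psi> k) \<le> B) \<longrightarrow>
       integrable lborel (\<lambda>k. g k * \<psi> k) \<and> norm (LINT k|lborel. g k * \<psi> k) \<le> C * B"
proof -
  have [measurable]: "g \<in> borel_measurable borel" using assms by (rule tempered_measurable)
  obtain N where N: "integrable lborel (\<lambda>k. of_real (inverse ((1 + norm k) ^ N)) * g k)"
    using assms by (auto simp: tempered_def)
  let ?w = "\<lambda>k. of_real (inverse ((1 + norm k) ^ N)) * g k"
  show ?thesis
  proof (intro exI[of _ N] exI[of _ "LINT k|lborel. norm (?w k)"] conjI allI impI)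
    fix \<psi> :: "'d fn" and B
    assume [measurable]: "\<psi> \<in> borel_measurable borel" and "\<forall>k. (1 + norm k) ^ N * norm (\<psi> k) \<le> B"
    then have B: "(1 + norm k) ^ N * norm (\<psi> k) \<le> B" for k by blast
    have le: "norm (g k * \<psi> k) \<le> norm (?w k) * B" for k
    proof -
      have p: "0 < (1 + norm k) ^ N" by (intro zero_less_power) (simp add: add_pos_nonneg)
      have "norm (?w k) * ((1 + norm k) ^ N * norm (\<psi> k))
          = (inverse ((1 + norm k) ^ N) * (1 + norm k) ^ N) * norm (g k * \<psi> k)"
        unfolding norm_mult norm_of_real by simp
      also have "\<dots> = norm (g k * \<psi> k)"
        by (subst left_inverse[OF less_imp_neq[THEN not_sym, OF p]]) simp
      finally have "norm (g k * \<psi> k) = norm (?w k) * ((1 + norm k) ^ N * norm (\<psi> k))" ..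
      also have "\<dots> \<le> norm (?w k) * B" by (intro mult_left_mono B norm_ge_zero)
      finally show ?thesis .
    qed
    have int: "integrable lborel (\<lambda>k. norm (?w k) * B)" by (intro integrable_mult_left integrable_norm N)
    have i: "integrable lborel (\<lambda>k. g k * \<psi> k)"
      by (rule Bochner_Integration.integrable_bound[OF int])
        (use le in \<open>auto intro: order_trans[OF _ abs_ge_self]\<close>)
    have "norm (LINT k|lborel. g k * \<psi> k) \<le> (LINT k|lborel. norm (?w k) * B)"
      by (rule Bochner_Integration.integral_norm_bound_integral[OF i int le])
    also have "\<dots> = (LINT k|lborel. norm (?w k)) * B" by simp
    finally show "norm (LINT k|lborel. g k * \<psi> k) \<le> (LINT k|lborel. norm (?w k)) * B" .
    show "integrable lborel (\<lambda>k. g k * \<psi> k)" by (rule i)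
  qed auto
qed

lemma tempered_integrable:
  assumes g: "tempered g" and \<psi>: "\<psi> \<in> schwartz"
  shows "integrable lborel (\<lambda>k. g k * \<psi> k)"
proof -
  obtain N C where NC: "\<forall>\<psi> B. \<psi> \<in> borel_measurable borel \<longrightarrow> (\<forall>k. (1 + norm k) ^ N * norm (\<psi> k) \<le> B) \<longrightarrow>
       integrable lborel (\<lambda>k. g k * \<psi> k) \<and> norm (LINT k|lborel. g k * \<psi> k) \<le> C * B"
    using tempered_bound[OF g] by fast
  obtain B where "\<forall>k. (1 + norm k) ^ N * norm (\<psi> k) \<le> B" using schwartz_decay[OF \<psi>] by fast
  with NC[rule_format, of \<psi> B] schwartz_measurable[OF \<psi>] show ?thesis by simp
qed

lemma L2_fun_measurable: "u \<in> L2_fun \<Longrightarrow> u \<in> borel_measurable borel"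
  and L2_fun_integrable: "u \<in> L2_fun \<Longrightarrow> integrable lborel (\<lambda>x. (norm (u x))\<^sup>2)"
  by (auto simp: L2_fun_def)

lemma L2_fun_I: "u \<in> borel_measurable borel \<Longrightarrow> integrable lborel (\<lambda>x. (norm (u x))\<^sup>2) \<Longrightarrow> u \<in> L2_fun"
  by (auto simp: L2_fun_def)

lemma L1_tempered: "integrable lborel g \<Longrightarrow> tempered g"
  unfolding tempered_def by (intro conjI exI[of _ 0]) simp_all

lemma L2_tempered:
  fixes g :: "'d::finite fn"
  assumes "g \<in> L2_fun"
  shows "tempered g"
proof -
  note [measurable] = L2_fun_measurable[OF assms]
  let ?w = "\<lambda>k::real^'d. complex_of_real (inverse ((1 + norm k) ^ (2 * CARD('d))))"
  have "integrable lborel (\<lambda>k. (norm (?w k))\<^sup>2)"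
  proof (rule Bochner_Integration.integrable_bound[OF integrable_weight])
    show "AE k in lborel. norm ((norm (?w k))\<^sup>2) \<le> norm (inverse ((1 + norm k) ^ (2 * CARD('d))))"
    proof (intro AE_I2)
      fix k :: "real^'d"
      have "1 \<le> (1 + norm k) ^ (2 * CARD('d))" by (rule one_le_power) simp
      then have "inverse ((1 + norm k) ^ (2 * CARD('d))) \<le> 1" by (rule inverse_le_1_iff[THEN iffD2, OF disjI2])
      then have "(inverse ((1 + norm k) ^ (2 * CARD('d))))\<^sup>2 \<le> inverse ((1 + norm k) ^ (2 * CARD('d)))"
        unfolding power2_eq_square by (intro mult_left_le) auto
      then show "norm ((norm (?w k))\<^sup>2) \<le> norm (inverse ((1 + norm k) ^ (2 * CARD('d))))"
        unfolding norm_of_real by simp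
    qed
  qed measurable
  then have "integrable lborel (\<lambda>k. ?w k * g k)"
    by (intro L2_product(1) L2_fun_integrable[OF assms]) auto
  then show ?thesis unfolding tempered_def by auto
qed

lemma norm_powr_tempered:
  fixes g :: "'d::finite fn"
  assumes g: "tempered g" and s: "0 \<le> s"
  shows "tempered (\<lambda>k. of_real (norm k powr s) * g k)"
proof -
  note [measurable] = tempered_measurable[OF g]
  obtain N where N: "integrable lborel (\<lambda>k. of_real (inverse ((1 + norm k) ^ N)) * g k)"
    using g by (auto simp: tempered_def)
  obtain m :: nat where m: "s \<le> real m" using real_arch_simple by blast
  have "integrable lborel (\<lambda>k. of_real (norm k powr s * inverse ((1 + norm k) ^ m)) * (of_real (inverse ((1 + norm k) ^ N)) * g k))"
  proof (rule integrable_mult_bounded[OF N, where B = 1])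
    fix k :: "real^'d"
    have "norm k powr s \<le> (1 + norm k) powr s" using s by (intro powr_mono2) auto
    also have "\<dots> \<le> (1 + norm k) powr real m" using m by (intro powr_mono) auto
    also have "\<dots> = (1 + norm k) ^ m" by (intro powr_realpow) (simp add: add_pos_nonneg)
    finally have "norm k powr s * inverse ((1 + norm k) ^ m) \<le> (1 + norm k) ^ m * inverse ((1 + norm k) ^ m)"
      by (intro mult_right_mono) auto
    also have "\<dots> = 1"
    proof (rule right_inverse)
      have "0 < (1 + norm k) ^ m" by (intro zero_less_power) (simp add: add_pos_nonneg)
      then show "(1 + norm k) ^ m \<noteq> 0" by (rule less_imp_neq[THEN not_sym])
    qed
    finally show "norm (complex_of_real (norm k powr s * inverse ((1 + norm k) ^ m))) \<le> 1"
      unfolding norm_of_real by (subst abs_of_nonneg) auto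
  qed measurable
  moreover have "(\<lambda>k. of_real (norm k powr s * inverse ((1 + norm k) ^ m)) * (of_real (inverse ((1 + norm k) ^ N)) * g k))
     = (\<lambda>k. of_real (inverse ((1 + norm k) ^ (m + N))) * (of_real (norm k powr s) * g k))"
    by (rule ext) (simp add: power_add)
  ultimately have "integrable lborel (\<lambda>k. of_real (inverse ((1 + norm k) ^ (m + N))) * (of_real (norm k powr s) * g k))"
    by (rule back_subst)
  then show ?thesis unfolding tempered_def by auto
qed

lemma tempered_diff:
  assumes f: "tempered f" and g: "tempered g"
  shows "tempered (\<lambda>k. f k - g k)"
proof -
  note [measurable] = tempered_measurable[OF f] tempered_measurable[OF g]
  obtain M N where M: "integrable lborel (\<lambda>k. of_real (inverse ((1 + norm k) ^ M)) * f k)"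
    and N: "integrable lborel (\<lambda>k. of_real (inverse ((1 + norm k) ^ N)) * g k)"
    using f g by (auto simp: tempered_def)
  have b: "norm (complex_of_real (inverse ((1 + norm k) ^ l))) \<le> 1" for l and k :: "real^'a"
  proof -
    have "1 \<le> (1 + norm k) ^ l" by (rule one_le_power) simp
    then have "inverse ((1 + norm k) ^ l) \<le> 1" by (rule inverse_le_1_iff[THEN iffD2, OF disjI2])
    then show ?thesis unfolding norm_of_real by (subst abs_of_nonneg) auto
  qed
  have "integrable lborel (\<lambda>k. of_real (inverse ((1 + norm k) ^ N)) * (of_real (inverse ((1 + norm k) ^ M)) * f k)
     - of_real (inverse ((1 + norm k) ^ M)) * (of_real (inverse ((1 + norm k) ^ N)) * g k))"
    by (intro Bochner_Integration.integrable_diff integrable_mult_bounded[OF M _ b] integrable_mult_bounded[OF N _ b]) measurable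
  moreover have "(\<lambda>k. of_real (inverse ((1 + norm k) ^ N)) * (of_real (inverse ((1 + norm k) ^ M)) * f k)
     - of_real (inverse ((1 + norm k) ^ M)) * (of_real (inverse ((1 + norm k) ^ N)) * g k))
     = (\<lambda>k. of_real (inverse ((1 + norm k) ^ (M + N))) * (f k - g k))"
    by (rule ext) (simp add: power_add algebra_simps)
  ultimately have "integrable lborel (\<lambda>k. of_real (inverse ((1 + norm k) ^ (M + N))) * (f k - g k))"
    by (rule back_subst)
  then show ?thesis unfolding tempered_def by auto
qed

text \<open>The functions \<open>cutoff_gauss 1 a (1/2) 0\<close> are waves of arbitrary frequency \<open>a\<close> times one and the same
  function that is positive off the origin. Annihilating them means that \<open>g\<close> times this function, which
  is integrable, has Fourier transform zero.\<close>

lemma Psi_annihilator: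
  fixes g :: "'d::finite fn"
  assumes g: "tempered g" and z: "\<And>\<psi>. \<psi> \<in> Psi \<Longrightarrow> (LINT k|lborel. g k * \<psi> k) = 0"
  shows "AE k in lborel. g k = 0"
proof -
  let ?G = "\<lambda>k. g k * of_real (exp (- (1/2) * (k \<bullet> k)) * flat_cutoff 1 k)"
  have eq: "g k * cutoff_gauss 1 a (1/2) 0 k = wave a k * ?G k" for a k
    by (cases "k = 0") (simp_all add: cutoff_gauss_def flat_cutoff_bounds)
  have P: "cutoff_gauss 1 a (1/2) 0 \<in> Psi" for a :: "real^'d" by (rule cutoff_gauss_Psi) auto
  have "integrable lborel (\<lambda>k. wave 0 k * ?G k)"
    unfolding eq[symmetric] by (rule tempered_integrable[OF g Psi_schwartz[OF P]])
  then have G: "integrable lborel ?G" by simp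
  have "fourier ?G a = 0" for a
    unfolding fourier_eq eq[symmetric] by (simp add: z[OF P])
  from fourier_L1_unique[OF G this] AE_lborel_singleton[of "0 :: real^'d"]
  show ?thesis
  proof eventually_elim
    case (elim k)
    then show ?case using flat_cutoff_bounds(3)[of k 1] by auto
  qed
qed

section \<open>Functions vanishing at infinity are determined by their action on Phi\<close>

lemma C0_fun_continuous: "h \<in> C0_fun \<Longrightarrow> continuous_on UNIV h"
  and C0_fun_limit: "h \<in> C0_fun \<Longrightarrow> (h \<longlongrightarrow> 0) at_infinity"
  by (auto simp: C0_fun_def)

lemma C0_fun_measurable: "h \<in> C0_fun \<Longrightarrow> h \<in> borel_measurable borel"
  by (simp add: borel_measurable_continuous_onI C0_fun_continuous)

lemma C0_fun_bounded:
  assumes h: "h \<in> (C0_fun :: 'd::finite fn set)"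
  obtains B where "\<And>x. norm (h x) \<le> B"
proof -
  have "\<forall>\<^sub>F x in at_infinity. dist (h x) 0 < 1" using tendstoD[OF C0_fun_limit[OF h], of 1] by simp
  then obtain R where R: "\<And>x. R \<le> norm x \<Longrightarrow> norm (h x) < 1" unfolding eventually_at_infinity by auto
  have "compact (h ` cball 0 R)"
    by (intro compact_continuous_image continuous_on_subset[OF C0_fun_continuous[OF h]]) auto
  then obtain B where B: "\<And>x. x \<in> cball 0 R \<Longrightarrow> norm (h x) \<le> B"
    using compact_imp_bounded bounded_iff by (metis imageI)
  have "norm (h x) \<le> max 1 B" for x
    using R[of x] B[of x] by (cases "R \<le> norm x") (auto simp: le_max_iff_disj)
  then show thesis by (rule that)
qed

lemma fourier_reflect:
  fixes f :: "'d::finite fn"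
  assumes [measurable]: "f \<in> borel_measurable borel"
  shows "fourier (\<lambda>x. f (- x)) k = fourier f (- k)"
  using integral_lborel_reflect[of "\<lambda>x. wave (- k) x * f x"] by (simp add: fourier_eq)

lemma C0_average_tendsto_0:
  fixes h F :: "'d::finite fn"
  assumes h: "h \<in> C0_fun" and F: "integrable lborel F" and z: "z \<noteq> 0"
  shows "(\<lambda>n. LINT y|lborel. h (y + real (Suc n) *\<^sub>R z) * F y) \<longlonglongrightarrow> 0"
proof -
  note [measurable] = C0_fun_measurable[OF h]
  have [measurable]: "F \<in> borel_measurable borel" using F by auto
  obtain B where B: "\<And>x. norm (h x) \<le> B" using C0_fun_bounded[OF h] by blast
  have "(\<lambda>n. LINT y|lborel. h (y + real (Suc n) *\<^sub>R z) * F y) \<longlonglongrightarrow> (LINT y|lborel. 0 * F y)"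
  proof (rule integral_dominated_convergence[where w = "\<lambda>y. B * norm (F y)"])
    show "AE y in lborel. (\<lambda>n. h (y + real (Suc n) *\<^sub>R z) * F y) \<longlonglongrightarrow> 0 * F y"
    proof (intro AE_I2 tendsto_mult tendsto_const)
      fix y :: "real^'d"
      have "filterlim (\<lambda>n. real (Suc n) * norm z - norm y) at_top sequentially"
        using z by real_asymp
      then have "filterlim (\<lambda>n. norm (y + real (Suc n) *\<^sub>R z)) at_top sequentially"
      proof (rule filterlim_at_top_mono)
        have "real (Suc n) * norm z - norm y \<le> norm (y + real (Suc n) *\<^sub>R z)" for n
          using norm_triangle_ineq4[of "y + real (Suc n) *\<^sub>R z" y] by (simp del: of_nat_Suc)
        then show "\<forall>\<^sub>F n in sequentially. real (Suc n) * norm z - norm y \<le> norm (y + real (Suc n) *\<^sub>R z)" by simp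
      qed
      then have "filterlim (\<lambda>n. y + real (Suc n) *\<^sub>R z) at_infinity sequentially"
        by (rule filterlim_norm_at_top_imp_at_infinity)
      then show "(\<lambda>n. h (y + real (Suc n) *\<^sub>R z)) \<longlonglongrightarrow> 0"
        by (rule filterlim_compose[OF C0_fun_limit[OF h]])
    qed
    show "AE y in lborel. norm (h (y + real (Suc n) *\<^sub>R z) * F y) \<le> B * norm (F y)" for n
      by (intro AE_I2) (simp add: norm_mult mult_right_mono B)
  qed (use F in auto)
  then show ?thesis by simp
qed

text \<open>A bounded function that annihilates \<open>Phi\<close> is a polynomial, since its Fourier transform is supported
  at the origin, and hence a constant; vanishing at infinity excludes the nonzero constants. The proof
  makes this quantitative. A Gaussian \<open>\<psi>\<close> differs from an element of \<open>Psi\<close> by \<open>\<psi>\<close> times a Schwartz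
  cutoff concentrated at scale \<open>1/m\<close> around the origin. The transform of the latter is an average of
  translates of the transform of \<open>\<psi>\<close> over distances of order \<open>m\<close>, and its integral against \<open>h\<close>
  tends to 0 as \<open>m\<close> tends to infinity. So \<open>h\<close> annihilates all Gaussians, and these approximate
  point evaluations.\<close>

lemma C0_Phi_annihilator:
  fixes h :: "'d::finite fn"
  assumes h: "h \<in> C0_fun" and z: "\<And>\<phi>. \<phi> \<in> Phi \<Longrightarrow> (LINT x|lborel. h x * \<phi> x) = 0"
  shows "h x = 0"
proof -
  note [measurable] = C0_fun_measurable[OF h]
  obtain B where B: "\<And>x. norm (h x) \<le> B" using C0_fun_bounded[OF h] by blast
  let ?c = "fconst TYPE('d)"
  define \<eta> :: "'d fn" where "\<eta> k = of_real (1 - flat_cutoff 1 k)" for k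
  have \<eta>: "\<eta> \<in> schwartz" unfolding \<eta>_def[abs_def] by (rule cutoff_complement_schwartz) simp
  define X where "X = fourier \<eta>"
  have Xs: "X \<in> schwartz" unfolding X_def by (rule fourier_schwartz[OF \<eta>])
  note X = schwartz_integrable[OF Xs]
  have \<eta>X: "\<eta> q = fourier X (- q)" for q unfolding X_def fourier_fourier[OF \<eta>] by simp
  have avg: "(LINT w|lborel. h (x + t *\<^sub>R w) * of_real (gauss w)) = 0" if t: "0 < t" for t
  proof -
    define \<psi> where "\<psi> k = wave (- x) k * complex_of_real (gauss (t *\<^sub>R k))" for k
    have \<psi>: "integrable lborel \<psi>" unfolding \<psi>_def using t by (intro integrable_wave_gauss_scaled) auto
    then have [measurable]: "\<psi> \<in> borel_measurable borel" by auto
    have F\<psi>: "fourier \<psi> y = of_real (inverse (t ^ CARD('d)) * gauss ((y - x) /\<^sub>R t))" for y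
      unfolding \<psi>_def by (rule fourier_wave_gauss_scaled[OF t])
    have iF\<psi>: "integrable lborel (fourier \<psi>)"
    proof -
      have "integrable lborel (\<lambda>y::real^'d. complex_of_real (gauss (- (inverse t) *\<^sub>R x + inverse t *\<^sub>R y)))"
        using t by (intro integrable_of_real integrable_lborel_affine integrable_gauss) auto
      then show ?thesis unfolding F\<psi> of_real_mult
        by (intro integrable_mult_right) (simp add: scaleR_diff_right)
    qed
    define J where "J w = (LINT y|lborel. h (y + w) * fourier \<psi> y)" for w
    have [measurable]: "J \<in> borel_measurable borel" unfolding J_def by measurable
    have Jb: "norm (J w) \<le> B * (LINT y|lborel. norm (fourier \<psi> y))" for w
    proof -
      have "norm (J w) \<le> (LINT y|lborel. B * norm (fourier \<psi> y))"
        unfolding J_def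
      proof (rule Bochner_Integration.integral_norm_bound_integral)
        show "integrable lborel (\<lambda>y. h (y + w) * fourier \<psi> y)"
          by (rule integrable_mult_bounded[OF iF\<psi> _ B]) measurable
      qed (use iF\<psi> in \<open>auto simp: norm_mult intro!: mult_right_mono B\<close>)
      then show ?thesis by simp
    qed
    have eq: "(LINT y|lborel. h y * fourier \<psi> y) = of_real ?c * (LINT w|lborel. J (real (Suc n) *\<^sub>R w) * X w)" for n
    proof -
      define m where "m = real (Suc n)"
      have m: "0 < m" by (simp add: m_def)
      \<comment> \<open>rescaling the cutoff by \<open>m\<close> changes its parameter to \<open>m\<^sup>2\<close>\<close>
      have cut: "\<psi> k - \<psi> k * \<eta> (m *\<^sub>R k) = cutoff_gauss (m\<^sup>2) (- x) (t\<^sup>2 / 2) 0 k" for k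
        using m by (cases "k = 0")
          (simp_all add: \<psi>_def \<eta>_def cutoff_gauss_def flat_cutoff_def gauss_def power2_eq_square algebra_simps)
      have "cutoff_gauss (m\<^sup>2) (- x) (t\<^sup>2 / 2) 0 \<in> Psi" using t m by (intro cutoff_gauss_Psi) auto
      then have "(LINT y|lborel. h y * fourier (\<lambda>k. \<psi> k - \<psi> k * \<eta> (m *\<^sub>R k)) y) = 0"
        unfolding cut by (intro z fourier_Psi) simp
      moreover have i\<eta>: "integrable lborel (\<lambda>k. \<psi> k * \<eta> (m *\<^sub>R k))"
      proof -
        have "norm (\<eta> k) \<le> 1" for k
          using flat_cutoff_bounds(1)[of 1 k] flat_cutoff_bounds(2)[of 1 k] unfolding \<eta>_def norm_of_real by simp
        moreover have "\<eta> \<in> borel_measurable borel" by (rule schwartz_measurable[OF \<eta>])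
        ultimately have "integrable lborel (\<lambda>k. \<eta> (m *\<^sub>R k) * \<psi> k)"
          by (intro integrable_mult_bounded[OF \<psi>, where B = 1]) auto
        then show ?thesis by (simp add: mult.commute)
      qed
      \<comment> \<open>the transform of a product with the cutoff, as an average of translates\<close>
      have conv: "fourier (\<lambda>k. \<psi> k * \<eta> (m *\<^sub>R k)) y = of_real ?c * (LINT w|lborel. fourier \<psi> (y + (- m) *\<^sub>R w) * X w)" for y
      proof -
        have e1: "wave y k * (\<psi> k * \<eta> (m *\<^sub>R k)) = of_real ?c * (LINT w|lborel. wave (y + (- m) *\<^sub>R w) k * (\<psi> k * X w))" for k
        proof -
          have "wave (y + (- m) *\<^sub>R w) k = wave y k * wave (- (m *\<^sub>R k)) w" for w
            unfolding wave_add by (simp add: wave_def inner_commute)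
          then have eqw: "wave (y + (- m) *\<^sub>R w) k * (\<psi> k * X w) = (wave y k * \<psi> k) * (wave (- (m *\<^sub>R k)) w * X w)" for w
            by (simp only: mult_ac)
          show ?thesis
            unfolding \<eta>X fourier_eq[of X] eqw integral_mult_right_zero by (simp only: mult_ac)
        qed
        have "integrable (lborel \<Otimes>\<^sub>M lborel) (\<lambda>(k, w). wave (y + (- m) *\<^sub>R w) k * (\<psi> k * X w))"
          by (rule integrable_pair_kernel[OF \<psi> X, where B = 1]) auto
        from lborel_pair.Fubini_integral[OF this]
        have "(LINT w|lborel. LINT k|lborel. wave (y + (- m) *\<^sub>R w) k * (\<psi> k * X w))
          = (LINT k|lborel. LINT w|lborel. wave (y + (- m) *\<^sub>R w) k * (\<psi> k * X w))" .
        moreover have "(LINT k|lborel. wave (y + (- m) *\<^sub>R w) k * (\<psi> k * X w))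
          = (LINT k|lborel. wave (y + (- m) *\<^sub>R w) k * \<psi> k) * X w" for w
          by (simp add: mult.assoc[symmetric])
        ultimately have "(LINT k|lborel. LINT w|lborel. wave (y + (- m) *\<^sub>R w) k * (\<psi> k * X w))
          = (LINT w|lborel. (LINT k|lborel. wave (y + (- m) *\<^sub>R w) k * \<psi> k) * X w)" by simp
        then show ?thesis
          unfolding fourier_eq[of "\<lambda>k. \<psi> k * \<eta> (m *\<^sub>R k)"] e1 integral_mult_right_zero
          by (simp add: fourier_eq[of \<psi>] mult.assoc)
      qed
      have ib: "integrable lborel (\<lambda>y. h y * fourier (\<lambda>k. \<psi> k * \<eta> (m *\<^sub>R k)) y)"
        and swap: "(LINT y|lborel. h y * fourier (\<lambda>k. \<psi> k * \<eta> (m *\<^sub>R k)) y) = of_real ?c * (LINT w|lborel. J (m *\<^sub>R w) * X w)"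
      proof -
        have int: "integrable (lborel \<Otimes>\<^sub>M lborel) (\<lambda>(w, y). h y * fourier \<psi> (y + (- m) *\<^sub>R w) * X w)"
          by (rule integrable_shift_pair[OF iF\<psi> X _ B]) measurable
        have yint: "h y * fourier (\<lambda>k. \<psi> k * \<eta> (m *\<^sub>R k)) y
            = of_real ?c * (LINT w|lborel. h y * fourier \<psi> (y + (- m) *\<^sub>R w) * X w)" for y
          unfolding conv mult.assoc integral_mult_right_zero by (rule mult.left_commute)
        show "integrable lborel (\<lambda>y. h y * fourier (\<lambda>k. \<psi> k * \<eta> (m *\<^sub>R k)) y)"
          unfolding yint using lborel_pair.integrable_snd[OF int] by (intro integrable_mult_right)
        have "(LINT y|lborel. LINT w|lborel. h y * fourier \<psi> (y + (- m) *\<^sub>R w) * X w)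
          = (LINT w|lborel. LINT y|lborel. h y * fourier \<psi> (y + (- m) *\<^sub>R w) * X w)"
          by (rule lborel_pair.Fubini_integral[OF int])
        also have "(\<lambda>w. LINT y|lborel. h y * fourier \<psi> (y + (- m) *\<^sub>R w) * X w) = (\<lambda>w. J (m *\<^sub>R w) * X w)"
        proof
          fix w
          have "(LINT y|lborel. h y * fourier \<psi> (y + (- m) *\<^sub>R w)) = J (m *\<^sub>R w)"
            using integral_lborel_shift[of "\<lambda>y. h y * fourier \<psi> (y + (- m) *\<^sub>R w)" "m *\<^sub>R w"]
            by (simp add: J_def add.commute)
          then show "(LINT y|lborel. h y * fourier \<psi> (y + (- m) *\<^sub>R w) * X w) = J (m *\<^sub>R w) * X w" by simp
        qed
        finally show "(LINT y|lborel. h y * fourier (\<lambda>k. \<psi> k * \<eta> (m *\<^sub>R k)) y) = of_real ?c * (LINT w|lborel. J (m *\<^sub>R w) * X w)"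
          unfolding yint integral_mult_right_zero by simp
      qed
      have ih: "integrable lborel (\<lambda>y. h y * fourier \<psi> y)" by (rule integrable_mult_bounded[OF iF\<psi> _ B]) measurable
      have "(LINT y|lborel. h y * fourier (\<lambda>k. \<psi> k - \<psi> k * \<eta> (m *\<^sub>R k)) y)
         = (LINT y|lborel. h y * fourier \<psi> y) - (LINT y|lborel. h y * fourier (\<lambda>k. \<psi> k * \<eta> (m *\<^sub>R k)) y)"
        unfolding fourier_diff[OF \<psi> i\<eta>] right_diff_distrib
        by (rule Bochner_Integration.integral_diff[OF ih ib])
      ultimately show ?thesis unfolding m_def[symmetric] by (simp add: swap)
    qed
    have "(\<lambda>n. LINT w|lborel. J (real (Suc n) *\<^sub>R w) * X w) \<longlonglongrightarrow> (LINT w|lborel. 0 * X w)"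
    proof (rule integral_dominated_convergence[where w = "\<lambda>w. B * (LINT y|lborel. norm (fourier \<psi> y)) * norm (X w)"])
      show "AE w in lborel. (\<lambda>n. J (real (Suc n) *\<^sub>R w) * X w) \<longlonglongrightarrow> 0 * X w"
        using AE_lborel_singleton[of "0::real^'d"]
      proof eventually_elim
        case (elim w)
        then show ?case
          unfolding J_def by (intro tendsto_mult tendsto_const C0_average_tendsto_0[OF h iF\<psi>])
      qed
      show "AE w in lborel. norm (J (real (Suc n) *\<^sub>R w) * X w) \<le> B * (LINT y|lborel. norm (fourier \<psi> y)) * norm (X w)" for n
        by (intro AE_I2) (simp add: norm_mult mult_right_mono Jb del: of_nat_Suc)
    qed (use X in auto)
    then have "(\<lambda>n. of_real ?c * (LINT w|lborel. J (real (Suc n) *\<^sub>R w) * X w)) \<longlonglongrightarrow> of_real ?c * 0"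
      by (intro tendsto_mult tendsto_const) simp
    then have "(LINT y|lborel. h y * fourier \<psi> y) = 0"
      unfolding eq[symmetric] by (simp add: LIMSEQ_const_iff)
    then show ?thesis unfolding F\<psi> integral_against_scaled_gauss[OF C0_fun_measurable[OF h] t] .
  qed
  have "(\<lambda>n. of_real ?c * (LINT w|lborel. h (x + inverse (real (Suc n)) *\<^sub>R w) * of_real (gauss w))) \<longlonglongrightarrow> h x"
    by (rule gauss_average_tendsto[OF C0_fun_continuous[OF h] B])
  then show ?thesis by (simp add: avg LIMSEQ_const_iff del: of_nat_Suc)
qed

section \<open>Functionals with a spectral density\<close>

text \<open>The functional with Fourier transform \<open>g\<close>, by \<open>fourier_dual_spectral\<close> below.\<close>

definition spectral :: "'d::finite fn \<Rightarrow> 'd functional" where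
  "spectral g = (\<lambda>\<phi>\<in>Phi. LINT k|lborel. g k * fourier \<phi> (- k))"

lemma Phi_add: "f \<in> Phi \<Longrightarrow> g \<in> Phi \<Longrightarrow> (\<lambda>x. f x + g x) \<in> (Phi :: 'd::finite fn set)"
  and Phi_cmult: "f \<in> Phi \<Longrightarrow> (\<lambda>x. c * f x) \<in> (Phi :: 'd::finite fn set)"
proof -
  assume f: "f \<in> (Phi :: 'd fn set)"
  have fs: "f \<in> schwartz" and f0: "\<And>is. (LINT x|lborel. of_real (\<Prod>i\<leftarrow>is. x $ i) * f x) = 0"
    using f by (auto simp: Phi_def)
  note fi = schwartz_integrable[OF schwartz_coords_mult[OF fs]]
  have "(LINT x|lborel. of_real (\<Prod>i\<leftarrow>is. x $ i) * (c * f x)) = c * 0" for "is"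
    unfolding f0[of "is", symmetric] integral_mult_right_zero[symmetric] by (simp only: mult_ac)
  then show "(\<lambda>x. c * f x) \<in> Phi" using schwartz_cmult[OF fs, of c] by (simp add: Phi_def)
  assume g: "g \<in> (Phi :: 'd fn set)"
  have gs: "g \<in> schwartz" and g0: "\<And>is. (LINT x|lborel. of_real (\<Prod>i\<leftarrow>is. x $ i) * g x) = 0"
    using g by (auto simp: Phi_def)
  note gi = schwartz_integrable[OF schwartz_coords_mult[OF gs]]
  have "(LINT x|lborel. of_real (\<Prod>i\<leftarrow>is. x $ i) * (f x + g x)) = 0" for "is"
    unfolding distrib_left by (subst Bochner_Integration.integral_add[OF fi gi]) (simp add: f0 g0)
  then show "(\<lambda>x. f x + g x) \<in> Phi" using schwartz_add[OF fs gs] by (simp add: Phi_def)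
qed

lemma Phi_diff: "f \<in> Phi \<Longrightarrow> g \<in> Phi \<Longrightarrow> (\<lambda>x. f x - g x) \<in> (Phi :: 'd::finite fn set)"
  using Phi_add[of f "\<lambda>x. (-1) * g x"] Phi_cmult[of g "-1"] by simp

lemma topspace_Phi: "topspace (subtopology schwartz_topology Phi) = (Phi :: 'd::finite fn set)"
proof -
  have "f \<in> topspace schwartz_topology" if f: "f \<in> (schwartz :: 'd fn set)" for f
  proof -
    have "{g \<in> schwartz. schwartz_seminorm 0 [] (\<lambda>x. g x - f x) < 1} \<in>
      {{g \<in> schwartz. schwartz_seminorm N is (\<lambda>x. g x - f x) < e} | N is f e. f \<in> schwartz \<and> 0 < e}"
      using f by (intro CollectI exI conjI) (auto intro: zero_less_one)
    moreover have "schwartz_seminorm 0 [] (\<lambda>x. f x - f x) < 1" by (simp add: schwartz_seminorm_def)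
    ultimately show ?thesis
      unfolding schwartz_topology_def topology_generated_by_topspace using f by blast
  qed
  then show ?thesis using Phi_schwartz by auto
qed

text \<open>An additive functional that is bounded by finitely many seminorms is continuous: the differences to a
  given point stay in \<open>Phi\<close>, and the seminorm balls around that point are subbasic open sets.\<close>

lemma continuous_map_Phi:
  fixes T :: "'d::finite functional" and J :: "'d list set"
  assumes add: "\<And>f g. f \<in> Phi \<Longrightarrow> g \<in> Phi \<Longrightarrow> T (\<lambda>x. f x + g x) = T f + T g"
    and J: "finite J" and K: "0 \<le> K"
    and bd: "\<And>\<phi>. \<phi> \<in> Phi \<Longrightarrow> norm (T \<phi>) \<le> K * (\<Sum>is\<in>J. schwartz_seminorm N is \<phi>)"
  shows "continuous_map (subtopology schwartz_topology Phi) euclidean T"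
  unfolding continuous_map_def topspace_Phi
proof (intro conjI allI impI)
  show "T \<in> Phi \<rightarrow> topspace euclidean" by simp
  fix U :: "complex set" assume "openin euclidean U"
  then have U: "open U" by simp
  show "openin (subtopology schwartz_topology Phi) {\<phi> \<in> Phi. T \<phi> \<in> U}"
  proof (subst openin_subopen, intro ballI)
    fix \<phi>0 assume "\<phi>0 \<in> {\<phi> \<in> Phi. T \<phi> \<in> U}"
    then have \<phi>0: "\<phi>0 \<in> Phi" "T \<phi>0 \<in> U" by auto
    obtain e where e: "0 < e" "\<And>z. dist z (T \<phi>0) < e \<Longrightarrow> z \<in> U" using U \<phi>0(2) unfolding open_dist by blast
    define \<delta> where "\<delta> = e / (K * real (card J) + 1)"
    have pos: "0 < K * real (card J) + 1" using K by (simp add: add_nonneg_pos)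
    then have \<delta>: "0 < \<delta>" using e by (simp add: \<delta>_def)
    define V where "V is = {g \<in> schwartz. schwartz_seminorm N is (\<lambda>x. g x - \<phi>0 x) < \<delta>}" for "is" :: "'d list"
    have oV: "openin schwartz_topology (V is)" for "is"
      unfolding schwartz_topology_def V_def
      by (rule topology_generated_by_Basis) (use \<delta> Phi_schwartz[OF \<phi>0(1)] in blast)
    \<comment> \<open>\<open>V []\<close> is included because the intersection over an empty \<open>J\<close> is \<open>UNIV\<close>, which is not open here\<close>
    have "openin schwartz_topology (V [] \<inter> (\<Inter>is\<in>J. V is))"
      using J oV by (cases "J = {}") (auto intro!: openin_Int openin_INT2)
    then have "openin (subtopology schwartz_topology Phi) ((V [] \<inter> (\<Inter>is\<in>J. V is)) \<inter> Phi)"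
      by (auto simp: openin_subtopology)
    moreover have "\<phi>0 \<in> (V [] \<inter> (\<Inter>is\<in>J. V is)) \<inter> Phi"
    proof -
      have "partials is (\<lambda>x. 0 :: complex) x = 0" for "is" and x :: "real^'d"
        using partials_cmult[OF schwartz_0, of "is" 0] by (simp add: fun_eq_iff)
      then have "schwartz_seminorm N is (\<lambda>x. \<phi>0 x - \<phi>0 x) = 0" for "is"
        by (simp add: schwartz_seminorm_def)
      then show ?thesis using \<phi>0(1) Phi_schwartz[OF \<phi>0(1)] \<delta> by (simp add: V_def)
    qed
    moreover have "(V [] \<inter> (\<Inter>is\<in>J. V is)) \<inter> Phi \<subseteq> {\<phi> \<in> Phi. T \<phi> \<in> U}"
    proof
      fix \<phi> assume \<phi>: "\<phi> \<in> (V [] \<inter> (\<Inter>is\<in>J. V is)) \<inter> Phi"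
      then have \<phi>P: "\<phi> \<in> Phi" by simp
      have d: "(\<lambda>x. \<phi> x - \<phi>0 x) \<in> Phi" by (rule Phi_diff[OF \<phi>P \<phi>0(1)])
      have "T \<phi> = T (\<lambda>x. \<phi> x - \<phi>0 x) + T \<phi>0" using add[OF d \<phi>0(1)] by simp
      then have "dist (T \<phi>) (T \<phi>0) = norm (T (\<lambda>x. \<phi> x - \<phi>0 x))" by (simp add: dist_norm)
      also have "\<dots> \<le> K * (\<Sum>is\<in>J. schwartz_seminorm N is (\<lambda>x. \<phi> x - \<phi>0 x))" by (rule bd[OF d])
      also have "\<dots> \<le> K * (real (card J) * \<delta>)"
        using \<phi> K by (intro mult_left_mono sum_bounded_above) (auto simp: V_def less_imp_le)
      also have "\<dots> < (K * real (card J) + 1) * \<delta>" using \<delta> by (simp add: algebra_simps)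
      also have "\<dots> = e" using pos by (simp add: \<delta>_def)
      finally show "\<phi> \<in> {\<phi> \<in> Phi. T \<phi> \<in> U}" using e(2) \<phi>P by simp
    qed
    ultimately show "\<exists>W. openin (subtopology schwartz_topology Phi) W \<and> \<phi>0 \<in> W \<and> W \<subseteq> {\<phi> \<in> Phi. T \<phi> \<in> U}"
      by blast
  qed
qed

lemma spectral_in_dual:
  fixes g :: "'d::finite fn"
  assumes g: "tempered g"
  shows "spectral g \<in> dual Phi"
proof -
  have i: "integrable lborel (\<lambda>k. g k * fourier \<phi> (- k))" if "\<phi> \<in> Phi" for \<phi>
    by (rule tempered_integrable[OF g schwartz_reflect[OF fourier_schwartz[OF Phi_schwartz[OF that]]]])
  have add: "spectral g (\<lambda>x. \<phi> x + \<eta> x) = spectral g \<phi> + spectral g \<eta>" if "\<phi> \<in> Phi" "\<eta> \<in> Phi" for \<phi> \<eta>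
  proof -
    have "fourier (\<lambda>x. \<phi> x + \<eta> x) k = fourier \<phi> k + fourier \<eta> k" for k
      by (intro fourier_add schwartz_integrable Phi_schwartz that)
    then show ?thesis
      using that Phi_add[OF that] Bochner_Integration.integral_add[OF i[OF that(1)] i[OF that(2)]]
      by (simp add: spectral_def distrib_left)
  qed
  have cm: "spectral g (\<lambda>x. c * \<phi> x) = c * spectral g \<phi>" if "\<phi> \<in> Phi" for c \<phi>
    using that Phi_cmult[OF that] by (simp add: spectral_def fourier_cmult mult.left_commute[of _ c])
  obtain N C where C: "0 \<le> C" and NC: "\<forall>\<psi> B. \<psi> \<in> borel_measurable borel \<longrightarrow> (\<forall>k. (1 + norm k) ^ N * norm (\<psi> k) \<le> B) \<longrightarrow>
       integrable lborel (\<lambda>k. g k * \<psi> k) \<and> norm (LINT k|lborel. g k * \<psi> k) \<le> C * B"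
    using tempered_bound[OF g] by fast
  obtain K where K: "0 \<le> K"
    "\<And>f k. f \<in> schwartz \<Longrightarrow> (1 + norm k) ^ N * norm (fourier f k) \<le> K * fourier_bound N (f :: 'd fn)"
    using fourier_decay[of N] by blast
  let ?J = "insert [] (range (replicate N :: 'd \<Rightarrow> 'd list))"
  have "continuous_map (subtopology schwartz_topology Phi) euclidean (spectral g)"
  proof (rule continuous_map_Phi[OF add, where J = ?J and K = "C * (K * (1 + real CARD('d)))" and N = "2 * CARD('d)"])
    show "0 \<le> C * (K * (1 + real CARD('d)))" using C K(1) by simp
    fix \<phi> :: "'d fn" assume \<phi>: "\<phi> \<in> Phi"
    note \<phi>s = Phi_schwartz[OF \<phi>]
    let ?p = "\<lambda>is. schwartz_seminorm (2 * CARD('d)) is \<phi>"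
    have p0: "0 \<le> ?p is" for "is" by (rule schwartz_seminorm_nonneg[OF \<phi>s])
    have le: "?p is \<le> (\<Sum>is\<in>?J. ?p is)" if "is \<in> ?J" for "is"
      by (rule member_le_sum[OF that]) (use p0 in auto)
    have "fourier_bound N \<phi> \<le> (\<Sum>is\<in>?J. ?p is) + (\<Sum>i\<in>(UNIV :: 'd set). (\<Sum>is\<in>?J. ?p is))"
      unfolding fourier_bound_def by (intro add_mono sum_mono le) auto
    then have fb: "fourier_bound N \<phi> \<le> (1 + real CARD('d)) * (\<Sum>is\<in>?J. ?p is)" by (simp add: distrib_right)
    have "(1 + norm k) ^ N * norm (fourier \<phi> (- k)) \<le> K * fourier_bound N \<phi>" for k
      using K(2)[OF \<phi>s, of "- k"] by simp
    moreover have "(\<lambda>k. fourier \<phi> (- k)) \<in> borel_measurable borel"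
      by (rule schwartz_measurable[OF schwartz_reflect[OF fourier_schwartz[OF \<phi>s]]])
    ultimately have "norm (LINT k|lborel. g k * fourier \<phi> (- k)) \<le> C * (K * fourier_bound N \<phi>)"
      using NC by simp
    also have "\<dots> \<le> C * (K * ((1 + real CARD('d)) * (\<Sum>is\<in>?J. ?p is)))"
      by (intro mult_left_mono fb C K(1))
    finally show "norm (spectral g \<phi>) \<le> C * (K * (1 + real CARD('d))) * (\<Sum>is\<in>?J. ?p is)"
      using \<phi> by (simp add: spectral_def mult.assoc)
  qed auto
  then show ?thesis unfolding dual_def using add cm by (simp add: spectral_def)
qed

lemma fourier_dual_apply:
  assumes "\<psi> \<in> Psi" shows "fourier_dual T \<psi> = T (fourier \<psi>)"
  using assms by (simp add: fourier_dual_def inv_fourier_reflect[OF Psi_schwartz])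

lemma fourier_dual_spectral: "fourier_dual (spectral g) = as_functional Psi g"
proof
  fix \<psi> :: "'a fn"
  show "fourier_dual (spectral g) \<psi> = as_functional Psi g \<psi>"
  proof (cases "\<psi> \<in> Psi")
    case True
    then show ?thesis
      by (simp add: fourier_dual_apply spectral_def fourier_Psi as_functional_def fourier_fourier[OF Psi_schwartz])
  qed (simp add: fourier_dual_def as_functional_def)
qed

lemma fourier_reflect_fourier:
  fixes \<phi> :: "'d::finite fn"
  assumes "\<phi> \<in> schwartz"
  shows "fourier (\<lambda>k. fourier \<phi> (- k)) = \<phi>"
proof
  fix x
  have "fourier (\<lambda>k. fourier \<phi> (- k)) x = fourier (fourier \<phi>) (- x)"
    by (rule fourier_reflect[OF schwartz_measurable[OF fourier_schwartz[OF assms]]])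
  then show "fourier (\<lambda>k. fourier \<phi> (- k)) x = \<phi> x" by (simp add: fourier_fourier[OF assms])
qed

text \<open>Every \<open>\<phi>\<close> in \<open>Phi\<close> is the transform of an element of \<open>Psi\<close>, and outside \<open>Phi\<close> all elements of the
  dual agree. Together with \<open>fourier_dual_spectral\<close> this identifies \<open>inv_fourier_dual\<close> on densities.\<close>

lemma inj_fourier_dual: "inj_on fourier_dual (dual Phi)"
proof (rule inj_onI, rule ext)
  fix S T :: "'a functional" and \<phi>
  assume S: "S \<in> dual Phi" and T: "T \<in> dual Phi" and eq: "fourier_dual S = fourier_dual T"
  show "S \<phi> = T \<phi>"
  proof (cases "\<phi> \<in> Phi")
    case True
    then have P: "(\<lambda>k. fourier \<phi> (- k)) \<in> Psi" by (intro Psi_reflect fourier_Phi)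
    have "S (fourier (\<lambda>k. fourier \<phi> (- k))) = T (fourier (\<lambda>k. fourier \<phi> (- k)))"
      unfolding fourier_dual_apply[OF P, symmetric] eq ..
    then show ?thesis by (simp only: fourier_reflect_fourier[OF Phi_schwartz[OF True]])
  next
    case False
    then show ?thesis using S T by (simp add: dual_def extensional_def)
  qed
qed

lemma inv_fourier_dual_as_functional:
  "tempered g \<Longrightarrow> inv_fourier_dual (as_functional Psi g) = spectral g"
  unfolding inv_fourier_dual_def fourier_dual_spectral[symmetric]
  by (intro inv_into_f_f inj_fourier_dual spectral_in_dual)

lemma frac_deriv_spectral:
  fixes g :: "'d::finite fn"
  assumes g: "tempered g" and s: "0 \<le> s"
  shows "frac_deriv s (spectral g) = spectral (\<lambda>k. of_real (norm k powr s) * g k)"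
proof -
  have "mult_norm_powr s (as_functional Psi g) = as_functional Psi (\<lambda>k. of_real (norm k powr s) * g k)"
  proof
    fix \<psi> :: "'d fn"
    show "mult_norm_powr s (as_functional Psi g) \<psi> = as_functional Psi (\<lambda>k. of_real (norm k powr s) * g k) \<psi>"
    proof (cases "\<psi> \<in> Psi")
      case True
      then show ?thesis
        by (simp add: mult_norm_powr_def as_functional_def Psi_norm_powr_mult) (simp only: mult_ac)
    qed (simp add: mult_norm_powr_def as_functional_def)
  qed
  then show ?thesis
    unfolding frac_deriv_def fourier_dual_spectral
    by (simp add: inv_fourier_dual_as_functional norm_powr_tempered g s)
qed

lemma spectral_unique:
  fixes f g :: "'d::finite fn"
  assumes f: "tempered f" and g: "tempered g" and eq: "spectral f = spectral g"
  shows "AE k in lborel. f k = g k"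
proof -
  have "AE k in lborel. f k - g k = 0"
  proof (rule Psi_annihilator[OF tempered_diff[OF f g]])
    fix \<psi> :: "'d fn" assume \<psi>: "\<psi> \<in> Psi"
    have "as_functional Psi f \<psi> = as_functional Psi g \<psi>"
      unfolding fourier_dual_spectral[symmetric] eq ..
    then show "(LINT k|lborel. (f k - g k) * \<psi> k) = 0"
      using \<psi> tempered_integrable[OF f Psi_schwartz[OF \<psi>]] tempered_integrable[OF g Psi_schwartz[OF \<psi>]]
      by (simp add: as_functional_def left_diff_distrib)
  qed
  then show ?thesis by simp
qed

section \<open>Square integrable densities\<close>

lemma schwartz_square_integrable:
  fixes f :: "'d::finite fn"
  assumes f: "f \<in> schwartz"
  shows "integrable lborel (\<lambda>x. (norm (f x))\<^sup>2)"
proof -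
  obtain B where B: "\<And>x. norm (f x) \<le> B" using schwartz_bounded[OF f] by blast
  have int: "integrable lborel (\<lambda>x. B * norm (f x))"
    by (intro integrable_mult_right integrable_norm schwartz_integrable f)
  have "norm ((norm (f x))\<^sup>2) \<le> norm (B * norm (f x))" for x
    using mult_right_mono[OF B[of x] norm_ge_zero[of "f x"]] by (simp add: power2_eq_square)
  then show ?thesis
    using schwartz_measurable[OF f] by (intro Bochner_Integration.integrable_bound[OF int] AE_I2) auto
qed

definition L2_sq :: "'d::finite fn \<Rightarrow> real" where
  "L2_sq f = (LINT x|lborel. (norm (f x))\<^sup>2)"

lemma L2_sq_nonneg: "0 \<le> L2_sq f"
  unfolding L2_sq_def by (intro integral_nonneg_AE) auto

text \<open>The density is the \<open>L2\<close> Fourier transform of \<open>u\<close>. The multiplication formula against all Schwartz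
  functions, not only those in \<open>Psi\<close>, is kept for the uniqueness of \<open>u\<close>.\<close>

lemma L2_spectral_density:
  fixes u :: "'d::finite fn"
  assumes u: "u \<in> L2_fun"
  obtains g where "g \<in> L2_fun" "L2_sq g \<le> L2_sq u" "as_functional Phi u = spectral g"
    "\<And>\<psi>. \<psi> \<in> schwartz \<Longrightarrow> (LINT k|lborel. g k * \<psi> k) = (LINT x|lborel. u x * fourier \<psi> x)"
proof -
  obtain g where g: "g \<in> L2_fun" "L2_sq g \<le> L2_sq u"
    and R: "\<And>\<psi>. integrable lborel \<psi> \<Longrightarrow> integrable lborel (\<lambda>x. (norm (\<psi> x))\<^sup>2) \<Longrightarrow>
      (LINT k|lborel. g k * \<psi> k) = (LINT x|lborel. u x * fourier \<psi> x)"
    using fourier_L2_extension[OF u] unfolding L2_sq_def by blast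
  have R': "(LINT k|lborel. g k * \<psi> k) = (LINT x|lborel. u x * fourier \<psi> x)" if "\<psi> \<in> schwartz" for \<psi>
    by (intro R schwartz_integrable schwartz_square_integrable that)
  have "as_functional Phi u = spectral g"
    unfolding as_functional_def spectral_def
  proof (rule restrict_ext)
    fix \<phi> :: "'d fn" assume "\<phi> \<in> Phi"
    then have \<phi>: "\<phi> \<in> schwartz" by (rule Phi_schwartz)
    show "(LINT x|lborel. u x * \<phi> x) = (LINT k|lborel. g k * fourier \<phi> (- k))"
      using R'[OF schwartz_reflect[OF fourier_schwartz[OF \<phi>]]] by (simp add: fourier_reflect_fourier[OF \<phi>])
  qed
  then show thesis using that g R' by blast
qed

lemma L2_fun_reflect:
  fixes g :: "'d::finite fn"
  assumes "g \<in> L2_fun"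
  shows "(\<lambda>k. g (- k)) \<in> L2_fun" "L2_sq (\<lambda>k. g (- k)) = L2_sq g"
proof -
  note [measurable] = L2_fun_measurable[OF assms]
  show "(\<lambda>k. g (- k)) \<in> L2_fun"
    using integrable_lborel_affine[OF L2_fun_integrable[OF assms], of "-1" 0] by (intro L2_fun_I) auto
  show "L2_sq (\<lambda>k. g (- k)) = L2_sq g"
    unfolding L2_sq_def using integral_lborel_reflect[of "\<lambda>k. (norm (g k))\<^sup>2"] by simp
qed

lemma spectral_L2_function:
  fixes g :: "'d::finite fn"
  assumes g: "g \<in> L2_fun"
  obtains u where "u \<in> L2_fun" "L2_sq u \<le> L2_sq g" "as_functional Phi u = spectral g"
proof -
  note [measurable] = L2_fun_measurable[OF g]
  obtain u where u: "u \<in> L2_fun" "L2_sq u \<le> L2_sq g"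
    and R: "\<And>\<psi>. \<psi> \<in> schwartz \<Longrightarrow> (LINT x|lborel. u x * \<psi> x) = (LINT k|lborel. g (- k) * fourier \<psi> k)"
    using L2_spectral_density[OF L2_fun_reflect(1)[OF g]] L2_fun_reflect(2)[OF g] by metis
  have "as_functional Phi u = spectral g"
    unfolding as_functional_def spectral_def
  proof (rule restrict_ext)
    fix \<phi> :: "'d fn" assume "\<phi> \<in> Phi"
    then have \<phi>: "\<phi> \<in> schwartz" by (rule Phi_schwartz)
    note [measurable] = schwartz_measurable[OF fourier_schwartz[OF \<phi>]]
    show "(LINT x|lborel. u x * \<phi> x) = (LINT k|lborel. g k * fourier \<phi> (- k))"
      unfolding R[OF \<phi>] using integral_lborel_reflect[of "\<lambda>k. g k * fourier \<phi> (- k)"] by simp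
  qed
  then show thesis using that u by blast
qed

text \<open>Passing to the density turns the annihilation of \<open>Phi\<close> into that of \<open>Psi\<close>. The density is therefore
  zero, so \<open>u\<close> annihilates all Schwartz functions.\<close>

lemma Phi_annihilator_L2:
  fixes u :: "'d::finite fn"
  assumes u: "u \<in> L2_fun" and z: "as_functional Phi u = as_functional Phi (\<lambda>_. 0)"
  shows "AE x in lborel. u x = 0"
proof -
  obtain g where g: "g \<in> L2_fun" "as_functional Phi u = spectral g"
    and R: "\<And>\<psi>. \<psi> \<in> schwartz \<Longrightarrow> (LINT k|lborel. g k * \<psi> k) = (LINT x|lborel. u x * fourier \<psi> x)"
    using L2_spectral_density[OF u] by metis
  note [measurable] = L2_fun_measurable[OF g(1)]
  have "spectral g = spectral (\<lambda>_. 0)"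
    using g(2) z by (simp add: as_functional_def spectral_def)
  then have g0: "AE k in lborel. g k = 0"
    by (rule spectral_unique[OF L2_tempered[OF g(1)] L1_tempered, rotated]) simp
  show ?thesis
  proof (rule Psi_annihilator[OF L2_tempered[OF u]])
    fix \<psi> :: "'d fn" assume "\<psi> \<in> Psi"
    then have \<psi>: "\<psi> \<in> schwartz" by (rule Psi_schwartz)
    have s: "(\<lambda>k. fourier \<psi> (- k)) \<in> schwartz" by (intro schwartz_reflect fourier_schwartz \<psi>)
    note [measurable] = schwartz_measurable[OF s]
    have "(LINT x|lborel. u x * \<psi> x) = (LINT k|lborel. g k * fourier \<psi> (- k))"
      unfolding R[OF s] fourier_reflect_fourier[OF \<psi>] ..
    also have "\<dots> = (LINT k|(lborel :: (real^'d) measure). 0 :: complex)"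
      by (rule integral_cong_AE) (use g0 in auto)
    finally show "(LINT x|lborel. u x * \<psi> x) = 0" by simp
  qed
qed

lemma L2_fun_diff:
  fixes u v :: "'d::finite fn"
  assumes u: "u \<in> L2_fun" and v: "v \<in> L2_fun"
  shows "(\<lambda>x. u x - v x) \<in> L2_fun"
proof (rule L2_fun_I)
  note [measurable] = L2_fun_measurable[OF u] L2_fun_measurable[OF v]
  show "(\<lambda>x. u x - v x) \<in> borel_measurable borel" by measurable
  have "integrable lborel (\<lambda>x. 2 * (norm (u x))\<^sup>2 + 2 * (norm (v x))\<^sup>2)"
    using L2_fun_integrable[OF u] L2_fun_integrable[OF v] by simp
  then show "integrable lborel (\<lambda>x. (norm (u x - v x))\<^sup>2)"
  proof (rule Bochner_Integration.integrable_bound)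
    show "AE x in lborel. norm ((norm (u x - v x))\<^sup>2) \<le> norm (2 * (norm (u x))\<^sup>2 + 2 * (norm (v x))\<^sup>2)"
    proof (intro AE_I2)
      fix x
      have "(norm (u x - v x))\<^sup>2 \<le> (norm (u x) + norm (v x))\<^sup>2"
        by (intro power_mono norm_triangle_ineq4) auto
      also have "\<dots> \<le> 2 * (norm (u x))\<^sup>2 + 2 * (norm (v x))\<^sup>2"
        using zero_le_power2[of "norm (u x) - norm (v x)"] unfolding power2_sum power2_diff by linarith
      finally show "norm ((norm (u x - v x))\<^sup>2) \<le> norm (2 * (norm (u x))\<^sup>2 + 2 * (norm (v x))\<^sup>2)" by simp
    qed
  qed simp
qed

lemma L2_sq_cong_AE:
  assumes "u \<in> borel_measurable borel" "v \<in> borel_measurable borel" "AE x in lborel. u x = v x"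
  shows "L2_sq u = L2_sq v"
  unfolding L2_sq_def by (rule integral_cong_AE) (use assms in auto)

text \<open>Plancherel. The passages from \<open>u\<close> to \<open>g\<close> and from \<open>g\<close> to \<open>u\<close> both do not increase the norm, and by the
  uniqueness results the representative selected by \<open>inv_into\<close> agrees with \<open>u\<close>.\<close>

lemma L2_norm_spectral:
  fixes g :: "'d::finite fn"
  assumes g: "g \<in> L2_fun"
  shows "spectral g \<in> L2" "L2_norm (spectral g) = sqrt (L2_sq g)"
proof -
  obtain u where u: "u \<in> L2_fun" "L2_sq u \<le> L2_sq g" "as_functional Phi u = spectral g"
    using spectral_L2_function[OF g] by blast
  then show mem: "spectral g \<in> L2" unfolding L2_def by (metis imageI)
  define v where "v = inv_into L2_fun (as_functional Phi) (spectral g)"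
  have v: "v \<in> L2_fun" "as_functional Phi v = spectral g"
    using inv_into_into[OF mem[unfolded L2_def]] f_inv_into_f[OF mem[unfolded L2_def]] unfolding v_def .
  have uv: "L2_sq v = L2_sq u"
  proof -
    have "as_functional Phi (\<lambda>x. v x - u x) = as_functional Phi (\<lambda>_. 0)"
      unfolding as_functional_def
    proof (rule restrict_ext)
      fix \<phi> :: "'d fn" assume \<phi>: "\<phi> \<in> Phi"
      have "as_functional Phi v \<phi> = as_functional Phi u \<phi>" using v(2) u(3) by simp
      then show "(LINT x|lborel. (v x - u x) * \<phi> x) = (LINT x|lborel. 0 * \<phi> x)"
        using \<phi> tempered_integrable[OF L2_tempered[OF v(1)] Phi_schwartz[OF \<phi>]]
          tempered_integrable[OF L2_tempered[OF u(1)] Phi_schwartz[OF \<phi>]]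
        by (simp add: as_functional_def left_diff_distrib)
    qed
    from Phi_annihilator_L2[OF L2_fun_diff[OF v(1) u(1)] this]
    show ?thesis
      by (intro L2_sq_cong_AE L2_fun_measurable u v) auto
  qed
  obtain g' where g': "g' \<in> L2_fun" "L2_sq g' \<le> L2_sq v" "as_functional Phi v = spectral g'"
    using L2_spectral_density[OF v(1)] by metis
  have "L2_sq g' = L2_sq g"
    by (intro L2_sq_cong_AE L2_fun_measurable g g'(1) spectral_unique L2_tempered)
      (use v(2) g'(3) in simp)
  then have "L2_sq v = L2_sq g" using uv u(2) g'(2) by simp
  then show "L2_norm (spectral g) = sqrt (L2_sq g)"
    unfolding L2_norm_def v_def[symmetric] L2_sq_def by simp
qed

lemma L2_obtain_density:
  assumes "T \<in> L2"
  obtains g where "g \<in> L2_fun" "T = spectral g"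
  using assms L2_spectral_density unfolding L2_def by (metis imageE)

lemma spectral_in_L2_D:
  assumes g: "tempered g" and L: "spectral g \<in> L2"
  shows "g \<in> L2_fun"
proof -
  note [measurable] = tempered_measurable[OF g]
  obtain h where h: "h \<in> L2_fun" "spectral g = spectral h" using L2_obtain_density[OF L] by metis
  note [measurable] = L2_fun_measurable[OF h(1)]
  have "AE k in lborel. g k = h k" by (rule spectral_unique[OF g L2_tempered[OF h(1)] h(2)])
  then have "integrable lborel (\<lambda>k. (norm (g k))\<^sup>2) \<longleftrightarrow> integrable lborel (\<lambda>k. (norm (h k))\<^sup>2)"
    by (intro integrable_cong_AE) auto
  then show ?thesis using L2_fun_integrable[OF h(1)] by (intro L2_fun_I) auto
qed

lemma H_iff_density:
  assumes n: "0 \<le> n"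
  shows "f \<in> H n \<longleftrightarrow> (\<exists>g. g \<in> L2_fun \<and> (\<lambda>k. of_real (norm k powr n) * g k) \<in> L2_fun \<and> f = spectral g)"
proof
  assume f: "f \<in> H n"
  then obtain g where g: "g \<in> L2_fun" "f = spectral g" using L2_obtain_density by (auto simp: H_def)
  note t = L2_tempered[OF g(1)]
  have "spectral (\<lambda>k. of_real (norm k powr n) * g k) \<in> L2"
    using f by (simp add: H_def g(2) frac_deriv_spectral[OF t n])
  from spectral_in_L2_D[OF norm_powr_tempered[OF t n] this] g
  show "\<exists>g. g \<in> L2_fun \<and> (\<lambda>k. of_real (norm k powr n) * g k) \<in> L2_fun \<and> f = spectral g" by blast
next
  assume "\<exists>g. g \<in> L2_fun \<and> (\<lambda>k. of_real (norm k powr n) * g k) \<in> L2_fun \<and> f = spectral g"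
  then obtain g where g: "g \<in> L2_fun" "(\<lambda>k. of_real (norm k powr n) * g k) \<in> L2_fun" "f = spectral g" by blast
  then show "f \<in> H n"
    by (simp add: H_def L2_norm_spectral(1) frac_deriv_spectral[OF L2_tempered[OF g(1)] n])
qed

section \<open>Integrable densities\<close>

lemma fourier_L1_C0:
  assumes g: "integrable lborel g"
  shows "(\<lambda>x. fourier g (- x)) \<in> (C0_fun :: 'd::finite fn set)"
proof -
  have "continuous_on UNIV (\<lambda>x. fourier g (- x))"
    by (rule continuous_on_compose2[OF continuous_fourier[OF g]]) (auto intro: continuous_intros)
  moreover have "filterlim (\<lambda>x::real^'d. - x) at_infinity at_infinity"
    by (rule filterlim_norm_at_top_imp_at_infinity) (simp add: filterlim_norm_at_top)
  from filterlim_compose[OF riemann_lebesgue[OF g] this]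
  have "((\<lambda>x. fourier g (- x)) \<longlongrightarrow> 0) at_infinity" .
  ultimately show ?thesis by (simp add: C0_fun_def)
qed

text \<open>The reflected transform of an integrable density is the inverse transform, and it represents the same
  functional by the multiplication formula.\<close>

lemma as_functional_fourier_L1:
  fixes g :: "'d::finite fn"
  assumes g: "integrable lborel g"
  shows "as_functional Phi (\<lambda>x. fourier g (- x)) = spectral g"
  unfolding as_functional_def spectral_def
proof (rule restrict_ext)
  fix \<phi> :: "'d fn" assume "\<phi> \<in> Phi"
  then have \<phi>: "\<phi> \<in> schwartz" by (rule Phi_schwartz)
  note [measurable] = schwartz_measurable[OF \<phi>]
  have [measurable]: "g \<in> borel_measurable borel" using g by auto
  have "(LINT x|lborel. fourier g (- x) * \<phi> x) = (LINT x|lborel. fourier g x * \<phi> (- x))"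
    using integral_lborel_reflect[of "\<lambda>x. fourier g x * \<phi> (- x)"] by simp
  also have "\<dots> = (LINT k|lborel. g k * fourier (\<lambda>x. \<phi> (- x)) k)"
    by (rule fourier_multiplication[OF g schwartz_integrable[OF schwartz_reflect[OF \<phi>]]])
  finally show "(LINT x|lborel. fourier g (- x) * \<phi> x) = (LINT k|lborel. g k * fourier \<phi> (- k))"
    by (simp add: fourier_reflect)
qed

lemma C0_Phi_integrable:
  assumes h: "h \<in> (C0_fun :: 'd::finite fn set)" and \<phi>: "\<phi> \<in> schwartz"
  shows "integrable lborel (\<lambda>x. h x * \<phi> x)"
proof -
  obtain B where "\<And>x. norm (h x) \<le> B" using C0_fun_bounded[OF h] by blast
  then show ?thesis by (intro integrable_mult_bounded[OF schwartz_integrable[OF \<phi>]]) (use C0_fun_measurable[OF h] in auto)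
qed

lemma inj_as_functional_C0: "inj_on (as_functional Phi) (C0_fun :: 'd::finite fn set)"
proof (rule inj_onI, rule ext)
  fix h l :: "'d fn" and x
  assume h: "h \<in> C0_fun" and l: "l \<in> C0_fun" and eq: "as_functional Phi h = as_functional Phi l"
  have "h x - l x = 0"
  proof (rule C0_Phi_annihilator[of "\<lambda>x. h x - l x"])
    show "(\<lambda>x. h x - l x) \<in> C0_fun"
      using h l tendsto_diff[of h 0 at_infinity l 0] by (auto simp: C0_fun_def intro: continuous_on_diff)
    fix \<phi> :: "'d fn" assume \<phi>: "\<phi> \<in> Phi"
    have "as_functional Phi h \<phi> = as_functional Phi l \<phi>" using eq by simp
    then show "(LINT x|lborel. (h x - l x) * \<phi> x) = 0"
      using \<phi> C0_Phi_integrable[OF h Phi_schwartz[OF \<phi>]] C0_Phi_integrable[OF l Phi_schwartz[OF \<phi>]]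
      by (simp add: as_functional_def left_diff_distrib)
  qed
  then show "h x = l x" by simp
qed

lemma Linf_norm_spectral:
  fixes g :: "'d::finite fn"
  assumes g: "integrable lborel g"
  shows "spectral g \<in> Linf" "Linf_norm (spectral g) = (SUP x. norm (fourier g (- x)))"
proof -
  have C: "(\<lambda>x. fourier g (- x)) \<in> C0_fun" by (rule fourier_L1_C0[OF g])
  show "spectral g \<in> Linf"
    unfolding Linf_def as_functional_fourier_L1[OF g, symmetric] by (rule imageI[OF C])
  have "inv_into C0_fun (as_functional Phi) (spectral g) = (\<lambda>x. fourier g (- x))"
    by (intro inv_into_f_eq inj_as_functional_C0 C as_functional_fourier_L1 g)
  then show "Linf_norm (spectral g) = (SUP x. norm (fourier g (- x)))" by (simp add: Linf_norm_def)
qed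

section \<open>The radial integral\<close>

lemma nn_integral_reflect_real:
  fixes f :: "real \<Rightarrow> ennreal"
  assumes "f \<in> borel_measurable borel"
  shows "(\<integral>\<^sup>+v. f v \<partial>lborel) = (\<integral>\<^sup>+v. f (- v) \<partial>lborel)"
  using nn_integral_real_affine[OF assms, of "-1" 0] by simp

text \<open>The volume of balls determines the law of \<open>|k|^q\<close> under Lebesgue measure. The minus sign makes the
  measure of every half-line \<open>{x<..}\<close> finite, so that these half-lines determine the measure.\<close>

lemma distr_norm_powr:
  fixes q :: real
  assumes q: "0 < q"
  defines "a \<equiv> real CARD('d::finite) / q"
  defines "c \<equiv> unit_ball_vol (real CARD('d)) * a"
  shows "distr lborel borel (\<lambda>k::real^'d. - (norm k powr q))
    = density lborel (\<lambda>v. ennreal (indicator {..<0} v * (c * (- v) powr (a - 1))))" (is "?M = ?N")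
proof (rule measure_eqI_lessThan)
  have a: "0 < a" unfolding a_def using q by simp
  have c: "0 \<le> c" unfolding c_def using a by simp
  have M: "emeasure ?M {x<..} = ennreal (if x < 0 then unit_ball_vol (real CARD('d)) * (- x) powr a else 0)" for x
  proof -
    have "emeasure ?M {x<..} = emeasure lborel {k::real^'d. norm k powr q < - x}"
      by (subst emeasure_distr) (auto intro!: arg_cong[where f = "emeasure lborel"])
    also have "\<dots> = ennreal (if x < 0 then unit_ball_vol (real CARD('d)) * (- x) powr a else 0)"
    proof (cases "x < 0")
      case False
      have "\<not> norm k powr q < - x" for k :: "real^'d" using False powr_ge_zero[of "norm k" q] by linarith
      then have "{k::real^'d. norm k powr q < - x} = {}" by blast
      then show ?thesis using False by simp
    next
      case True
      let ?r = "(- x) powr (1 / q)"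
      have r: "?r powr q = - x" using True q by (simp add: powr_powr)
      have less_iff: "norm k powr q < - x \<longleftrightarrow> norm k < ?r" for k :: "real^'d"
      proof
        assume lt: "norm k powr q < - x"
        show "norm k < ?r"
        proof (rule ccontr)
          assume "\<not> norm k < ?r"
          then have "?r powr q \<le> norm k powr q" using q by (intro powr_mono2) auto
          then show False using lt unfolding r by linarith
        qed
      next
        assume "norm k < ?r"
        from powr_less_mono2[OF q norm_ge_zero this] show "norm k powr q < - x" unfolding r .
      qed
      have "{k::real^'d. norm k powr q < - x} = ball 0 ?r"
        by (simp only: less_iff set_eq_iff mem_ball_0 mem_Collect_eq simp_thms)
      moreover have "?r ^ CARD('d) = (- x) powr a"
      proof -
        have "?r ^ CARD('d) = ?r powr real CARD('d)" using True by (intro powr_realpow[symmetric]) simp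
        then show ?thesis by (simp add: powr_powr a_def)
      qed
      ultimately show ?thesis using True emeasure_ball[of ?r "0::real^'d"] by simp
    qed
    finally show ?thesis .
  qed
  show "emeasure ?M {x<..} < \<infinity>" for x unfolding M by simp
  show "emeasure ?M {x<..} = emeasure ?N {x<..}" for x
  proof (cases "x < 0")
    case False
    have "emeasure ?N {x<..} = (\<integral>\<^sup>+v. ennreal (indicator {..<0} v * (c * (- v) powr (a - 1))) * indicator {x<..} v \<partial>lborel)"
      by (subst emeasure_density) auto
    also have "\<dots> = (\<integral>\<^sup>+v. 0 \<partial>(lborel :: real measure))"
      by (rule nn_integral_cong) (use False in \<open>auto simp: indicator_def\<close>)
    finally have "emeasure ?N {x<..} = 0" by simp
    then show ?thesis using False by (simp add: M)
  next
    case True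
    have "((\<lambda>v. v powr (a - 1)) has_integral ((- x) powr (a - 1 + 1) / (a - 1 + 1))) {0..- x}"
      by (rule has_integral_powr_from_0) (use a True in auto)
    from has_integral_mult_right[OF this, of c]
    have I: "((\<lambda>v. c * v powr (a - 1)) has_integral (c * ((- x) powr a / a))) {0..- x}" by simp
    have "emeasure ?N {x<..} = (\<integral>\<^sup>+v. ennreal (indicator {..<0} v * (c * (- v) powr (a - 1))) * indicator {x<..} v \<partial>lborel)"
      by (subst emeasure_density) auto
    also have "\<dots> = (\<integral>\<^sup>+v. ennreal (indicator {..<0} (- v) * (c * v powr (a - 1))) * indicator {x<..} (- v) \<partial>lborel)"
      by (subst nn_integral_reflect_real) auto
    also have "\<dots> = (\<integral>\<^sup>+v. ennreal (indicator {0..- x} v * (c * v powr (a - 1))) \<partial>lborel)"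
    proof (rule nn_integral_cong_AE)
      show "AE v in lborel. ennreal (indicator {..<0} (- v) * (c * v powr (a - 1))) * indicator {x<..} (- v)
          = ennreal (indicator {0..- x} v * (c * v powr (a - 1)))"
        using AE_lborel_singleton[of "- x"]
        by eventually_elim (auto simp: indicator_def)
    qed
    also have "\<dots> = ennreal (c * ((- x) powr a / a))"
      using nn_integral_has_integral_lebesgue[OF _ I] c by simp
    also have "c * ((- x) powr a / a) = unit_ball_vol (real CARD('d)) * (- x) powr a"
      using a by (simp add: c_def)
    finally show ?thesis using True by (simp add: M)
  qed
qed simp_all

lemma nn_integral_norm_powr:
  fixes q :: real and F :: "real \<Rightarrow> ennreal"
  assumes q: "0 < q" and [measurable]: "F \<in> borel_measurable borel"
  defines "a \<equiv> real CARD('d::finite) / q"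
  shows "(\<integral>\<^sup>+k. F (norm (k::real^'d) powr q) \<partial>lborel)
    = (\<integral>\<^sup>+v. ennreal (indicator {0<..} v * (unit_ball_vol (real CARD('d)) * a * v powr (a - 1))) * F v \<partial>lborel)"
proof -
  let ?c = "unit_ball_vol (real CARD('d)) * a"
  have "(\<integral>\<^sup>+k. F (norm (k::real^'d) powr q) \<partial>lborel) = (\<integral>\<^sup>+v. F (- v) \<partial>distr lborel borel (\<lambda>k::real^'d. - (norm k powr q)))"
    by (subst nn_integral_distr) auto
  also have "\<dots> = (\<integral>\<^sup>+v. ennreal (indicator {..<0} v * (?c * (- v) powr (a - 1))) * F (- v) \<partial>lborel)"
    unfolding distr_norm_powr[OF q, where 'd='d] a_def by (subst nn_integral_density) auto
  also have "\<dots> = (\<integral>\<^sup>+v. ennreal (indicator {0<..} v * (?c * v powr (a - 1))) * F v \<partial>lborel)"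
    by (subst nn_integral_reflect_real) (auto intro!: nn_integral_cong simp: indicator_def)
  finally show ?thesis .
qed

lemma nn_integral_Gamma_scaled:
  assumes s: "0 < s" and c: "0 < c"
  shows "(\<integral>\<^sup>+t. ennreal (indicator {0..} t * t powr (s - 1) * exp (- (c * t))) \<partial>lborel) = ennreal (Gamma s * c powr (- s))"
proof -
  let ?f = "\<lambda>t. ennreal (indicator {0..} t * t powr (s - 1) * exp (- t))"
  have "ennreal (Gamma s) = (\<integral>\<^sup>+t. ?f t \<partial>lborel)"
    using Gamma_conv_nn_integral_real[OF s] by (simp add: exp_minus divide_inverse)
  also have "\<dots> = ennreal c * (\<integral>\<^sup>+t. ?f (c * t) \<partial>lborel)"
    using nn_integral_real_affine[of ?f c 0] c by simp
  also have "(\<integral>\<^sup>+t. ?f (c * t) \<partial>lborel) = (\<integral>\<^sup>+t. ennreal (c powr (s - 1)) * ennreal (indicator {0..} t * t powr (s - 1) * exp (- (c * t))) \<partial>lborel)"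
    using c by (intro nn_integral_cong) (auto simp: indicator_def zero_le_mult_iff powr_mult simp flip: ennreal_mult)
  also have "\<dots> = ennreal (c powr (s - 1)) * (\<integral>\<^sup>+t. ennreal (indicator {0..} t * t powr (s - 1) * exp (- (c * t))) \<partial>lborel)"
    by (rule nn_integral_cmult) measurable
  also have "ennreal c * \<dots> = ennreal (c powr s) * (\<integral>\<^sup>+t. ennreal (indicator {0..} t * t powr (s - 1) * exp (- (c * t))) \<partial>lborel)"
  proof -
    have "c * c powr (s - 1) = c powr s" using c by (simp add: powr_mult_base)
    then show ?thesis using c by (simp add: mult.assoc[symmetric] flip: ennreal_mult)
  qed
  finally have *: "ennreal (Gamma s) = ennreal (c powr s) * (\<integral>\<^sup>+t. ennreal (indicator {0..} t * t powr (s - 1) * exp (- (c * t))) \<partial>lborel)" .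
  have "ennreal (c powr (- s)) * ennreal (c powr s) = 1"
    using c by (simp flip: ennreal_mult powr_add)
  then have "ennreal (c powr (- s)) * ennreal (Gamma s) = (\<integral>\<^sup>+t. ennreal (indicator {0..} t * t powr (s - 1) * exp (- (c * t))) \<partial>lborel)"
    unfolding * by (simp add: mult.assoc[symmetric])
  then show ?thesis using Gamma_real_pos[OF s] by (simp add: ennreal_mult mult.commute)
qed

lemma Gamma_reflection_real:
  assumes x: "0 < x" "x < (1::real)"
  shows "Gamma x * Gamma (1 - x) = pi / sin (pi * x)"
proof -
  have "Gamma (1 - complex_of_real x) = of_real (Gamma (1 - x))"
    by (simp flip: Gamma_complex_of_real)
  then have "complex_of_real (Gamma x * Gamma (1 - x)) = of_real (pi / sin (pi * x))"
    using Gamma_reflection_complex[of "of_real x"]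
    by (simp add: Gamma_complex_of_real sin_of_real flip: of_real_mult)
  then show ?thesis by (simp only: of_real_eq_iff)
qed

text \<open>Writing \<open>1 / (1 + l v)\<close> as the Laplace transform \<open>\<integral> exp (- (1 + l v) t) dt\<close> and exchanging the
  integrals produces \<open>Gamma \<theta> * Gamma (1 - \<theta>)\<close>.\<close>

lemma nn_integral_powr_over_linear:
  assumes \<theta>: "0 < \<theta>" "\<theta> < 1" and l: "0 < l"
  shows "(\<integral>\<^sup>+v. ennreal (indicator {0<..} v * (v powr (\<theta> - 1) / (1 + l * v))) \<partial>lborel)
    = ennreal (l powr (- \<theta>) * (pi / sin (pi * \<theta>)))"
proof -
  let ?h = "\<lambda>v t. ennreal (indicator {0..} v * v powr (\<theta> - 1) * (indicator {0..} t * t powr (1 - 1) * exp (- ((1 + l * v) * t))))"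
  have "(\<integral>\<^sup>+v. ennreal (indicator {0<..} v * (v powr (\<theta> - 1) / (1 + l * v))) \<partial>lborel) = (\<integral>\<^sup>+v. \<integral>\<^sup>+t. ?h v t \<partial>lborel \<partial>lborel)"
  proof (rule nn_integral_cong)
    fix v :: real
    show "ennreal (indicator {0<..} v * (v powr (\<theta> - 1) / (1 + l * v))) = (\<integral>\<^sup>+t. ?h v t \<partial>lborel)"
    proof (cases "0 < v")
      case True
      then have p: "0 < 1 + l * v" using l by (simp add: add_pos_pos)
      have "(\<integral>\<^sup>+t. ?h v t \<partial>lborel) = (\<integral>\<^sup>+t. ennreal (v powr (\<theta> - 1)) * ennreal (indicator {0..} t * t powr (1 - 1) * exp (- ((1 + l * v) * t))) \<partial>lborel)"
        using True by (intro nn_integral_cong) (simp flip: ennreal_mult)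
      also have "\<dots> = ennreal (v powr (\<theta> - 1)) * ennreal (Gamma 1 * (1 + l * v) powr (- 1))"
        by (subst nn_integral_cmult, measurable) (subst nn_integral_Gamma_scaled[OF zero_less_one p], rule refl)
      finally show ?thesis using True p by (simp add: powr_minus_divide flip: ennreal_mult)
    next
      case False
      then show ?thesis by (cases "v = 0") auto
    qed
  qed
  also have "\<dots> = (\<integral>\<^sup>+t. \<integral>\<^sup>+v. ?h v t \<partial>lborel \<partial>lborel)"
    by (rule lborel_pair.Fubini') measurable
  also have "\<dots> = (\<integral>\<^sup>+t. ennreal (Gamma \<theta> * l powr (- \<theta>)) * ennreal (indicator {0..} t * t powr ((1 - \<theta>) - 1) * exp (- (1 * t))) \<partial>lborel)"
  proof (rule nn_integral_cong)
    fix t :: real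
    show "(\<integral>\<^sup>+v. ?h v t \<partial>lborel) = ennreal (Gamma \<theta> * l powr (- \<theta>)) * ennreal (indicator {0..} t * t powr ((1 - \<theta>) - 1) * exp (- (1 * t)))"
    proof (cases "0 < t")
      case True
      have "(\<integral>\<^sup>+v. ?h v t \<partial>lborel) = (\<integral>\<^sup>+v. ennreal (exp (- t)) * ennreal (indicator {0..} v * v powr (\<theta> - 1) * exp (- ((l * t) * v))) \<partial>lborel)"
        using True by (intro nn_integral_cong) (simp add: algebra_simps exp_add exp_diff exp_minus divide_inverse flip: ennreal_mult)
      also have "\<dots> = ennreal (exp (- t)) * ennreal (Gamma \<theta> * (l * t) powr (- \<theta>))"
        using nn_integral_Gamma_scaled[OF \<theta>(1), of "l * t"] l True by (subst nn_integral_cmult) auto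
      finally show ?thesis
        using True l Gamma_real_pos[OF \<theta>(1)] by (simp add: powr_mult mult_ac flip: ennreal_mult)
    next
      case False
      then show ?thesis by (cases "t = 0") auto
    qed
  qed
  also have "\<dots> = ennreal (Gamma \<theta> * l powr (- \<theta>)) * ennreal (Gamma (1 - \<theta>) * 1 powr (- (1 - \<theta>)))"
  proof -
    have "0 < 1 - \<theta>" using \<theta> by simp
    from nn_integral_Gamma_scaled[OF this zero_less_one] show ?thesis by (subst nn_integral_cmult) auto
  qed
  also have "\<dots> = ennreal (l powr (- \<theta>) * (Gamma \<theta> * Gamma (1 - \<theta>)))"
    using Gamma_real_pos[OF \<theta>(1)] Gamma_real_pos[of "1 - \<theta>"] \<theta> by (simp add: mult_ac flip: ennreal_mult)
  finally show ?thesis unfolding Gamma_reflection_real[OF \<theta>] .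
qed

text \<open>The integral of \<open>|k|^(2j) / (1 + |k|^(2n))\<close>; it depends on \<open>j\<close> only through \<open>\<theta>\<close>.\<close>

definition radial_const :: "'d::finite itself \<Rightarrow> real \<Rightarrow> real \<Rightarrow> real" where
  "radial_const _ n \<theta> = pi powr (real CARD('d) / 2 + 1) / (n * Gamma (real CARD('d) / 2) * sin (pi * \<theta>))"

lemma radial_integral:
  fixes n j \<theta> l :: real
  assumes n: "0 < n" and j: "0 \<le> j" and \<theta>: "\<theta> = j / n + real CARD('d::finite) / (2 * n)" "\<theta> < 1" and l: "0 < l"
  shows "integrable lborel (\<lambda>k::real^'d. norm k powr (2 * j) / (1 + l * norm k powr (2 * n)))"
    and "(LINT k|lborel. norm (k::real^'d) powr (2 * j) / (1 + l * norm k powr (2 * n))) = l powr (- \<theta>) * radial_const TYPE('d) n \<theta>"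
    and "0 < radial_const TYPE('d) n \<theta>" and "0 < \<theta>"
proof -
  let ?d = "real CARD('d)"
  let ?a = "?d / (2 * n)"
  let ?c = "unit_ball_vol ?d * ?a"
  have d: "0 < ?d" by simp
  have a: "0 < ?a" using n by simp
  show \<theta>0: "0 < \<theta>" unfolding \<theta>(1) using n j a by (intro add_nonneg_pos) auto
  have c0: "0 \<le> ?c" using a by (intro mult_nonneg_nonneg) auto
  have sin: "0 < sin (pi * \<theta>)" using \<theta>0 \<theta>(2) by (intro sin_gt_zero) auto
  have c: "?c * (pi / sin (pi * \<theta>)) = radial_const TYPE('d) n \<theta>"
  proof -
    have "Gamma (?d / 2 + 1) = ?d / 2 * Gamma (?d / 2)"
      by (rule Gamma_plus1) (use d nonpos_Ints_nonpos[of "?d / 2"] in auto)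
    then have "unit_ball_vol ?d = pi powr (?d / 2) / (?d / 2 * Gamma (?d / 2))" by (simp only: unit_ball_vol_def)
    then have "?c = pi powr (?d / 2) / (n * Gamma (?d / 2))" using d n by (simp add: field_simps)
    then show ?thesis by (simp add: radial_const_def powr_add)
  qed
  show pos: "0 < radial_const TYPE('d) n \<theta>"
    unfolding radial_const_def using n sin Gamma_real_pos[of "?d / 2"] d by (intro divide_pos_pos mult_pos_pos) auto
  let ?f = "\<lambda>k::real^'d. norm k powr (2 * j) / (1 + l * norm k powr (2 * n))"
  let ?F = "\<lambda>v. ennreal (v powr (j / n) / (1 + l * v))"
  have f0: "0 \<le> ?f k" for k using l by (intro divide_nonneg_nonneg add_nonneg_nonneg mult_nonneg_nonneg) auto
  have "(\<integral>\<^sup>+k. ennreal (?f k) \<partial>lborel) = (\<integral>\<^sup>+k. ?F (norm (k::real^'d) powr (2 * n)) \<partial>lborel)"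
    using n by (intro nn_integral_cong) (simp add: powr_powr)
  also have "\<dots> = (\<integral>\<^sup>+v. ennreal (indicator {0<..} v * (?c * v powr (?a - 1))) * ?F v \<partial>lborel)"
    by (rule nn_integral_norm_powr) (use n in auto)
  also have "\<dots> = (\<integral>\<^sup>+v. ennreal ?c * ennreal (indicator {0<..} v * (v powr (\<theta> - 1) / (1 + l * v))) \<partial>lborel)"
  proof (rule nn_integral_cong)
    fix v :: real
    show "ennreal (indicator {0<..} v * (?c * v powr (?a - 1))) * ?F v = ennreal ?c * ennreal (indicator {0<..} v * (v powr (\<theta> - 1) / (1 + l * v)))"
    proof (cases "0 < v")
      case True
      have "v powr (?a - 1) * v powr (j / n) = v powr (\<theta> - 1)"
        unfolding \<theta>(1) powr_add[symmetric] by (simp add: algebra_simps)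
      then have "?c * v powr (?a - 1) * (v powr (j / n) / (1 + l * v)) = ?c * (v powr (\<theta> - 1) / (1 + l * v))"
        by (metis mult.assoc times_divide_eq_right)
      moreover note c0
      moreover have "0 \<le> v powr (j / n) / (1 + l * v)" "0 \<le> v powr (\<theta> - 1) / (1 + l * v)"
        using True l by (auto intro!: divide_nonneg_nonneg add_nonneg_nonneg)
      ultimately show ?thesis using True
        by (simp only: indicator_simps greaterThan_iff mult_1_left ennreal_mult[symmetric] mult_nonneg_nonneg powr_ge_zero)
    qed simp
  qed
  also have "\<dots> = ennreal ?c * ennreal (l powr (- \<theta>) * (pi / sin (pi * \<theta>)))"
    using nn_integral_powr_over_linear[OF \<theta>0 \<theta>(2) l] by (subst nn_integral_cmult) auto
  also have "\<dots> = ennreal (?c * (l powr (- \<theta>) * (pi / sin (pi * \<theta>))))"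
    by (rule ennreal_mult[symmetric]) (use c0 sin in \<open>simp_all add: less_imp_le\<close>)
  also have "?c * (l powr (- \<theta>) * (pi / sin (pi * \<theta>))) = l powr (- \<theta>) * radial_const TYPE('d) n \<theta>"
    unfolding c[symmetric] by (rule mult.left_commute)
  finally have I: "(\<integral>\<^sup>+k. ennreal (?f k) \<partial>lborel) = ennreal (l powr (- \<theta>) * radial_const TYPE('d) n \<theta>)" .
  show int: "integrable lborel ?f"
    by (rule integrableI_nn_integral_finite[OF _ _ I]) (use f0 in auto)
  have "ennreal (LINT k|lborel. ?f k) = ennreal (l powr (- \<theta>) * radial_const TYPE('d) n \<theta>)"
    using nn_integral_eq_integral[OF int] f0 I by simp
  then show "(LINT k|lborel. ?f k) = l powr (- \<theta>) * radial_const TYPE('d) n \<theta>"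
    using pos f0 by (subst (asm) ennreal_inj) (auto intro!: integral_nonneg_AE)
qed

section \<open>The sharp inequalities\<close>

text \<open>Cauchy-Schwarz for the factors \<open>|k|^j / sqrt (1 + l |k|^(2n))\<close> and \<open>sqrt (1 + l |k|^(2n)) g\<close>.\<close>

lemma weighted_L1_bound:
  fixes g :: "'d::finite fn" and n j \<theta> l :: real
  assumes n: "0 < n" and j: "0 \<le> j" and \<theta>: "\<theta> = j / n + real CARD('d) / (2 * n)" "\<theta> < 1" and l: "0 < l"
    and g: "g \<in> L2_fun" and ng: "(\<lambda>k. of_real (norm k powr n) * g k) \<in> L2_fun"
  shows "integrable lborel (\<lambda>k. of_real (norm k powr j) * g k)"
    and "(LINT k|lborel. norm (of_real (norm k powr j) * g k))\<^sup>2
      \<le> l powr (- \<theta>) * radial_const TYPE('d) n \<theta> * (L2_sq g + l * L2_sq (\<lambda>k. of_real (norm k powr n) * g k))"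
proof -
  note [measurable] = L2_fun_measurable[OF g]
  let ?w = "\<lambda>k::real^'d. 1 + l * norm k powr (2 * n)"
  have w: "0 < ?w k" for k using l by (intro add_pos_nonneg) auto
  let ?u = "\<lambda>k::real^'d. complex_of_real (norm k powr j / sqrt (?w k))"
  let ?v = "\<lambda>k. of_real (sqrt (?w k)) * g k"
  have u2: "(norm (?u k))\<^sup>2 = norm k powr (2 * j) / ?w k" for k
  proof -
    have "norm k powr (2 * j) = (norm k powr j)\<^sup>2" by (simp add: power2_eq_square flip: powr_add)
    then show ?thesis using w[of k] unfolding norm_of_real by (simp add: power_divide)
  qed
  have v2: "(norm (?v k))\<^sup>2 = (norm (g k))\<^sup>2 + l * (norm (of_real (norm k powr n) * g k))\<^sup>2" for k
  proof -
    have "norm k powr (2 * n) = (norm k powr n)\<^sup>2" by (simp add: power2_eq_square flip: powr_add)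
    then show ?thesis using w[of k] by (simp add: norm_mult power_mult_distrib distrib_right)
  qed
  have uv: "?u k * ?v k = of_real (norm k powr j) * g k" for k
    using w[of k] by (simp add: less_imp_neq[symmetric])
  have iu: "integrable lborel (\<lambda>k. (norm (?u k))\<^sup>2)"
    unfolding u2 by (rule radial_integral(1)[OF n j \<theta> l])
  have iv: "integrable lborel (\<lambda>k. (norm (?v k))\<^sup>2)"
    unfolding v2 using L2_fun_integrable[OF g] L2_fun_integrable[OF ng] by simp
  show "integrable lborel (\<lambda>k. of_real (norm k powr j) * g k)"
    using L2_product(1)[OF _ _ iu iv] unfolding uv by simp
  have "(LINT k|lborel. norm (?u k * ?v k))\<^sup>2 \<le> (LINT k|lborel. (norm (?u k))\<^sup>2) * (LINT k|lborel. (norm (?v k))\<^sup>2)"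
    by (rule L2_product(2)[OF _ _ iu iv]) measurable
  moreover have "(LINT k|lborel. (norm (?v k))\<^sup>2) = L2_sq g + l * L2_sq (\<lambda>k. of_real (norm k powr n) * g k)"
    unfolding v2 L2_sq_def using L2_fun_integrable[OF g] L2_fun_integrable[OF ng] by simp
  ultimately show "(LINT k|lborel. norm (of_real (norm k powr j) * g k))\<^sup>2
      \<le> l powr (- \<theta>) * radial_const TYPE('d) n \<theta> * (L2_sq g + l * L2_sq (\<lambda>k. of_real (norm k powr n) * g k))"
    unfolding uv u2 radial_integral(2)[OF n j \<theta> l] by simp
qed

lemma L2_sq_eq_0:
  assumes u: "u \<in> L2_fun" and z: "L2_sq u = 0"
  shows "AE x in lborel. u x = 0"
proof -
  have "AE x in lborel. (norm (u x))\<^sup>2 = 0"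
    using z integral_nonneg_eq_0_iff_AE[OF L2_fun_integrable[OF u]] by (simp add: L2_sq_def)
  then show ?thesis by simp
qed

text \<open>The right-hand side of \<open>weighted_L1_bound\<close> is minimal in \<open>l\<close> where \<open>l B / (A + l B) = \<theta>\<close>, with \<open>A\<close> and
  \<open>B\<close> the squared norms. If one of the norms is zero there is no such \<open>l\<close>, but then \<open>g\<close> vanishes.\<close>

lemma weighted_L1_bound_optimal:
  fixes g :: "'d::finite fn" and n j \<theta> :: real
  assumes n: "0 < n" and j: "0 \<le> j" and \<theta>: "\<theta> = j / n + real CARD('d) / (2 * n)" "\<theta> < 1"
    and g: "g \<in> L2_fun" and ng: "(\<lambda>k. of_real (norm k powr n) * g k) \<in> L2_fun"
  shows "(LINT k|lborel. norm (of_real (norm k powr j) * g k))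
      \<le> sqrt (radial_const TYPE('d) n \<theta>) / sqrt ((1 - \<theta>) powr (1 - \<theta>) * \<theta> powr \<theta>) *
        sqrt (L2_sq g) powr (1 - \<theta>) * sqrt (L2_sq (\<lambda>k. of_real (norm k powr n) * g k)) powr \<theta>"
proof -
  note [measurable] = L2_fun_measurable[OF g]
  let ?I = "radial_const TYPE('d) n \<theta>"
  let ?p = "LINT k|lborel. norm (of_real (norm k powr j) * g k)"
  let ?h = "\<lambda>k. of_real (norm k powr n) * g k"
  let ?A = "L2_sq g" and ?B = "L2_sq ?h"
  note \<theta>0 = radial_integral(4)[OF n j \<theta> zero_less_one]
  note I = radial_integral(3)[OF n j \<theta> zero_less_one]
  show ?thesis
  proof (cases "?A = 0 \<or> ?B = 0")
    case True
    then have "AE k in lborel. g k = 0"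
    proof
      assume "?B = 0"
      from L2_sq_eq_0[OF ng this] AE_lborel_singleton[of "0::real^'d"]
      show ?thesis by eventually_elim auto
    qed (rule L2_sq_eq_0[OF g])
    then have "?p = (LINT k|(lborel :: (real^'d) measure). 0)"
      by (intro integral_cong_AE) auto
    then show ?thesis using I by simp
  next
    case False
    then have A: "0 < ?A" and B: "0 < ?B" using L2_sq_nonneg[of g] L2_sq_nonneg[of ?h] by linarith+
    \<comment> \<open>the minimiser of \<open>l powr (- \<theta>) * (A + l * B)\<close>\<close>
    define l where "l = \<theta> * ?A / ((1 - \<theta>) * ?B)"
    have l: "0 < l" unfolding l_def using A B \<theta>0 \<theta>(2) by simp
    have "?A + l * ?B = ?A / (1 - \<theta>)" unfolding l_def using A B \<theta>(2) by (simp add: field_simps)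
    then have "?p\<^sup>2 \<le> l powr (- \<theta>) * ?I * (?A / (1 - \<theta>))"
      using weighted_L1_bound(2)[OF n j \<theta> l g ng] by simp
    also have "\<dots> = ?I / ((1 - \<theta>) powr (1 - \<theta>) * \<theta> powr \<theta>) * (?A powr (1 - \<theta>) * ?B powr \<theta>)"
    proof -
      have "l powr (- \<theta>) = ((1 - \<theta>) powr \<theta> * ?B powr \<theta>) / (\<theta> powr \<theta> * ?A powr \<theta>)"
        unfolding l_def using A B \<theta>0 \<theta>(2) by (simp add: powr_minus powr_divide powr_mult)
      moreover have "?A powr (1 - \<theta>) = ?A / ?A powr \<theta>" using A by (simp add: powr_diff)
      moreover have "(1 - \<theta>) powr (1 - \<theta>) = (1 - \<theta>) / (1 - \<theta>) powr \<theta>" using \<theta>(2) by (simp add: powr_diff)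
      ultimately show ?thesis by (simp add: field_simps)
    qed
    finally have "?p \<le> sqrt (?I / ((1 - \<theta>) powr (1 - \<theta>) * \<theta> powr \<theta>) * (?A powr (1 - \<theta>) * ?B powr \<theta>))"
      by (rule real_le_rsqrt)
    also have "\<dots> = sqrt ?I / sqrt ((1 - \<theta>) powr (1 - \<theta>) * \<theta> powr \<theta>) * sqrt ?A powr (1 - \<theta>) * sqrt ?B powr \<theta>"
    proof -
      have "sqrt (x powr y) = sqrt x powr y" if "0 < x" for x y :: real
        using that by (simp add: powr_half_sqrt[symmetric] powr_powr mult.commute)
      then show ?thesis using A B by (simp add: real_sqrt_mult real_sqrt_divide)
    qed
    finally show ?thesis .
  qed
qed

lemma Linf_norm_le:
  fixes g :: "'d::finite fn"
  assumes g: "integrable lborel g"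
  shows "Linf_norm (spectral g) \<le> fconst TYPE('d) * (LINT k|lborel. norm (g k))"
  unfolding Linf_norm_spectral(2)[OF g] by (rule cSUP_least) (auto intro: norm_fourier_le)

text \<open>For a nonnegative density the waves do not oscillate at the origin, so the supremum is attained there.\<close>

lemma Linf_norm_nonneg_density:
  fixes g :: "real^'d::finite \<Rightarrow> real"
  assumes g: "integrable lborel g" and pos: "\<And>k. 0 \<le> g k"
  shows "Linf_norm (spectral (\<lambda>k. of_real (g k))) = fconst TYPE('d) * (LINT k|lborel. g k)"
proof (rule antisym)
  let ?g = "\<lambda>k. complex_of_real (g k)"
  have ig: "integrable lborel ?g" using g by simp
  have n: "(LINT k|lborel. norm (?g k)) = (LINT k|lborel. g k)" using pos by simp
  show "Linf_norm (spectral ?g) \<le> fconst TYPE('d) * (LINT k|lborel. g k)"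
    using Linf_norm_le[OF ig] unfolding n .
  have "norm (fourier ?g (- 0)) \<le> (SUP x. norm (fourier ?g (- x)))"
    by (rule cSUP_upper) (auto intro!: bdd_aboveI2 norm_fourier_le)
  moreover have "norm (fourier ?g 0) = fconst TYPE('d) * (LINT k|lborel. g k)"
  proof -
    have "0 \<le> (LINT k|lborel. g k)" using pos by (intro integral_nonneg_AE) simp
    then show ?thesis using fconst_pos[where 'd='d] by (simp add: fourier_eq norm_mult)
  qed
  ultimately show "fconst TYPE('d) * (LINT k|lborel. g k) \<le> Linf_norm (spectral ?g)"
    unfolding Linf_norm_spectral(2)[OF ig] by simp
qed

text \<open>Here Cauchy-Schwarz is an equality for \<open>l = 1\<close>. As \<open>weighted_L1_bound\<close> holds for all \<open>l\<close>, the function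
  \<open>l \<mapsto> l^(-\<theta>) (A + l B)\<close> has a minimum at 1, and the vanishing of its derivative gives both norms
  without a further integration.\<close>

lemma maximizer_density:
  fixes n j \<theta> :: real and g :: "'d::finite fn"
  assumes n: "0 < n" and j: "0 \<le> j" and \<theta>: "\<theta> = j / n + real CARD('d) / (2 * n)" "\<theta> < 1"
    and g_def: "g = (\<lambda>k. of_real (norm k powr j / (1 + norm k powr (2 * n))))"
  shows "g \<in> L2_fun" and "(\<lambda>k. of_real (norm k powr n) * g k) \<in> L2_fun"
    and "L2_sq g = (1 - \<theta>) * radial_const TYPE('d) n \<theta>"
    and "L2_sq (\<lambda>k. of_real (norm k powr n) * g k) = \<theta> * radial_const TYPE('d) n \<theta>"
    and "Linf_norm (spectral (\<lambda>k. of_real (norm k powr j) * g k)) = fconst TYPE('d) * radial_const TYPE('d) n \<theta>"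
proof -
  let ?I = "radial_const TYPE('d) n \<theta>"
  let ?r = "\<lambda>k::real^'d. norm k powr (2 * j) / (1 + norm k powr (2 * n))"
  let ?h = "\<lambda>k. of_real (norm k powr n) * g k"
  note I = radial_integral(3)[OF n j \<theta> zero_less_one]
  have ir: "integrable lborel ?r" and Ir: "(LINT k|lborel. ?r k) = ?I"
    using radial_integral(1,2)[OF n j \<theta> zero_less_one] by simp_all
  have w: "0 < 1 + norm k powr (2 * n)" for k :: "real^'d" by (intro add_pos_nonneg) auto
  have sq: "norm k powr (2 * s) = (norm k powr s)\<^sup>2" for s and k :: "real^'d"
    by (simp add: power2_eq_square flip: powr_add)
  have [measurable]: "g \<in> borel_measurable borel" unfolding g_def by measurable
  have g2: "(norm (g k))\<^sup>2 = norm k powr (2 * j) / (1 + norm k powr (2 * n))\<^sup>2" for k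
    unfolding g_def norm_of_real by (simp add: power_divide sq)
  have h2: "(norm (?h k))\<^sup>2 = norm k powr (2 * n) * (norm k powr (2 * j) / (1 + norm k powr (2 * n))\<^sup>2)" for k
    unfolding norm_mult power_mult_distrib g2 by (simp add: sq)
  have sum: "(norm (g k))\<^sup>2 + (norm (?h k))\<^sup>2 = ?r k" for k
  proof -
    let ?w = "1 + norm k powr (2 * n)"
    have "(norm (g k))\<^sup>2 + (norm (?h k))\<^sup>2 = ?w * (norm k powr (2 * j) / ?w\<^sup>2)"
      unfolding g2 h2 by (simp only: distrib_right mult_1_left)
    also have "\<dots> = ?r k" using w[of k] by (simp add: power2_eq_square)
    finally show ?thesis .
  qed
  have ig: "integrable lborel (\<lambda>k. (norm (g k))\<^sup>2)"
  proof (rule Bochner_Integration.integrable_bound[OF ir _ AE_I2])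
    show "norm ((norm (g k))\<^sup>2) \<le> norm (?r k)" for k
      unfolding sum[symmetric] by simp
  qed measurable
  have ih: "integrable lborel (\<lambda>k. (norm (?h k))\<^sup>2)"
  proof (rule Bochner_Integration.integrable_bound[OF ir _ AE_I2])
    show "norm ((norm (?h k))\<^sup>2) \<le> norm (?r k)" for k
      unfolding sum[symmetric] by simp
  qed measurable
  show gL: "g \<in> L2_fun" by (rule L2_fun_I[OF _ ig]) measurable
  show hL: "?h \<in> L2_fun" by (rule L2_fun_I[OF _ ih]) measurable
  have AB: "L2_sq g + L2_sq ?h = ?I"
    unfolding L2_sq_def Ir[symmetric] sum[symmetric] by (rule Bochner_Integration.integral_add[OF ig ih, symmetric])
  have jg: "of_real (norm k powr j) * g k = of_real (?r k)" for k
    unfolding g_def by (simp add: sq power2_eq_square)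
  have r0: "0 \<le> ?r k" for k using w[of k] by simp
  show "Linf_norm (spectral (\<lambda>k. of_real (norm k powr j) * g k)) = fconst TYPE('d) * ?I"
    unfolding jg Linf_norm_nonneg_density[OF ir r0] Ir ..
  have p: "(LINT k|lborel. norm (of_real (norm k powr j) * g k)) = ?I"
    unfolding jg norm_of_real abs_of_nonneg[OF r0] by (rule Ir)
  let ?\<phi> = "\<lambda>l. l powr (- \<theta>) * (L2_sq g + l * L2_sq ?h)"
  have le: "?I \<le> ?\<phi> l" if l: "0 < l" for l
  proof -
    have "?I * ?I \<le> ?I * ?\<phi> l"
      using weighted_L1_bound(2)[OF n j \<theta> l gL hL] unfolding p by (simp add: power2_eq_square mult_ac)
    then show ?thesis using I by simp
  qed
  have D: "(?\<phi> has_real_derivative (- \<theta> * (L2_sq g + L2_sq ?h) + L2_sq ?h)) (at 1)"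
    by (auto intro!: derivative_eq_intros)
  have "\<forall>y. \<bar>1 - y\<bar> < 1 \<longrightarrow> ?\<phi> 1 \<le> ?\<phi> y"
    using le AB by auto
  from DERIV_local_min[OF D zero_less_one this]
  have "- \<theta> * (L2_sq g + L2_sq ?h) + L2_sq ?h = 0" .
  then show B: "L2_sq ?h = \<theta> * ?I" unfolding AB by simp
  then show "L2_sq g = (1 - \<theta>) * ?I" using AB by (simp add: left_diff_distrib)
qed

theorem corollary5p12:
  fixes n j \<theta> :: real
  assumes "0 < n" and "0 \<le> j"
    and "\<theta> = j / n + real CARD('d::finite) / (2 * n)"
    and "\<theta> < 1"
  shows "(H n :: 'd functional set) \<subseteq> L2inf j \<and>
    (\<exists>G\<ge>0. \<forall>f \<in> (H n :: 'd functional set). GN_inequality j n \<theta> G f) \<and>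
    (\<exists>G S.
       is_sharp_constant (\<lambda>C. \<forall>f \<in> (H n :: 'd functional set). GN_inequality j n \<theta> C f) G \<and>
       is_sharp_constant (\<lambda>C. \<forall>f \<in> (H n :: 'd functional set). S_inequality j n C f) S \<and>
       G = S / sqrt ((1 - \<theta>) powr (1 - \<theta>) * \<theta> powr \<theta>) \<and>
       G = 1 / (2 powr (real CARD('d) / 2) * pi powr (real CARD('d) / 4 - 1 / 2) *
             sqrt (Gamma (real CARD('d) / 2) * (1 - \<theta>) powr (1 - \<theta>) * \<theta> powr \<theta> *
                   n * sin (pi * \<theta>))) \<and>
       GN_maximizer j n \<theta> G
         (inv_fourier_dual (as_functional Psi
            (\<lambda>k :: real ^ 'd. of_real (norm k powr j / (1 + norm k powr (2 * n)))))))"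
proof -
  note n = assms(1) and j = assms(2) and \<theta> = assms(3,4)
  note \<theta>0 = radial_integral(4)[OF n j \<theta> zero_less_one]
  let ?I = "radial_const TYPE('d) n \<theta>"
  let ?c = "fconst TYPE('d)"
  let ?q = "(1 - \<theta>) powr (1 - \<theta>) * \<theta> powr \<theta>"
  define S where "S = ?c * sqrt ?I"
  define G where "G = S / sqrt ?q"
  define g where "g = (\<lambda>k::real^'d. complex_of_real (norm k powr j / (1 + norm k powr (2 * n))))"
  define f where "f = spectral g"
  have I: "0 < ?I" by (rule radial_integral(3)[OF n j \<theta> zero_less_one])
  have c: "0 < ?c" by (rule fconst_pos)
  have q: "0 < ?q" using \<theta>0 \<theta>(2) by simp
  have S: "0 < S" unfolding S_def using c I by simp
  have G: "0 < G" unfolding G_def using S q by simp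

  have density: "f' \<in> L2inf j" "Linf_norm (frac_deriv j f') \<le> ?c * (LINT k|lborel. norm (of_real (norm k powr j) * g' k))"
      "L2_norm f' = sqrt (L2_sq g')" "L2_norm (frac_deriv n f') = sqrt (L2_sq (\<lambda>k. of_real (norm k powr n) * g' k))"
    if g': "g' \<in> L2_fun" "(\<lambda>k. of_real (norm k powr n) * g' k) \<in> L2_fun" and f': "f' = spectral g'"
    for f' :: "'d functional" and g'
  proof -
    note t = L2_tempered[OF g'(1)]
    note i = weighted_L1_bound(1)[OF n j \<theta> zero_less_one g']
    have dj: "frac_deriv j f' = spectral (\<lambda>k. of_real (norm k powr j) * g' k)"
      unfolding f' by (rule frac_deriv_spectral[OF t j])
    have dn: "frac_deriv n f' = spectral (\<lambda>k. of_real (norm k powr n) * g' k)"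
      unfolding f' using n by (intro frac_deriv_spectral[OF t]) simp
    show "f' \<in> L2inf j"
      unfolding L2inf_def using Linf_norm_spectral(1)[OF i] L2_norm_spectral(1)[OF g'(1)] by (simp add: dj) (simp add: f')
    show "Linf_norm (frac_deriv j f') \<le> ?c * (LINT k|lborel. norm (of_real (norm k powr j) * g' k))"
      unfolding dj by (rule Linf_norm_le[OF i])
    show "L2_norm f' = sqrt (L2_sq g')" unfolding f' by (rule L2_norm_spectral(2)[OF g'(1)])
    show "L2_norm (frac_deriv n f') = sqrt (L2_sq (\<lambda>k. of_real (norm k powr n) * g' k))"
      unfolding dn by (rule L2_norm_spectral(2)[OF g'(2)])
  qed
  have Hn: "f' \<in> H n \<longleftrightarrow> (\<exists>g'. g' \<in> L2_fun \<and> (\<lambda>k. of_real (norm k powr n) * g' k) \<in> L2_fun \<and> f' = spectral g')"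
    for f' :: "'d functional"
    using n by (intro H_iff_density) simp

  have incl: "(H n :: 'd functional set) \<subseteq> L2inf j" using Hn density(1) by blast
  have GN: "GN_inequality j n \<theta> G f'" if f': "f' \<in> H n" for f' :: "'d functional"
  proof -
    obtain g' where g': "g' \<in> L2_fun" "(\<lambda>k. of_real (norm k powr n) * g' k) \<in> L2_fun" "f' = spectral g'"
      using f' Hn by blast
    note D = density[OF g']
    note D(2)
    also have "?c * (LINT k|lborel. norm (of_real (norm k powr j) * g' k))
      \<le> ?c * (sqrt ?I / sqrt ?q * sqrt (L2_sq g') powr (1 - \<theta>) * sqrt (L2_sq (\<lambda>k. of_real (norm k powr n) * g' k)) powr \<theta>)"
      by (rule mult_left_mono[OF weighted_L1_bound_optimal[OF n j \<theta> g'(1,2)] less_imp_le[OF c]])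
    also have "\<dots> = G * sqrt (L2_sq g') powr (1 - \<theta>) * sqrt (L2_sq (\<lambda>k. of_real (norm k powr n) * g' k)) powr \<theta>"
      by (simp only: G_def S_def mult.assoc times_divide_eq_right times_divide_eq_left)
    finally show ?thesis unfolding GN_inequality_def D(3,4) .
  qed
  have SI: "S_inequality j n S f'" if f': "f' \<in> H n" for f' :: "'d functional"
  proof -
    obtain g' where g': "g' \<in> L2_fun" "(\<lambda>k. of_real (norm k powr n) * g' k) \<in> L2_fun" "f' = spectral g'"
      using f' Hn by blast
    note D = density[OF g']
    let ?X = "L2_sq g' + L2_sq (\<lambda>k. of_real (norm k powr n) * g' k)"
    have "(LINT k|lborel. norm (of_real (norm k powr j) * g' k))\<^sup>2 \<le> ?I * ?X"
      using weighted_L1_bound(2)[OF n j \<theta> zero_less_one g'(1,2)] by simp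
    then have "(LINT k|lborel. norm (of_real (norm k powr j) * g' k)) \<le> sqrt (?I * ?X)" by (rule real_le_rsqrt)
    then have "?c * (LINT k|lborel. norm (of_real (norm k powr j) * g' k)) \<le> ?c * sqrt (?I * ?X)"
      by (rule mult_left_mono[OF _ less_imp_le[OF c]])
    also have "\<dots> = S * sqrt ?X" by (simp only: S_def real_sqrt_mult mult.assoc)
    finally have "Linf_norm (frac_deriv j f') \<le> S * sqrt ?X" using D(2) by linarith
    moreover have "(sqrt (L2_sq g'))\<^sup>2 + (sqrt (L2_sq (\<lambda>k. of_real (norm k powr n) * g' k)))\<^sup>2 = ?X"
      by (simp only: real_sqrt_pow2 L2_sq_nonneg)
    ultimately show ?thesis unfolding S_inequality_def D(3,4) by (simp only:)
  qed

  note M = maximizer_density[OF n j \<theta> g_def]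
  have fH: "f \<in> H n" unfolding Hn by (intro exI[of _ g] conjI M(1,2) f_def)
  have fj: "Linf_norm (frac_deriv j f) = ?c * ?I"
    unfolding f_def frac_deriv_spectral[OF L2_tempered[OF M(1)] j] by (rule M(5))
  have f2: "L2_norm f = sqrt ((1 - \<theta>) * ?I)" "L2_norm (frac_deriv n f) = sqrt (\<theta> * ?I)"
    using density(3,4)[OF M(1,2) f_def] unfolding M(3,4) by simp_all
  let ?N = "L2_norm f powr (1 - \<theta>) * L2_norm (frac_deriv n f) powr \<theta>"
  have N: "?N = sqrt ?q * sqrt ?I"
  proof -
    have e: "sqrt x powr y = sqrt (x powr y)" if "0 < x" for x y :: real
      using that by (simp add: powr_half_sqrt[symmetric] powr_powr mult.commute)
    have "?N = sqrt (((1 - \<theta>) * ?I) powr (1 - \<theta>) * (\<theta> * ?I) powr \<theta>)"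
    proof -
      have p: "0 < (1 - \<theta>) * ?I" "0 < \<theta> * ?I" using I \<theta>0 \<theta>(2) by simp_all
      show ?thesis unfolding f2 e[OF p(1)] e[OF p(2)] by (rule real_sqrt_mult[symmetric])
    qed
    also have "((1 - \<theta>) * ?I) powr (1 - \<theta>) * (\<theta> * ?I) powr \<theta> = ?q * (?I powr (1 - \<theta>) * ?I powr \<theta>)"
      using I \<theta>0 \<theta>(2) by (simp add: powr_mult)
    also have "?I powr (1 - \<theta>) * ?I powr \<theta> = ?I" using I by (simp flip: powr_add)
    finally show ?thesis by (simp add: real_sqrt_mult)
  qed
  have Npos: "0 < ?N" unfolding N using q I by simp
  have eqG: "Linf_norm (frac_deriv j f) = G * ?N"
    unfolding fj N G_def S_def using I \<theta>0 \<theta>(2) by simp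
  have eqS: "Linf_norm (frac_deriv j f) = S * sqrt ((L2_norm f)\<^sup>2 + (L2_norm (frac_deriv n f))\<^sup>2)"
  proof -
    have "(L2_norm f)\<^sup>2 + (L2_norm (frac_deriv n f))\<^sup>2 = ?I"
      unfolding f2 using I \<theta>0 \<theta>(2) by (simp add: left_diff_distrib)
    then show ?thesis unfolding fj S_def using I by simp
  qed

  have sharpG: "is_sharp_constant (\<lambda>C. \<forall>f \<in> (H n :: 'd functional set). GN_inequality j n \<theta> C f) G"
    unfolding is_sharp_constant_def
  proof (intro conjI ballI allI impI)
    fix C' :: real assume "\<forall>f \<in> (H n :: 'd functional set). GN_inequality j n \<theta> C' f"
    then have "G * ?N \<le> C' * ?N" using fH unfolding GN_inequality_def eqG[symmetric] by (simp add: mult.assoc)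
    then show "G \<le> C'" by (rule mult_right_le_imp_le[OF _ Npos])
  qed (use G GN in auto)
  have sharpS: "is_sharp_constant (\<lambda>C. \<forall>f \<in> (H n :: 'd functional set). S_inequality j n C f) S"
    unfolding is_sharp_constant_def
  proof (intro conjI ballI allI impI)
    let ?R = "sqrt ((L2_norm f)\<^sup>2 + (L2_norm (frac_deriv n f))\<^sup>2)"
    fix C' :: real assume "\<forall>f \<in> (H n :: 'd functional set). S_inequality j n C' f"
    then have "S * ?R \<le> C' * ?R" using fH unfolding S_inequality_def eqS[symmetric] by simp
    moreover have "0 < ?R"
      unfolding f2 using I \<theta>0 \<theta>(2) by (simp add: add_pos_pos)
    ultimately show "S \<le> C'" by (rule mult_right_le_imp_le)
  qed (use S SI in auto)

  have nz: "f \<noteq> as_functional Phi (\<lambda>_. 0)"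
  proof
    assume "f = as_functional Phi (\<lambda>_. 0)"
    then have "spectral g = spectral (\<lambda>_. 0)" by (simp add: f_def as_functional_def spectral_def)
    then have "AE k in lborel. g k = 0"
      by (rule spectral_unique[OF L2_tempered[OF M(1)] L1_tempered, rotated]) simp
    then have "L2_sq g = L2_sq (\<lambda>_::real^'d. 0)"
      by (intro L2_sq_cong_AE L2_fun_measurable[OF M(1)]) auto
    then show False using M(3) I \<theta>(2) by (simp add: L2_sq_def)
  qed
  have max: "GN_maximizer j n \<theta> G f"
    unfolding GN_maximizer_def using fH nz eqG by (simp add: mult.assoc)

  have val: "G = 1 / (2 powr (real CARD('d) / 2) * pi powr (real CARD('d) / 4 - 1 / 2) *
      sqrt (Gamma (real CARD('d) / 2) * (1 - \<theta>) powr (1 - \<theta>) * \<theta> powr \<theta> * n * sin (pi * \<theta>)))"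
  proof -
    let ?d = "real CARD('d)"
    let ?\<Gamma> = "Gamma (?d / 2)"
    have "sqrt (pi powr (?d / 2 + 1)) = pi powr (?d / 4 + 1 / 2)"
      by (simp add: powr_half_sqrt[symmetric] powr_powr add_divide_distrib)
    then have "sqrt ?I = pi powr (?d / 4 + 1 / 2) / sqrt (n * ?\<Gamma> * sin (pi * \<theta>))"
      by (simp add: radial_const_def real_sqrt_divide)
    moreover have "?c = 1 / (2 powr (?d / 2) * pi powr (?d / 2))"
      by (simp add: fconst_def powr_minus_divide powr_mult)
    ultimately have "G = pi powr (?d / 4 + 1 / 2) / pi powr (?d / 2) / (2 powr (?d / 2) * (sqrt (n * ?\<Gamma> * sin (pi * \<theta>)) * sqrt ?q))"
      by (simp add: G_def S_def)
    also have "pi powr (?d / 4 + 1 / 2) / pi powr (?d / 2) = 1 / pi powr (?d / 4 - 1 / 2)"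
      by (simp add: powr_minus_divide[symmetric] powr_diff[symmetric])
    also have "sqrt (n * ?\<Gamma> * sin (pi * \<theta>)) * sqrt ?q = sqrt (?\<Gamma> * (1 - \<theta>) powr (1 - \<theta>) * \<theta> powr \<theta> * n * sin (pi * \<theta>))"
      unfolding real_sqrt_mult[symmetric] by (simp only: mult_ac)
    finally show ?thesis by (simp add: mult_ac)
  qed
  have f_eq: "inv_fourier_dual (as_functional Psi (\<lambda>k :: real ^ 'd. of_real (norm k powr j / (1 + norm k powr (2 * n))))) = f"
    unfolding f_def g_def[symmetric] by (rule inv_fourier_dual_as_functional[OF L2_tempered[OF M(1)]])
  show ?thesis
    unfolding f_eq using incl GN G sharpG sharpS val max G_def less_imp_le[OF G] by blast
qed

end
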